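(* Let $G$ be a finite group with a split BN-pair of characteristic $p$ and rank $\ell$, let $I=\{1,\ldots,\ell\}$, let $J,K\subset I$ be opposite cotypes, and let $k$ be an algebraically closed field of characteristic $p$. Let $\eta:\mathcal{F}_J\to\mathcal{F}_K$ be the $kG$-homomorphism defined by the oppositeness relation, $$\eta(f)(P_Kh)=\sum_{P_Jg\subseteq P_Jw_0P_Kh}f(P_Jg)\qquad (f\in\mathcal{F}_J,\ h\in G),$$ the sum being over the cosets $P_Jg$ contained in $P_Jw_0P_Kh$. Then the image of $\eta$ is a simple $kG$-module, and it is uniquely characterized (up to isomorphism, among simple $kG$-modules) by the property that its one-dimensional subspace of $U$-fixed points has full stabilizer in $G$ equal to $P_J$, and $P_J$ acts trivially on this subspace.
   Context: $G$ is a finite group with a split BN-pair of characteristic $p$: $G$ has a BN-pair $(B,N)$, $B=UH$ with $U$ a normal $p$-subgroup of $B$ ($U$ is a Sylow $p$-subgroup of $G$), $H=B\cap N$ an abelian group of order prime to $p$, $U\cap H=1$, $H=\bigcap_{n\in N}nBn^{-1}$. The Weyl group $W=N/H$ is a euclidean reflection group on a real vector space $V$ containing a root system $R$ with simple roots $S=\{\alpha_i\mid i\in I\}$; $W$ is a Coxeter group with generators the fundamental reflections $w_i$ ($i\in I$), $w_i$ being the reflection in the hyperplane perpendicular to $\alpha_i$. $w_0$ is the longest element of $W$, sending all positive roots to negative roots. An element of $W$ appearing in a product of subsets of $G$ stands for any preimage in $N$. For $J\subset I$, $W_J=\langle w_i\mid i\in J\rangle$ and $P_J=BW_JB$ is the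 standard parabolic subgroup. A type is a nonempty subset of $I$. An object of cotype $J$ (equivalently, of type $I\setminus J$) is a right coset $P_Jg$ of $P_J$ in $G$. Two types $J',K'$ are opposite if $\{-w_0(\alpha_i)\mid i\in J'\}=\{\alpha_j\mid j\in K'\}$; $J,K$ are opposite cotypes if the types $I\setminus J$ and $I\setminus K$ are opposite. For opposite cotypes $J,K$, objects $P_Jg$ and $P_Kh$ are opposite if $P_Khg^{-1}P_J=P_Kw_0P_J$, equivalently $P_Jg\subseteq P_Jw_0P_Kh$. $\mathcal{F}_J$ is the $k$-space of functions from the set $P_J\backslash G$ of right cosets to $k$, a left $kG$-module via $(xf)(P_Jg)=f(P_Jgx)$ for $x,g\in G$. In every simple $kG$-module the subspace of $U$-fixed points is one-dimensional. *)

theory Defs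
  imports
    "HOL-Analysis.Analysis"
    "HOL-Algebra.Generated_Groups"
    "HOL-Computational_Algebra.Polynomial"
    "HOL-Library.Function_Algebras"
begin

section \<open>Split BN-pairs\<close>

text \<open>The group \<open>W = N/H\<close> with \<open>H = B \<inter> N\<close>.  An element \<open>x\<close> of \<open>W\<close> is a coset of \<open>H\<close>, hence a
  subset of \<open>G\<close>.  As \<open>H \<subseteq> B\<close> is normal in \<open>N\<close>, the set product \<open>B <#> x <#> B\<close> equals \<open>BnB\<close> for
  every preimage \<open>n\<close> of \<open>x\<close> in \<open>N\<close>, and likewise for all products in which a neighbour of \<open>x\<close>
  contains \<open>H\<close>.\<close>

definition weyl_group :: "('g, 'x) monoid_scheme \<Rightarrow> 'g set \<Rightarrow> 'g set \<Rightarrow> 'g set monoid"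
  where "weyl_group G B N = (G\<lparr>carrier := N\<rparr>) Mod (B \<inter> N)"

locale BN_pair = group G for G (structure) +
  fixes B N :: "'a set" and I :: "'i set" and w :: "'i \<Rightarrow> 'a set"
  assumes B_subgroup: "subgroup B G"
    and N_subgroup: "subgroup N G"
    and BN_generate: "generate G (B \<union> N) = carrier G"
    and H_normal: "(B \<inter> N) \<lhd> (G\<lparr>carrier := N\<rparr>)"
    and w_in_W: "i \<in> I \<Longrightarrow> w i \<in> carrier (weyl_group G B N)"
    and w_involution: "i \<in> I \<Longrightarrow> w i \<noteq> \<one>\<^bsub>weyl_group G B N\<^esub>"
      "i \<in> I \<Longrightarrow> w i \<otimes>\<^bsub>weyl_group G B N\<^esub> w i = \<one>\<^bsub>weyl_group G B N\<^esub>"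
    and w_generate: "generate (weyl_group G B N) (w ` I) = carrier (weyl_group G B N)"
    and BN_mult: "i \<in> I \<Longrightarrow> x \<in> carrier (weyl_group G B N) \<Longrightarrow>
      w i <#> B <#> x \<subseteq> (B <#> x <#> B) \<union> (B <#> (w i \<otimes>\<^bsub>weyl_group G B N\<^esub> x) <#> B)"
    and BN_nontrivial: "i \<in> I \<Longrightarrow> w i <#> B <#> w i \<noteq> B"

text \<open>That \<open>U\<close> is a Sylow \<open>p\<close>-subgroup of \<open>G\<close> is a consequence and not an axiom.\<close>

locale finite_split_BN_pair = BN_pair +
  fixes U :: "'a set" and p :: nat
  assumes finite_G: "finite (carrier G)"
    and p_prime: "prime p"
    and U_normal: "U \<lhd> (G\<lparr>carrier := B\<rparr>)"
    and U_p_group: "\<exists>a. card U = p ^ a"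
    and H_abelian: "comm_group (G\<lparr>carrier := B \<inter> N\<rparr>)"
    and H_coprime: "coprime (card (B \<inter> N)) p"
    and B_eq: "B = U <#> (B \<inter> N)"
    and U_H_disjoint: "U \<inter> (B \<inter> N) = {\<one>}"
    and H_saturated: "B \<inter> N = (\<Inter>n\<in>N. (n <# B) #> inv n)"


section \<open>The root system\<close>

definition reflection :: "'v::euclidean_space \<Rightarrow> 'v \<Rightarrow> 'v"
  where "reflection a x = x - (2 * (x \<bullet> a) / (a \<bullet> a)) *\<^sub>R a"

text \<open>No integrality condition is imposed: the Weyl group of a finite split BN-pair need not be
  crystallographic (for the groups of type \<open>\<^sup>2F\<^sub>4\<close> it is dihedral of order 16).\<close>

definition root_system :: "'v::euclidean_space set \<Rightarrow> bool"
  where "root_system R \<longleftrightarrow> finite R \<and> 0 \<notin> R \<and>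
    (\<forall>a\<in>R. R \<inter> span {a} = {a, - a}) \<and> (\<forall>a\<in>R. reflection a ` R = R)"

definition simple_roots :: "'v::euclidean_space set \<Rightarrow> 'i set \<Rightarrow> ('i \<Rightarrow> 'v) \<Rightarrow> bool"
  where "simple_roots R I \<alpha> \<longleftrightarrow> \<alpha> ` I \<subseteq> R \<and> inj_on \<alpha> I \<and> independent (\<alpha> ` I) \<and>
    (\<forall>r\<in>R. \<exists>c. r = (\<Sum>i\<in>I. c i *\<^sub>R \<alpha> i) \<and> ((\<forall>i\<in>I. c i \<ge> 0) \<or> (\<forall>i\<in>I. c i \<le> 0)))"

text \<open>\<open>\<rho>\<close> realises \<open>W\<close> as a group of isometries of the euclidean space \<open>V\<close>, which is the type
  \<open>'v\<close>; the root system is not required to span \<open>V\<close>.\<close>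

locale split_BN_pair_with_roots = finite_split_BN_pair +
  fixes \<rho> :: "'a set \<Rightarrow> 'v::euclidean_space \<Rightarrow> 'v" and R :: "'v set" and \<alpha> :: "'b \<Rightarrow> 'v"
  assumes roots: "root_system R"
    and simple: "simple_roots R I \<alpha>"
    and \<rho>_orthogonal: "x \<in> carrier (weyl_group G B N) \<Longrightarrow> orthogonal_transformation (\<rho> x)"
    and \<rho>_mult: "x \<in> carrier (weyl_group G B N) \<Longrightarrow> y \<in> carrier (weyl_group G B N) \<Longrightarrow>
      \<rho> (x \<otimes>\<^bsub>weyl_group G B N\<^esub> y) = \<rho> x \<circ> \<rho> y"
    and \<rho>_faithful: "inj_on \<rho> (carrier (weyl_group G B N))"
    and \<rho>_reflection: "i \<in> I \<Longrightarrow> \<rho> (w i) = reflection (\<alpha> i)"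


section \<open>Length, parabolic subgroups and opposition\<close>

text \<open>Inverses of generators are not needed in words, the generators being involutions.\<close>

definition coxeter_length :: "('w, 'x) monoid_scheme \<Rightarrow> 'w set \<Rightarrow> 'w \<Rightarrow> nat"
  where "coxeter_length W S x =
    (LEAST n. \<exists>xs. length xs = n \<and> set xs \<subseteq> S \<and> foldr (mult W) xs \<one>\<^bsub>W\<^esub> = x)"

definition longest_element :: "('w, 'x) monoid_scheme \<Rightarrow> 'w set \<Rightarrow> 'w \<Rightarrow> bool"
  where "longest_element W S x \<longleftrightarrow>
    x \<in> carrier W \<and> (\<forall>y\<in>carrier W. coxeter_length W S y \<le> coxeter_length W S x)"

definition parabolic ::
  "('g, 'x) monoid_scheme \<Rightarrow> 'g set \<Rightarrow> 'g set \<Rightarrow> ('i \<Rightarrow> 'g set) \<Rightarrow> 'i set \<Rightarrow> 'g set"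
  where "parabolic G B N w J =
    (\<Union>x\<in>generate (weyl_group G B N) (w ` J). B <#>\<^bsub>G\<^esub> x <#>\<^bsub>G\<^esub> B)"

text \<open>In the next two definitions \<open>\<theta>\<close> stands for the action of the longest element on \<open>V\<close>.\<close>

definition opposite_types ::
  "'i set \<Rightarrow> ('i \<Rightarrow> 'v::euclidean_space) \<Rightarrow> ('v \<Rightarrow> 'v) \<Rightarrow> 'i set \<Rightarrow> 'i set \<Rightarrow> bool"
  where "opposite_types I \<alpha> \<theta> J' K' \<longleftrightarrow>
    J' \<noteq> {} \<and> J' \<subseteq> I \<and> K' \<noteq> {} \<and> K' \<subseteq> I \<and> (\<lambda>i. - \<theta> (\<alpha> i)) ` J' = \<alpha> ` K'"

definition opposite_cotypes ::
  "'i set \<Rightarrow> ('i \<Rightarrow> 'v::euclidean_space) \<Rightarrow> ('v \<Rightarrow> 'v) \<Rightarrow> 'i set \<Rightarrow> 'i set \<Rightarrow> bool"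
  where "opposite_cotypes I \<alpha> \<theta> J K \<longleftrightarrow>
    J \<subseteq> I \<and> K \<subseteq> I \<and> opposite_types I \<alpha> \<theta> (I - J) (I - K)"

text \<open>Oppositeness of the objects \<open>D = Pg\<close> and \<open>C = Qh\<close>, where \<open>P\<close> and \<open>Q\<close> are parabolic subgroups
  of opposite cotypes and \<open>w0\<close> is the longest element (a coset of \<open>H\<close>):
  \<open>P <#> w0 <#> C\<close> is \<open>P w0 Q h\<close>.\<close>

definition opposite_objects ::
  "('g, 'x) monoid_scheme \<Rightarrow> 'g set \<Rightarrow> 'g set \<Rightarrow> 'g set \<Rightarrow> 'g set \<Rightarrow> bool"
  where "opposite_objects G P w0 D C \<longleftrightarrow> D \<subseteq> P <#>\<^bsub>G\<^esub> w0 <#>\<^bsub>G\<^esub> C"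


section \<open>Modules for a group over a field\<close>

text \<open>A left \<open>kG\<close>-module is a \<open>k\<close>-vector space with a \<open>k\<close>-linear left action of \<open>G\<close>.  The underlying
  space is a subspace \<open>M\<close> of an ambient vector space, so that submodules and images are again
  modules for the same \<open>smul\<close> and \<open>act\<close>; only the values of \<open>act g\<close> on \<open>M\<close> are relevant.\<close>

locale kG_module = G: group G + vector_space smul
  for G :: "('g, 'x) monoid_scheme" (structure)
    and smul :: "'k::field \<Rightarrow> 'm::ab_group_add \<Rightarrow> 'm" +
  fixes act :: "'g \<Rightarrow> 'm \<Rightarrow> 'm" and M :: "'m set"
  assumes M_subspace: "subspace M"
    and act_closed: "g \<in> carrier G \<Longrightarrow> v \<in> M \<Longrightarrow> act g v \<in> M"
    and act_add: "g \<in> carrier G \<Longrightarrow> u \<in> M \<Longrightarrow> v \<in> M \<Longrightarrow> act g (u + v) = act g u + act g v"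
    and act_scale: "g \<in> carrier G \<Longrightarrow> v \<in> M \<Longrightarrow> act g (smul c v) = smul c (act g v)"
    and act_one: "v \<in> M \<Longrightarrow> act \<one> v = v"
    and act_mult: "g \<in> carrier G \<Longrightarrow> h \<in> carrier G \<Longrightarrow> v \<in> M \<Longrightarrow> act (g \<otimes> h) v = act g (act h v)"

definition simple_kG_module ::
  "('g, 'x) monoid_scheme \<Rightarrow> ('k::field \<Rightarrow> 'm::ab_group_add \<Rightarrow> 'm) \<Rightarrow> ('g \<Rightarrow> 'm \<Rightarrow> 'm) \<Rightarrow> 'm set \<Rightarrow> bool"
  where "simple_kG_module G smul act M \<longleftrightarrow>
    kG_module G smul act M \<and> M \<noteq> {0} \<and>
    (\<forall>L. L \<subseteq> M \<and> kG_module G smul act L \<longrightarrow> L = {0} \<or> L = M)"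

definition kG_hom ::
  "('g, 'x) monoid_scheme \<Rightarrow>
    ('k::field \<Rightarrow> 'm::ab_group_add \<Rightarrow> 'm) \<Rightarrow> ('g \<Rightarrow> 'm \<Rightarrow> 'm) \<Rightarrow> 'm set \<Rightarrow>
    ('k \<Rightarrow> 'n::ab_group_add \<Rightarrow> 'n) \<Rightarrow> ('g \<Rightarrow> 'n \<Rightarrow> 'n) \<Rightarrow> 'n set \<Rightarrow> ('m \<Rightarrow> 'n) \<Rightarrow> bool"
  where "kG_hom G smul act M smul' act' M' \<phi> \<longleftrightarrow>
    \<phi> ` M \<subseteq> M' \<and>
    (\<forall>u\<in>M. \<forall>v\<in>M. \<phi> (u + v) = \<phi> u + \<phi> v) \<and>
    (\<forall>c. \<forall>v\<in>M. \<phi> (smul c v) = smul' c (\<phi> v)) \<and>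
    (\<forall>g\<in>carrier G. \<forall>v\<in>M. \<phi> (act g v) = act' g (\<phi> v))"

definition kG_isomorphic ::
  "('g, 'x) monoid_scheme \<Rightarrow>
    ('k::field \<Rightarrow> 'm::ab_group_add \<Rightarrow> 'm) \<Rightarrow> ('g \<Rightarrow> 'm \<Rightarrow> 'm) \<Rightarrow> 'm set \<Rightarrow>
    ('k \<Rightarrow> 'n::ab_group_add \<Rightarrow> 'n) \<Rightarrow> ('g \<Rightarrow> 'n \<Rightarrow> 'n) \<Rightarrow> 'n set \<Rightarrow> bool"
  where "kG_isomorphic G smul act M smul' act' M' \<longleftrightarrow>
    (\<exists>\<phi>. kG_hom G smul act M smul' act' M' \<phi> \<and> bij_betw \<phi> M M')"

definition fixed_points :: "('g \<Rightarrow> 'm \<Rightarrow> 'm) \<Rightarrow> 'm set \<Rightarrow> 'g set \<Rightarrow> 'm set"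
  where "fixed_points act M U = {v \<in> M. \<forall>u\<in>U. act u v = v}"

definition subset_stabilizer :: "('g, 'x) monoid_scheme \<Rightarrow> ('g \<Rightarrow> 'm \<Rightarrow> 'm) \<Rightarrow> 'm set \<Rightarrow> 'g set"
  where "subset_stabilizer G act L = {g \<in> carrier G. act g ` L = L}"

definition fixed_line_property ::
  "('g, 'x) monoid_scheme \<Rightarrow> 'g set \<Rightarrow> 'g set \<Rightarrow>
    ('k::field \<Rightarrow> 'm::ab_group_add \<Rightarrow> 'm) \<Rightarrow> ('g \<Rightarrow> 'm \<Rightarrow> 'm) \<Rightarrow> 'm set \<Rightarrow> bool"
  where "fixed_line_property G U P smul act M \<longleftrightarrow>
    vector_space.dim smul (fixed_points act M U) = 1 \<and>
    subset_stabilizer G act (fixed_points act M U) = P \<and>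
    (\<forall>g\<in>P. \<forall>v\<in>fixed_points act M U. act g v = v)"


section \<open>Functions on right cosets and the oppositeness map\<close>

text \<open>A function on \<open>rcosets P\<close> is represented by its extension by zero to all subsets of \<open>G\<close>.\<close>

definition coset_functions :: "('g, 'x) monoid_scheme \<Rightarrow> 'g set \<Rightarrow> ('g set \<Rightarrow> 'k::field) set"
  where "coset_functions G P = {f. \<forall>C. C \<notin> rcosets\<^bsub>G\<^esub> P \<longrightarrow> f C = 0}"

definition fun_scale :: "'k::field \<Rightarrow> ('b \<Rightarrow> 'k) \<Rightarrow> 'b \<Rightarrow> 'k"
  where "fun_scale c f = (\<lambda>x. c * f x)"

text \<open>For \<open>C = Pg\<close> the value is \<open>f (Pgx)\<close>.\<close>

definition coset_act ::
  "('g, 'x) monoid_scheme \<Rightarrow> 'g set \<Rightarrow> 'g \<Rightarrow> ('g set \<Rightarrow> 'k::field) \<Rightarrow> 'g set \<Rightarrow> 'k"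
  where "coset_act G P x f = (\<lambda>C. if C \<in> rcosets\<^bsub>G\<^esub> P then f (C #>\<^bsub>G\<^esub> x) else 0)"

definition opposite_map ::
  "('g, 'x) monoid_scheme \<Rightarrow> 'g set \<Rightarrow> 'g set \<Rightarrow> 'g set \<Rightarrow> ('g set \<Rightarrow> 'k::field) \<Rightarrow> 'g set \<Rightarrow> 'k"
  where "opposite_map G P Q w0 f = (\<lambda>C. if C \<in> rcosets\<^bsub>G\<^esub> Q
    then \<Sum>D | D \<in> rcosets\<^bsub>G\<^esub> P \<and> opposite_objects G P w0 D C. f D else 0)"

lemma vector_space_fun_scale: "vector_space (fun_scale :: 'k::field \<Rightarrow> ('b \<Rightarrow> 'k) \<Rightarrow> 'b \<Rightarrow> 'k)"
  by unfold_locales (auto simp: fun_scale_def fun_eq_iff algebra_simps)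

context group
begin

lemma rcosets_translate:
  assumes "P \<subseteq> carrier G" "C \<in> rcosets P" "x \<in> carrier G"
  shows "C #> x \<in> rcosets P"
  using assms by (auto simp: RCOSETS_def coset_mult_assoc intro!: bexI[of _ "_ \<otimes> x"])

lemma rcosets_subset_carrier:
  assumes "P \<subseteq> carrier G" "C \<in> rcosets P"
  shows "C \<subseteq> carrier G"
  using assms r_coset_subset_G by (auto simp: RCOSETS_def)

lemma kG_module_coset_functions:
  assumes P: "P \<subseteq> carrier G"
  shows "kG_module G fun_scale (coset_act G P) (coset_functions G P :: ('a set \<Rightarrow> 'k::field) set)"
proof -
  interpret V: vector_space "fun_scale :: 'k \<Rightarrow> ('a set \<Rightarrow> 'k) \<Rightarrow> _"
    by (rule vector_space_fun_scale)
  have one: "C #> \<one> = C" if "C \<in> rcosets P" for C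
    using rcosets_subset_carrier[OF P that] by (rule coset_mult_one)
  have mult: "C #> (g \<otimes> h) = (C #> g) #> h"
    if "C \<in> rcosets P" "g \<in> carrier G" "h \<in> carrier G" for C g h
    using rcosets_subset_carrier[OF P that(1)] that(2,3) by (simp add: coset_mult_assoc)
  show ?thesis
    by unfold_locales
      (auto simp: V.subspace_def coset_functions_def coset_act_def fun_scale_def fun_eq_iff
        one mult rcosets_translate[OF P])
qed

lemma opposite_objects_translate:
  assumes "P \<subseteq> carrier G" "w0 \<subseteq> carrier G" "D \<subseteq> carrier G" "C \<subseteq> carrier G" "x \<in> carrier G"
  shows "opposite_objects G P w0 (D #> x) (C #> x) \<longleftrightarrow> opposite_objects G P w0 D C"
proof -
  have *: "P <#> w0 \<subseteq> carrier G" "P <#> w0 <#> C \<subseteq> carrier G"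
    using assms by (simp_all add: set_mult_closed)
  have eq: "P <#> w0 <#> (C #> x) = (P <#> w0 <#> C) #> x"
    using * assms set_mult_assoc[of "P <#> w0" C "{x}"] by (simp add: r_coset_eq_set_mult)
  have cancel: "(E #> x) #> inv x = E" if "E \<subseteq> carrier G" for E
    using that assms(5) by (simp add: coset_mult_assoc coset_mult_one)
  have mono: "E #> y \<subseteq> F #> y" if "E \<subseteq> F" for E F y
    using that by (auto simp: r_coset_def)
  show ?thesis
    unfolding opposite_objects_def eq
    using mono[of "D #> x" "(P <#> w0 <#> C) #> x" "inv x"] mono[of D "P <#> w0 <#> C" x]
    by (auto simp: cancel assms *)
qed

lemma kG_hom_opposite_map:
  assumes P: "P \<subseteq> carrier G" and Q: "Q \<subseteq> carrier G" and w0: "w0 \<subseteq> carrier G"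
  shows "kG_hom G fun_scale (coset_act G P) (coset_functions G P :: ('a set \<Rightarrow> 'k::field) set)
    fun_scale (coset_act G Q) (coset_functions G Q) (opposite_map G P Q w0)"
proof -
  have "opposite_map G P Q w0 (coset_act G P g f) = coset_act G Q g (opposite_map G P Q w0 f)"
    if g: "g \<in> carrier G" for g and f :: "'a set \<Rightarrow> 'k"
  proof
    fix C
    show "opposite_map G P Q w0 (coset_act G P g f) C
        = coset_act G Q g (opposite_map G P Q w0 f) C"
    proof (cases "C \<in> rcosets Q")
      case True
      note C = rcosets_subset_carrier[OF Q True]
      note D = rcosets_subset_carrier[OF P]
      have Cg: "C #> g \<in> rcosets Q" by (rule rcosets_translate[OF Q True g])
      have cancel: "(E #> inv g) #> g = E" "(E #> g) #> inv g = E" if "E \<subseteq> carrier G" for E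
        using that g by (simp_all add: coset_mult_assoc coset_mult_one)
      have "(\<Sum>D | D \<in> rcosets P \<and> opposite_objects G P w0 D C. f (D #> g))
          = (\<Sum>D | D \<in> rcosets P \<and> opposite_objects G P w0 D (C #> g). f D)"
      proof (rule sum.reindex_bij_witness[where i = "\<lambda>D. D #> inv g" and j = "\<lambda>D. D #> g"])
        fix E assume "E \<in> {D \<in> rcosets P. opposite_objects G P w0 D (C #> g)}"
        then have E: "E \<in> rcosets P" "opposite_objects G P w0 E (C #> g)" by auto
        have "opposite_objects G P w0 (E #> inv g) ((C #> g) #> inv g)"
          using E opposite_objects_translate[OF P w0 D[OF E(1)] rcosets_subset_carrier[OF Q Cg], of "inv g"] g
          by simp
        then show "E #> inv g \<in> {D \<in> rcosets P. opposite_objects G P w0 D C}"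
          using rcosets_translate[OF P E(1)] g by (simp add: cancel C)
      qed (use g in \<open>auto simp: cancel D rcosets_translate[OF P] opposite_objects_translate P w0 C\<close>)
      moreover have "(\<Sum>D | D \<in> rcosets P \<and> opposite_objects G P w0 D C. coset_act G P g f D)
          = (\<Sum>D | D \<in> rcosets P \<and> opposite_objects G P w0 D C. f (D #> g))"
        by (rule sum.cong) (auto simp: coset_act_def)
      ultimately show ?thesis
        using True Cg by (simp add: opposite_map_def coset_act_def)
    qed (simp add: opposite_map_def coset_act_def)
  qed
  then show ?thesis
    by (auto simp: kG_hom_def opposite_map_def coset_functions_def fun_scale_def fun_eq_iff
        sum.distrib sum_distrib_left)
qed

end

end

theory Submission
  imports Defs "HOL-Algebra.Group_Action" "HOL-Number_Theory.Cong"
begin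

text \<open>Regard functions on right cosets of \<open>P\<^sub>K\<close> as functions on \<open>G\<close>.  The image of \<open>\<eta>\<close> is generated by
  the indicator function \<open>e\<close> of \<open>P\<^sub>K w\<^sub>0 P\<^sub>J\<close>.  As a panel (a coset of a minimal parabolic subgroup of
  type \<open>i\<close>) consists of one chamber nearest to a given one and of \<open>q\<close> others, with \<open>q\<close> a positive power
  of \<open>p\<close>, every function in the image has sum zero over the chambers of any panel of type \<open>i \<notin> K\<close>.
  For a \<open>U\<close>-invariant function this forces the values on all Bruhat cells outside \<open>P\<^sub>K w\<^sub>0 P\<^sub>J\<close> to vanish,
  so the \<open>U\<close>-fixed points of the image are the multiples of \<open>e\<close>, and simplicity follows because a
  \<open>p\<close>-group has nonzero fixed points in every nonzero module in characteristic \<open>p\<close>.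

  Conversely let \<open>v\<close> span the \<open>U\<close>-fixed line of a simple module with full stabilizer \<open>P\<^sub>J\<close>.  The sum
  of the translates of \<open>v\<close> over a panel of type \<open>i \<notin> J\<close> lies in this line and is fixed by the
  parabolic subgroup of type \<open>{i}\<close>, so it is zero.  With a nonzero \<open>U\<close>-invariant functional \<open>\<mu>\<close> these
  relations determine the matrix coefficient \<open>g \<mapsto> \<mu> (g v)\<close> up to a scalar, by descending induction
  over the Bruhat cells, so it is a multiple of \<open>e\<close>.\<close>

section \<open>Reflection groups\<close>

text \<open>The BN-pair axioms place a product of B w_i B and B x B in the union of two cells; the
  whole argument needs to know which one occurs. The roots decide: w_i x is longer than x exactly
  when the inverse of x keeps \<alpha>_i positive, and then the product lies in the cell of w_i x.
  The number q of a panel is the index in U of those u that n in w_i conjugates into B; it is not 1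
  because w_i B w_i differs from B.

  The two inductions over cells are mirror images: left \<open>P\<^sub>K\<close>-invariance goes
  with steps from x to w_i x, right \<open>P\<^sub>J\<close>-invariance with steps from x to x w_i.
  In the second, e needs no new computation: the image has the fixed line property, so e satisfies
  the same panel relations as v, and the coefficient minus a multiple of e vanishes on w_0, hence
  everywhere. As a multiple of e the coefficient of v is left \<open>P\<^sub>K\<close>-invariant,
  which places M inside the functions on cosets of \<open>P\<^sub>K\<close>.

  No bound on the dimension of M is available, so fixed vectors, also in its dual, come from finite
  spans over the prime field.\<close>

lemma reflection_linear: "linear (reflection a)"
  by (rule linearI) (simp_all add: reflection_def algebra_simps inner_add_left add_divide_distrib)

lemma reflection_self: "a \<noteq> 0 \<Longrightarrow> reflection a a = - a"
  by (simp add: reflection_def scaleR_2)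

lemma reflection_minus: "reflection (- a) = reflection a"
  by (simp add: reflection_def fun_eq_iff)

lemma reflection_orthogonal_transformation:
  assumes "orthogonal_transformation f"
  shows "f (reflection a x) = reflection (f a) (f x)"
proof -
  have "linear f" "f x \<bullet> f a = x \<bullet> a" "f a \<bullet> f a = a \<bullet> a"
    using assms by (auto simp: orthogonal_transformation_def)
  then show ?thesis
    by (simp add: reflection_def linear_diff linear_scale)
qed

locale reflection_group = group W for W (structure) +
  fixes w :: "'i \<Rightarrow> 'a" and I :: "'i set"
    and \<rho> :: "'a \<Rightarrow> 'v::euclidean_space \<Rightarrow> 'v" and R :: "'v set" and \<alpha> :: "'i \<Rightarrow> 'v"
  assumes w_closed: "i \<in> I \<Longrightarrow> w i \<in> carrier W"
    and w_square: "i \<in> I \<Longrightarrow> w i \<otimes> w i = \<one>"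
    and w_generates: "generate W (w ` I) = carrier W"
    and root_system: "root_system R"
    and simple_roots: "simple_roots R I \<alpha>"
    and \<rho>_orth: "x \<in> carrier W \<Longrightarrow> orthogonal_transformation (\<rho> x)"
    and \<rho>_comp: "x \<in> carrier W \<Longrightarrow> y \<in> carrier W \<Longrightarrow> \<rho> (x \<otimes> y) = \<rho> x \<circ> \<rho> y"
    and \<rho>_inj: "inj_on \<rho> (carrier W)"
    and \<rho>_refl: "i \<in> I \<Longrightarrow> \<rho> (w i) = reflection (\<alpha> i)"
begin

text \<open>Words are lists of indices rather than of generators, because the root attached to a
  letter depends on its index; \<open>foldr_mult_word\<close> makes the link with
  \<open>coxeter_length\<close>.\<close>

definition word :: "'i list \<Rightarrow> 'a"
  where "word ks = foldr (\<lambda>i x. w i \<otimes> x) ks \<one>"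

abbreviation len :: "'a \<Rightarrow> nat"
  where "len \<equiv> coxeter_length W (w ` I)"

text \<open>Defined for all vectors, not only for roots, so that it passes to nonnegative
  combinations. The zero vector is positive together with its negative; hence the nonzero hypothesis
  in \<open>not_pos_and_neg\<close>.\<close>

definition pos :: "'v \<Rightarrow> bool"
  where "pos r \<longleftrightarrow> (\<exists>c. r = (\<Sum>i\<in>I. c i *\<^sub>R \<alpha> i) \<and> (\<forall>i\<in>I. 0 \<le> c i))"

lemma word_Nil [simp]: "word [] = \<one>" and word_Cons [simp]: "word (i # ks) = w i \<otimes> word ks"
  by (simp_all add: word_def)

lemma word_closed [simp]: "set ks \<subseteq> I \<Longrightarrow> word ks \<in> carrier W"
  by (induction ks) (auto simp: w_closed)

lemma word_append: "set ks \<subseteq> I \<Longrightarrow> set js \<subseteq> I \<Longrightarrow> word (ks @ js) = word ks \<otimes> word js"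
  by (induction ks) (auto simp: w_closed m_assoc)

lemma inv_w: "i \<in> I \<Longrightarrow> inv (w i) = w i"
  by (simp add: inv_equality w_closed w_square)

lemma w_cancel: "i \<in> I \<Longrightarrow> x \<in> carrier W \<Longrightarrow> w i \<otimes> (w i \<otimes> x) = x"
  "i \<in> I \<Longrightarrow> x \<in> carrier W \<Longrightarrow> x \<otimes> w i \<otimes> w i = x"
  by (simp add: m_assoc[symmetric] w_closed w_square)
     (simp add: m_assoc w_closed w_square)

lemma word_rev: "set ks \<subseteq> I \<Longrightarrow> word (rev ks) = inv (word ks)"
  by (induction ks) (auto simp: w_closed word_append inv_mult_group inv_w)

lemma generate_word:
  assumes "J \<subseteq> I" "x \<in> generate W (w ` J)"
  obtains ks where "set ks \<subseteq> J" "word ks = x"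
proof -
  have "\<exists>ks. set ks \<subseteq> J \<and> word ks = x"
    using assms(2)
  proof induction
    case one
    show ?case by (rule exI[of _ "[]"]) simp
  next
    case (incl h)
    then obtain j where "j \<in> J" "h = w j" by auto
    then show ?case
      using assms(1) w_closed by (intro exI[of _ "[j]"]) auto
  next
    case (inv h)
    then obtain j where "j \<in> J" "h = w j" by auto
    then show ?case
      using assms(1) w_closed inv_w by (intro exI[of _ "[j]"]) auto
  next
    case (eng h1 h2)
    then obtain ks js where *: "set ks \<subseteq> J" "word ks = h1" "set js \<subseteq> J" "word js = h2" by auto
    then show ?case
      using assms(1) by (intro exI[of _ "ks @ js"]) (simp add: word_append subset_trans)
  qed
  then show ?thesis using that by blast
qed

lemma carrier_word:
  assumes "x \<in> carrier W"
  obtains ks where "set ks \<subseteq> I" "word ks = x"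
  using generate_word[of I x] assms w_generates by auto

lemma foldr_mult_word:
  "(\<exists>xs. length xs = n \<and> set xs \<subseteq> w ` I \<and> foldr (\<otimes>) xs \<one> = x) \<longleftrightarrow>
    (\<exists>ks. length ks = n \<and> set ks \<subseteq> I \<and> word ks = x)"
proof -
  have *: "foldr (\<otimes>) (map w ks) \<one> = word ks" for ks
    by (induction ks) auto
  show ?thesis
  proof safe
    fix xs assume "set xs \<subseteq> w ` I"
    then have "xs \<in> map w ` lists I"
      unfolding lists_image[symmetric] by auto
    then obtain ks where "ks \<in> lists I" "xs = map w ks" by blast
    then show "\<exists>ks. length ks = length xs \<and> set ks \<subseteq> I \<and> word ks = foldr (\<otimes>) xs \<one>"
      by (intro exI[of _ ks]) (auto simp: *)
  next
    fix ks assume "set ks \<subseteq> I"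
    then show "\<exists>xs. length xs = length ks \<and> set xs \<subseteq> w ` I \<and> foldr (\<otimes>) xs \<one> = word ks"
      by (intro exI[of _ "map w ks"]) (auto simp: *)
  qed
qed

lemma len_eq: "len x = (LEAST n. \<exists>ks. length ks = n \<and> set ks \<subseteq> I \<and> word ks = x)"
  by (simp add: coxeter_length_def foldr_mult_word)

lemma len_word_le: "set ks \<subseteq> I \<Longrightarrow> len (word ks) \<le> length ks"
  unfolding len_eq by (rule Least_le) auto

lemma reduced_word:
  assumes "x \<in> carrier W"
  obtains ks where "set ks \<subseteq> I" "word ks = x" "length ks = len x"
proof -
  have "\<exists>n ks. length ks = n \<and> set ks \<subseteq> I \<and> word ks = x"
    using carrier_word[OF assms] by metis
  then have "\<exists>ks. length ks = len x \<and> set ks \<subseteq> I \<and> word ks = x"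
    unfolding len_eq by (rule LeastI_ex)
  then show ?thesis using that by auto
qed

lemma len_inv:
  assumes "x \<in> carrier W"
  shows "len (inv x) = len x"
proof -
  have "len (inv y) \<le> len y" if "y \<in> carrier W" for y
    using reduced_word[OF that] len_word_le[of "rev _"] by (metis length_rev set_rev word_rev)
  from this[OF assms] this[of "inv x"] show ?thesis
    using assms by simp
qed

lemma len_mult_w_le: "x \<in> carrier W \<Longrightarrow> i \<in> I \<Longrightarrow> len (w i \<otimes> x) \<le> Suc (len x)"
proof -
  assume "x \<in> carrier W" "i \<in> I"
  moreover obtain ks where "set ks \<subseteq> I" "word ks = x" "length ks = len x"
    using reduced_word \<open>x \<in> carrier W\<close> .
  ultimately show ?thesis using len_word_le[of "i # ks"] by simp
qed

lemma len_mult_w_ge: "x \<in> carrier W \<Longrightarrow> i \<in> I \<Longrightarrow> len x \<le> Suc (len (w i \<otimes> x))"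
  using len_mult_w_le[of "w i \<otimes> x" i] by (simp add: w_cancel w_closed)

lemma len_right_mult_ge:
  assumes "x \<in> carrier W" "i \<in> I"
  shows "len x \<le> Suc (len (x \<otimes> w i))"
  using len_mult_w_ge[of "inv x" i] len_inv[of x] len_inv[of "x \<otimes> w i"] assms
  by (simp add: inv_mult_group inv_w w_closed)

text \<open>Multiplicativity makes \<open>\<rho> \<one>\<close> idempotent, and an injective
  idempotent map is the identity.\<close>

lemma \<rho>_one: "\<rho> \<one> = id"
proof -
  have "\<rho> \<one> (\<rho> \<one> v) = \<rho> \<one> v" for v
    using \<rho>_comp[of \<one> \<one>] by (metis comp_apply l_one one_closed)
  moreover have "inj (\<rho> \<one>)"
    using \<rho>_orth orthogonal_transformation_inj by blast
  ultimately show ?thesis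
    by (auto simp: fun_eq_iff dest: injD)
qed

lemma \<rho>_linear: "x \<in> carrier W \<Longrightarrow> linear (\<rho> x)"
  using \<rho>_orth orthogonal_transformation_linear by blast

lemma \<rho>_mult: "x \<in> carrier W \<Longrightarrow> y \<in> carrier W \<Longrightarrow> \<rho> (x \<otimes> y) v = \<rho> x (\<rho> y v)"
  by (simp add: \<rho>_comp)

lemma \<rho>_w: "i \<in> I \<Longrightarrow> \<rho> (w i) v = reflection (\<alpha> i) v"
  by (simp add: \<rho>_refl)

section \<open>Positive and negative roots\<close>

lemma finite_I: "finite I"
  using simple_roots unfolding simple_roots_def
  by (meson finite_imageD independent_imp_finite)

lemma \<alpha>_root: "i \<in> I \<Longrightarrow> \<alpha> i \<in> R"
  using simple_roots by (auto simp: simple_roots_def)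

lemma root_nonzero: "r \<in> R \<Longrightarrow> r \<noteq> 0"
  using root_system by (auto simp: root_system_def)

text \<open>Independence speaks of the set of simple roots; injectivity of \<open>\<alpha>\<close>
  turns it into a statement about coefficients indexed by \<open>I\<close>.\<close>

lemma coeff_unique:
  assumes "(\<Sum>i\<in>I. c i *\<^sub>R \<alpha> i) = (\<Sum>i\<in>I. d i *\<^sub>R \<alpha> i)" "i \<in> I"
  shows "c i = d i"
proof -
  have inj: "inj_on \<alpha> I" and ind: "independent (\<alpha> ` I)"
    using simple_roots by (auto simp: simple_roots_def)
  let ?u = "\<lambda>v. c (the_inv_into I \<alpha> v) - d (the_inv_into I \<alpha> v)"
  have "(\<Sum>v\<in>\<alpha> ` I. ?u v *\<^sub>R v) = (\<Sum>i\<in>I. (c i - d i) *\<^sub>R \<alpha> i)"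
    using inj by (simp add: sum.reindex the_inv_into_f_f)
  also have "\<dots> = 0"
    using assms(1) by (simp add: scaleR_diff_left sum_subtractf)
  finally have "?u (\<alpha> i) = 0"
    using ind finite_I assms(2) by (intro independentD[OF ind]) auto
  then show ?thesis
    using inj assms(2) by (simp add: the_inv_into_f_f)
qed

lemma \<alpha>_sum: "i \<in> I \<Longrightarrow> \<alpha> i = (\<Sum>j\<in>I. (if j = i then 1 else 0) *\<^sub>R \<alpha> j)"
proof -
  assume "i \<in> I"
  have "(\<Sum>j\<in>I. (if j = i then 1 else 0) *\<^sub>R \<alpha> j) = (\<Sum>j\<in>I. if j = i then \<alpha> j else 0)"
    by (rule sum.cong) auto
  then show ?thesis using finite_I \<open>i \<in> I\<close> by simp
qed

lemma pos_\<alpha>: "i \<in> I \<Longrightarrow> pos (\<alpha> i)"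
  unfolding pos_def using \<alpha>_sum[of i] by (intro exI[of _ "\<lambda>j. if j = i then 1 else 0"]) auto

lemma root_pos_or_neg:
  assumes "r \<in> R"
  shows "pos r \<or> pos (- r)"
proof -
  obtain c where c: "r = (\<Sum>i\<in>I. c i *\<^sub>R \<alpha> i)" "(\<forall>i\<in>I. c i \<ge> 0) \<or> (\<forall>i\<in>I. c i \<le> 0)"
    using assms simple_roots unfolding simple_roots_def by blast
  then have "- r = (\<Sum>i\<in>I. (- c i) *\<^sub>R \<alpha> i)"
    by (simp add: sum_negf)
  then show ?thesis
    using c unfolding pos_def by (metis neg_0_le_iff_le)
qed

lemma not_pos_and_neg:
  assumes "r \<noteq> 0" "pos r"
  shows "\<not> pos (- r)"
proof
  assume "pos (- r)"
  then obtain c d where c: "r = (\<Sum>i\<in>I. c i *\<^sub>R \<alpha> i)" "\<forall>i\<in>I. c i \<ge> 0"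
    and d: "- r = (\<Sum>i\<in>I. d i *\<^sub>R \<alpha> i)" "\<forall>i\<in>I. d i \<ge> 0"
    using assms(2) unfolding pos_def by blast
  have "r = (\<Sum>i\<in>I. (- d i) *\<^sub>R \<alpha> i)"
    using d(1) by (simp add: sum_negf) (metis minus_minus)
  then have "c i = - d i" if "i \<in> I" for i
    using c(1) that by (intro coeff_unique[of c "\<lambda>i. - d i"]) auto
  then have "c i = 0" if "i \<in> I" for i
    using c(2) d(2) that by fastforce
  then show False using assms(1) c(1) by simp
qed

lemma pos_sum:
  assumes "finite A" "\<And>a. a \<in> A \<Longrightarrow> pos (f a)" "\<And>a. a \<in> A \<Longrightarrow> c a \<ge> 0"
  shows "pos (\<Sum>a\<in>A. c a *\<^sub>R f a)"
  using assms
proof (induction A)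
  case empty
  show ?case by (auto simp: pos_def intro!: exI[of _ "\<lambda>_. 0"])
next
  case (insert x A)
  obtain d where d: "f x = (\<Sum>i\<in>I. d i *\<^sub>R \<alpha> i)" "\<forall>i\<in>I. d i \<ge> 0"
    using insert.prems(1)[of x] unfolding pos_def by auto
  have "pos (\<Sum>a\<in>A. c a *\<^sub>R f a)"
    using insert by simp
  then obtain e where e: "(\<Sum>a\<in>A. c a *\<^sub>R f a) = (\<Sum>i\<in>I. e i *\<^sub>R \<alpha> i)" "\<forall>i\<in>I. e i \<ge> 0"
    unfolding pos_def by blast
  have "(\<Sum>a\<in>insert x A. c a *\<^sub>R f a) = (\<Sum>i\<in>I. (c x * d i + e i) *\<^sub>R \<alpha> i)"
  proof -
    have "(\<Sum>a\<in>insert x A. c a *\<^sub>R f a) = c x *\<^sub>R f x + (\<Sum>a\<in>A. c a *\<^sub>R f a)"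
      using insert.hyps by simp
    also have "\<dots> = (\<Sum>i\<in>I. (c x * d i + e i) *\<^sub>R \<alpha> i)"
      unfolding d(1) e(1) by (simp add: scaleR_add_left sum.distrib scaleR_right.sum)
    finally show ?thesis .
  qed
  moreover have "\<forall>i\<in>I. 0 \<le> c x * d i + e i"
    using d(2) e(2) insert.prems(2)[of x] by simp
  ultimately show ?case
    unfolding pos_def by (intro exI[of _ "\<lambda>i. c x * d i + e i"]) auto
qed

text \<open>A simple reflection changes only the coefficient at its own simple root. If a positive
  root becomes negative, all its other coefficients are both nonnegative and nonpositive, so it is a
  multiple of \<alpha>_i.\<close>

lemma reflection_pos:
  assumes "i \<in> I" "r \<in> R" "pos r" "pos (- reflection (\<alpha> i) r)"
  shows "r = \<alpha> i"
proof -
  obtain c where c: "r = (\<Sum>j\<in>I. c j *\<^sub>R \<alpha> j)" "\<forall>j\<in>I. c j \<ge> 0"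
    using assms(3) unfolding pos_def by blast
  obtain d where d: "- reflection (\<alpha> i) r = (\<Sum>j\<in>I. d j *\<^sub>R \<alpha> j)" "\<forall>j\<in>I. d j \<ge> 0"
    using assms(4) unfolding pos_def by blast
  define t where "t = 2 * (r \<bullet> \<alpha> i) / (\<alpha> i \<bullet> \<alpha> i)"
  have "r = t *\<^sub>R \<alpha> i - (- reflection (\<alpha> i) r)"
    by (simp add: reflection_def t_def)
  also have "\<dots> = (\<Sum>j\<in>I. (t * (if j = i then 1 else 0) - d j) *\<^sub>R \<alpha> j)"
    by (subst \<alpha>_sum[OF assms(1)], subst d(1))
       (simp add: scaleR_diff_left sum_subtractf scaleR_right.sum)
  finally have *: "c j = t * (if j = i then 1 else 0) - d j" if "j \<in> I" for j
    using c(1) that by (intro coeff_unique) auto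
  have 0: "c j = 0" if "j \<in> I - {i}" for j
  proof -
    have "c j = - d j" "0 \<le> c j" "0 \<le> d j"
      using *[of j] c(2) d(2) that by auto
    then show ?thesis by linarith
  qed
  have "r = c i *\<^sub>R \<alpha> i"
    using c(1) 0 finite_I assms(1) by (simp add: sum.remove[of I i])
  then have "r \<in> R \<inter> span {\<alpha> i}"
    using assms(2) by (simp add: span_mul span_base)
  then have "r = \<alpha> i \<or> r = - \<alpha> i"
    using root_system \<alpha>_root[OF assms(1)] unfolding root_system_def by blast
  then show ?thesis
    using not_pos_and_neg[OF root_nonzero[OF \<alpha>_root] pos_\<alpha>] assms by auto
qed

lemma \<rho>_root:
  assumes "x \<in> carrier W" "r \<in> R"
  shows "\<rho> x r \<in> R"
proof -
  have "\<rho> (word ks) r \<in> R" if "set ks \<subseteq> I" for ks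
    using that
  proof (induction ks)
    case (Cons i ks)
    then have "\<rho> (word ks) r \<in> R" "\<alpha> i \<in> R"
      using \<alpha>_root by auto
    then have "reflection (\<alpha> i) (\<rho> (word ks) r) \<in> R"
      using root_system unfolding root_system_def by blast
    then show ?case
      using Cons.prems by (simp add: \<rho>_mult w_closed \<rho>_w)
  qed (simp add: \<rho>_one assms(2))
  then show ?thesis using carrier_word assms(1) by metis
qed

lemma \<rho>_minus: "x \<in> carrier W \<Longrightarrow> \<rho> x (- v) = - \<rho> x v"
  by (simp add: \<rho>_linear linear_neg)

lemma \<rho>_eqI: "x \<in> carrier W \<Longrightarrow> y \<in> carrier W \<Longrightarrow> (\<And>v. \<rho> x v = \<rho> y v) \<Longrightarrow> x = y"
  using \<rho>_inj by (auto simp: inj_on_def fun_eq_iff)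

section \<open>Length and the signs of roots\<close>

lemma conj_w:
  assumes "x \<in> carrier W" "i \<in> I" "j \<in> I" "\<rho> x (\<alpha> i) = \<alpha> j \<or> \<rho> x (\<alpha> i) = - \<alpha> j"
  shows "x \<otimes> w i = w j \<otimes> x"
  using assms by (intro \<rho>_eqI)
    (auto simp: \<rho>_mult w_closed \<rho>_w reflection_orthogonal_transformation[OF \<rho>_orth]
      reflection_minus)

text \<open>Apply the letters to \<alpha>_i from the right end of the word. The letter j that first
  makes the root negative meets it as \<alpha>_j by \<open>reflection_pos\<close>; so w_i, moved
  through the letters behind it, becomes w_j and cancels that letter.\<close>

lemma exchange:
  assumes "set ks \<subseteq> I" "i \<in> I" "pos (- \<rho> (word ks) (\<alpha> i))"
  shows "\<exists>js. Suc (length js) = length ks \<and> set js \<subseteq> I \<and> word ks \<otimes> w i = word js"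
  using assms
proof (induction ks)
  case Nil
  then show ?case
    using not_pos_and_neg[OF root_nonzero[OF \<alpha>_root] pos_\<alpha>] by (auto simp: \<rho>_one)
next
  case (Cons j ks)
  define \<beta> where "\<beta> = \<rho> (word ks) (\<alpha> i)"
  have \<beta>: "\<beta> \<in> R" using Cons.prems by (simp add: \<beta>_def \<rho>_root \<alpha>_root)
  from root_pos_or_neg[OF \<beta>] show ?case
  proof
    assume "pos (- \<beta>)"
    then obtain js where "Suc (length js) = length ks" "set js \<subseteq> I" "word ks \<otimes> w i = word js"
      using Cons by (auto simp: \<beta>_def)
    then show ?case
      using Cons.prems by (intro exI[of _ "j # js"]) (auto simp: m_assoc w_closed)
  next
    assume "pos \<beta>"
    moreover have "pos (- reflection (\<alpha> j) \<beta>)"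
      using Cons.prems by (simp add: \<beta>_def \<rho>_mult w_closed \<rho>_w)
    ultimately have "\<beta> = \<alpha> j" using reflection_pos[of j \<beta>] \<beta> Cons.prems by auto
    then have "word ks \<otimes> w i = w j \<otimes> word ks"
      using Cons.prems by (intro conj_w) (auto simp: \<beta>_def)
    then show ?case
      using Cons.prems by (intro exI[of _ ks]) (simp add: m_assoc w_closed w_cancel)
  qed
qed

lemma len_mult_neg:
  assumes "x \<in> carrier W" "i \<in> I" "pos (- \<rho> x (\<alpha> i))"
  shows "len (x \<otimes> w i) < len x"
proof -
  obtain ks where "set ks \<subseteq> I" "word ks = x" "length ks = len x"
    using reduced_word[OF assms(1)] .
  with exchange[of ks i] assms(2,3) show ?thesis
    using len_word_le by (metis Suc_le_eq le_imp_less_Suc)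
qed

text \<open>The negative case applied to x w_i, which sends \<alpha>_i to the opposite root.\<close>

lemma len_mult_pos:
  assumes "x \<in> carrier W" "i \<in> I" "pos (\<rho> x (\<alpha> i))"
  shows "len x < len (x \<otimes> w i)"
  using len_mult_neg[of "x \<otimes> w i" i] assms
  by (simp add: w_closed w_cancel \<rho>_mult \<rho>_w reflection_self root_nonzero \<alpha>_root \<rho>_minus)

lemma len_left_mult_neg:
  assumes "x \<in> carrier W" "i \<in> I" "pos (- \<rho> (inv x) (\<alpha> i))"
  shows "len (w i \<otimes> x) < len x"
  using len_mult_neg[of "inv x" i] assms len_inv[of "w i \<otimes> x"]
  by (simp add: len_inv inv_mult_group w_closed inv_w)

lemma len_left_mult_pos:
  assumes "x \<in> carrier W" "i \<in> I" "pos (\<rho> (inv x) (\<alpha> i))"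
  shows "len x < len (w i \<otimes> x)"
  using len_mult_pos[of "inv x" i] assms len_inv[of "w i \<otimes> x"]
  by (simp add: len_inv inv_mult_group w_closed inv_w)

text \<open>The last letter of a reduced word shortens x, so it cannot keep its simple root
  positive.\<close>

lemma descent_exists:
  assumes "x \<in> carrier W" "x \<noteq> \<one>"
  shows "\<exists>i\<in>I. pos (- \<rho> x (\<alpha> i))"
proof -
  obtain ks where ks: "set ks \<subseteq> I" "word ks = x" "length ks = len x"
    using reduced_word[OF assms(1)] .
  have "ks \<noteq> []" using ks assms(2) by auto
  then obtain js i where js: "ks = js @ [i]" by (metis rev_exhaust)
  then have i: "i \<in> I" "set js \<subseteq> I" and x: "x = word js \<otimes> w i"
    using ks by (auto simp: word_append w_closed)
  have "x \<otimes> w i = word js" using x i by (simp add: w_cancel)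
  then have "len (x \<otimes> w i) < len x"
    using len_word_le[OF i(2)] ks js by simp
  then have "\<not> pos (\<rho> x (\<alpha> i))"
    using len_mult_pos assms(1) i(1) by fastforce
  then show ?thesis
    using root_pos_or_neg \<rho>_root \<alpha>_root assms(1) i(1) by blast
qed

lemma \<rho>_generate_coeff:
  assumes "J \<subseteq> I" "x \<in> generate W (w ` J)"
  shows "\<exists>c. \<rho> x v = v + (\<Sum>j\<in>J. c j *\<^sub>R \<alpha> j)"
proof -
  have fin: "finite J" using assms(1) finite_I finite_subset by blast
  have "\<exists>c. \<rho> (word ks) v = v + (\<Sum>j\<in>J. c j *\<^sub>R \<alpha> j)" if "set ks \<subseteq> J" for ks
    using that
  proof (induction ks)
    case Nil
    show ?case by (intro exI[of _ "\<lambda>_. 0"]) (simp add: \<rho>_one)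
  next
    case (Cons i ks)
    then obtain c where c: "\<rho> (word ks) v = v + (\<Sum>j\<in>J. c j *\<^sub>R \<alpha> j)" by auto
    define t where "t = 2 * (\<rho> (word ks) v \<bullet> \<alpha> i) / (\<alpha> i \<bullet> \<alpha> i)"
    have "i \<in> I" "set ks \<subseteq> I" "i \<in> J" using Cons.prems assms(1) by auto
    then have "\<rho> (word (i # ks)) v = v + (\<Sum>j\<in>J. c j *\<^sub>R \<alpha> j) - t *\<^sub>R \<alpha> i"
      by (simp add: \<rho>_mult w_closed \<rho>_w reflection_def t_def c)
    also have "t *\<^sub>R \<alpha> i = (\<Sum>j\<in>J. (if j = i then t else 0) *\<^sub>R \<alpha> j)"
    proof -
      have "(\<Sum>j\<in>J. (if j = i then t else 0) *\<^sub>R \<alpha> j) = (\<Sum>j\<in>J. if j = i then t *\<^sub>R \<alpha> j else 0)"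
        by (rule sum.cong) auto
      then show ?thesis using fin \<open>i \<in> J\<close> by simp
    qed
    finally have "\<rho> (word (i # ks)) v = v + (\<Sum>j\<in>J. (c j - (if j = i then t else 0)) *\<^sub>R \<alpha> j)"
      by (simp add: scaleR_diff_left sum_subtractf)
    then show ?case by (intro exI)
  qed
  then show ?thesis using generate_word[OF assms] by metis
qed

text \<open>Reflections from J add multiples of the simple roots of J only, so the coefficient at i
  stays 1, which rules out a negative root.\<close>

lemma generate_pos:
  assumes "J \<subseteq> I" "x \<in> generate W (w ` J)" "i \<in> I - J"
  shows "pos (\<rho> x (\<alpha> i))"
proof (rule ccontr)
  have fin: "finite J" using assms(1) finite_I finite_subset by blast
  have x: "x \<in> carrier W"
    using assms(1,2) generate_in_carrier[of "w ` J"] w_closed by blast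
  obtain c where c: "\<rho> x (\<alpha> i) = \<alpha> i + (\<Sum>j\<in>J. c j *\<^sub>R \<alpha> j)"
    using \<rho>_generate_coeff[OF assms(1,2)] by blast
  define d where "d j = (if j = i then 1 else 0) + (if j \<in> J then c j else 0)" for j
  have "(\<Sum>j\<in>J. c j *\<^sub>R \<alpha> j) = (\<Sum>j\<in>I. (if j \<in> J then c j else 0) *\<^sub>R \<alpha> j)"
    by (rule sum.mono_neutral_cong_left) (use assms(1) finite_I in auto)
  then have d: "\<rho> x (\<alpha> i) = (\<Sum>j\<in>I. d j *\<^sub>R \<alpha> j)"
    using c \<alpha>_sum[of i] assms(3) by (simp add: d_def scaleR_add_left sum.distrib)
  assume "\<not> pos (\<rho> x (\<alpha> i))"
  then have "pos (- \<rho> x (\<alpha> i))"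
    using root_pos_or_neg \<rho>_root x \<alpha>_root assms(3) by blast
  then obtain e where e: "- \<rho> x (\<alpha> i) = (\<Sum>j\<in>I. e j *\<^sub>R \<alpha> j)" "\<forall>j\<in>I. e j \<ge> 0"
    unfolding pos_def by blast
  have "(\<Sum>j\<in>I. d j *\<^sub>R \<alpha> j) = (\<Sum>j\<in>I. (- e j) *\<^sub>R \<alpha> j)"
    using e(1) d by (simp add: sum_negf) (metis minus_minus)
  from coeff_unique[OF this, of i] assms(3) e(2) show False
    by (auto simp: d_def)
qed

lemma w_notin_generate:
  assumes "J \<subseteq> I" "i \<in> I - J"
  shows "w i \<notin> generate W (w ` J)"
proof
  assume "w i \<in> generate W (w ` J)"
  then have "pos (- \<alpha> i)"
    using generate_pos[OF assms(1) _ assms(2)] assms(2)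
    by (force simp: \<rho>_w reflection_self root_nonzero \<alpha>_root)
  then show False
    using not_pos_and_neg[OF root_nonzero[OF \<alpha>_root] pos_\<alpha>] assms(2) by auto
qed

end

section \<open>The longest element\<close>

locale reflection_group_longest = reflection_group +
  fixes w0 :: 'a
  assumes longest: "longest_element W (w ` I) w0"
begin

lemma w0_closed: "w0 \<in> carrier W"
  using longest by (simp add: longest_element_def)

lemma len_le_w0: "x \<in> carrier W \<Longrightarrow> len x \<le> len w0"
  using longest by (simp add: longest_element_def)

lemma w0_neg: "i \<in> I \<Longrightarrow> pos (- \<rho> w0 (\<alpha> i))"
  using len_mult_pos[of w0 i] len_le_w0[of "w0 \<otimes> w i"] w0_closed w_closed
    root_pos_or_neg[of "\<rho> w0 (\<alpha> i)"] \<rho>_root \<alpha>_root by fastforce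

lemma w0_neg_pos:
  assumes "pos v"
  shows "pos (- \<rho> w0 v)"
proof -
  obtain c where c: "v = (\<Sum>i\<in>I. c i *\<^sub>R \<alpha> i)" "\<forall>i\<in>I. c i \<ge> 0"
    using assms unfolding pos_def by blast
  have "- \<rho> w0 v = (\<Sum>i\<in>I. c i *\<^sub>R (- \<rho> w0 (\<alpha> i)))"
    using \<rho>_linear[OF w0_closed] by (simp add: c(1) linear_sum linear_scale sum_negf)
  then show ?thesis using pos_sum[of I "\<lambda>i. - \<rho> w0 (\<alpha> i)" c] finite_I c(2) w0_neg by simp
qed

text \<open>The product w_0 x turns every simple root positive again, so it has no descent and is
  the identity.\<close>

lemma all_descents:
  assumes "x \<in> carrier W" "\<And>i. i \<in> I \<Longrightarrow> pos (- \<rho> x (\<alpha> i))"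
  shows "x = inv w0"
proof -
  have "w0 \<otimes> x = \<one>"
  proof (rule ccontr)
    assume "w0 \<otimes> x \<noteq> \<one>"
    then obtain i where i: "i \<in> I" "pos (- \<rho> w0 (\<rho> x (\<alpha> i)))"
      using descent_exists[of "w0 \<otimes> x"] w0_closed assms(1) by (auto simp: \<rho>_mult)
    have "pos (\<rho> w0 (\<rho> x (\<alpha> i)))"
      using w0_neg_pos[OF assms(2)[OF i(1)]] w0_closed by (simp add: \<rho>_minus)
    moreover have "\<rho> w0 (\<rho> x (\<alpha> i)) \<in> R"
      using \<rho>_root \<alpha>_root i(1) w0_closed assms(1) by simp
    ultimately show False
      using not_pos_and_neg[OF root_nonzero] i(2) by blast
  qed
  then show ?thesis
    using inv_equality w0_closed assms(1) by (metis inv_inv inv_closed)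
qed

lemma inv_w0: "inv w0 = w0"
  using all_descents[OF w0_closed w0_neg] by simp

lemma w0_w0: "x \<in> carrier W \<Longrightarrow> w0 \<otimes> (w0 \<otimes> x) = x"
  using r_inv[OF w0_closed] w0_closed by (simp add: inv_w0 m_assoc[symmetric])

lemma ascent_exists:
  assumes "x \<in> carrier W" "x \<noteq> w0"
  shows "\<exists>i\<in>I. pos (\<rho> x (\<alpha> i))"
  using all_descents[OF assms(1)] assms inv_w0 root_pos_or_neg \<rho>_root \<alpha>_root by metis

text \<open>The conjugate y of w_i by w_0 is nontrivial, so it has a descent j. Then
  \<open>- \<rho> w0 (\<alpha> j)\<close> is a positive root that the reflection in \<alpha>_i makes
  negative, and only \<alpha>_i itself does that.\<close>

lemma w0_permutes_simple:
  assumes "i \<in> I"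
  shows "\<exists>j\<in>I. \<rho> w0 (\<alpha> i) = - \<alpha> j \<and> \<rho> w0 (\<alpha> j) = - \<alpha> i"
proof -
  define y where "y = w0 \<otimes> w i \<otimes> w0"
  have y: "y \<in> carrier W" using assms by (simp add: y_def w0_closed w_closed)
  have "y \<noteq> \<one>"
  proof
    assume "y = \<one>"
    then have "w0 \<otimes> (w0 \<otimes> w i) = w0 \<otimes> w0"
      using assms w0_closed w_closed unfolding y_def
      by (metis inv_equality inv_w0 m_closed)
    then have "w i = \<one>"
      using assms w_closed w0_w0[of "\<one>"] w0_w0 w0_closed by simp
    then show False
      using w_notin_generate[of "{}" i] assms by (simp add: generate.one)
  qed
  then obtain j where j: "j \<in> I" "pos (- \<rho> y (\<alpha> j))"
    using descent_exists[OF y] by blast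
  define \<beta> where "\<beta> = - \<rho> w0 (\<alpha> j)"
  have \<beta>: "\<beta> \<in> R" "pos \<beta>"
  proof -
    have "\<rho> w0 (\<rho> (w j) (\<alpha> j)) \<in> R"
      using \<rho>_root w0_closed w_closed \<alpha>_root j(1) by simp
    then show "\<beta> \<in> R"
      using j(1) by (simp add: \<beta>_def \<rho>_w reflection_self root_nonzero \<alpha>_root \<rho>_minus w0_closed)
  qed (simp add: \<beta>_def w0_neg j(1))
  have "\<rho> y (\<alpha> j) = - \<rho> w0 (reflection (\<alpha> i) \<beta>)"
    using assms linear_neg[OF reflection_linear[of "\<alpha> i"]]
    by (simp add: y_def \<rho>_mult w0_closed w_closed \<rho>_w \<beta>_def \<rho>_minus)
  with j(2) have "pos (\<rho> w0 (reflection (\<alpha> i) \<beta>))" by simp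
  then have "pos (- \<rho> w0 (\<rho> w0 (reflection (\<alpha> i) \<beta>)))" by (rule w0_neg_pos)
  moreover have sq: "\<rho> w0 (\<rho> w0 v) = v" for v
    using w0_w0[of \<one>] w0_closed by (metis \<rho>_mult \<rho>_one id_apply one_closed r_one)
  ultimately have "\<beta> = \<alpha> i"
    using reflection_pos[OF assms \<beta>] by simp
  then have "\<rho> w0 (\<alpha> j) = - \<alpha> i" by (simp add: \<beta>_def minus_equation_iff)
  moreover from this have "\<rho> w0 (\<alpha> i) = - \<alpha> j"
    using sq[of "\<alpha> j"] by (simp add: \<rho>_minus w0_closed minus_equation_iff)
  ultimately show ?thesis using j(1) by blast
qed

text \<open>The map -w_0 permutes the simple roots and takes those outside J onto those outside K;
  being injective it takes those of J into those of K.\<close>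

lemma opposite_generator:
  assumes "opposite_cotypes I \<alpha> (\<rho> w0) J K" "i \<in> J"
  shows "\<exists>j\<in>K. w0 \<otimes> w i = w j \<otimes> w0"
proof -
  have inj: "inj_on \<alpha> I" using simple_roots by (simp add: simple_roots_def)
  have JK: "J \<subseteq> I" "K \<subseteq> I" and eq: "(\<lambda>i. - \<rho> w0 (\<alpha> i)) ` (I - J) = \<alpha> ` (I - K)"
    using assms(1) by (auto simp: opposite_cotypes_def opposite_types_def)
  obtain j where j: "j \<in> I" "\<rho> w0 (\<alpha> i) = - \<alpha> j" "\<rho> w0 (\<alpha> j) = - \<alpha> i"
    using w0_permutes_simple assms(2) JK by blast
  have "j \<in> K"
  proof (rule ccontr)
    assume "j \<notin> K"
    then have "\<alpha> j \<in> (\<lambda>i. - \<rho> w0 (\<alpha> i)) ` (I - J)" using j(1) eq by blast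
    then obtain i' where i': "i' \<in> I - J" "\<alpha> j = - \<rho> w0 (\<alpha> i')" by blast
    then have "\<rho> w0 (\<alpha> i') = \<rho> w0 (\<alpha> i)" using j by simp
    then have "\<alpha> i' = \<alpha> i"
      using orthogonal_transformation_inj[OF \<rho>_orth[OF w0_closed]] by (auto dest: injD)
    then show False using inj i'(1) assms(2) JK by (auto dest: inj_onD)
  qed
  moreover have "w0 \<otimes> w i = w j \<otimes> w0"
    using conj_w[OF w0_closed, of i j] j assms(2) JK by auto
  ultimately show ?thesis by blast
qed

lemma opposite_cotypes_sym:
  assumes "opposite_cotypes I \<alpha> (\<rho> w0) J K"
  shows "opposite_cotypes I \<alpha> (\<rho> w0) K J"
proof -
  have sq: "\<rho> w0 (\<rho> w0 v) = v" for v
    using w0_w0[of \<one>] w0_closed by (metis \<rho>_mult \<rho>_one id_apply one_closed r_one)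
  have eq: "\<alpha> ` (I - K) = (\<lambda>i. - \<rho> w0 (\<alpha> i)) ` (I - J)"
    using assms by (auto simp: opposite_cotypes_def opposite_types_def)
  have "(\<lambda>v. - \<rho> w0 v) ` \<alpha> ` (I - K) = \<alpha> ` (I - J)"
    unfolding eq by (simp add: image_image \<rho>_minus w0_closed sq)
  then show ?thesis
    using assms by (auto simp: opposite_cotypes_def opposite_types_def image_image)
qed

lemma generate_opposite:
  assumes "opposite_cotypes I \<alpha> (\<rho> w0) J K" "x \<in> generate W (w ` J)"
  shows "w0 \<otimes> x \<otimes> w0 \<in> generate W (w ` K)"
proof -
  have JK: "J \<subseteq> I" "K \<subseteq> I" using assms(1) by (auto simp: opposite_cotypes_def)
  have "w0 \<otimes> word ks \<otimes> w0 \<in> generate W (w ` K)" if "set ks \<subseteq> J" for ks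
    using that
  proof (induction ks)
    case Nil
    then show ?case using w0_w0[of \<one>] w0_closed by (simp add: generate.one)
  next
    case (Cons i ks)
    then obtain j where j: "j \<in> K" "w0 \<otimes> w i = w j \<otimes> w0"
      using opposite_generator[OF assms(1)] by auto
    have "w0 \<otimes> word (i # ks) \<otimes> w0 = (w0 \<otimes> w i) \<otimes> word ks \<otimes> w0"
      using Cons.prems JK w0_closed w_closed
      by (simp add: m_assoc subset_iff)
    also have "\<dots> = w j \<otimes> (w0 \<otimes> word ks \<otimes> w0)"
      using Cons.prems JK w0_closed w_closed j
      by (simp add: m_assoc subset_iff)
    finally show ?case
      using Cons j(1) by (simp add: generate.eng generate.incl)
  qed
  then show ?thesis using generate_word[OF JK(1) assms(2)] by metis
qed

end

section \<open>Bruhat decomposition\<close>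

lemma (in group) mult_inv_cancel:
  assumes "x \<in> carrier G" "y \<in> carrier G"
  shows "x \<otimes> (inv x \<otimes> y) = y" "inv x \<otimes> (x \<otimes> y) = y"
  using assms by (simp_all add: m_assoc[symmetric])

lemmas (in group) group_normalize = m_assoc inv_mult_group mult_inv_cancel

context BN_pair
begin

abbreviation W :: "'a set monoid"
  where "W \<equiv> weyl_group G B N"

definition cell :: "'a set \<Rightarrow> 'a set"
  where "cell x = B <#> x <#> B"

lemma B_sub: "b \<in> B \<Longrightarrow> b \<in> carrier G" and N_sub: "n \<in> N \<Longrightarrow> n \<in> carrier G"
  using subgroup.mem_carrier B_subgroup N_subgroup by metis+

lemma B_mult: "a \<in> B \<Longrightarrow> b \<in> B \<Longrightarrow> a \<otimes> b \<in> B"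
  and B_inv: "b \<in> B \<Longrightarrow> inv b \<in> B" and B_one: "\<one> \<in> B"
  using B_subgroup by (auto intro: subgroup.m_closed subgroup.m_inv_closed subgroup.one_closed)

lemma N_mult: "a \<in> N \<Longrightarrow> b \<in> N \<Longrightarrow> a \<otimes> b \<in> N"
  and N_inv: "b \<in> N \<Longrightarrow> inv b \<in> N" and N_one: "\<one> \<in> N"
  using N_subgroup by (auto intro: subgroup.m_closed subgroup.m_inv_closed subgroup.one_closed)

lemma W_group: "group W"
  unfolding weyl_group_def using H_normal by (rule normal.factorgroup_is_group)

sublocale W: group "weyl_group G B N"
  by (rule W_group)

lemma W_one: "\<one>\<^bsub>W\<^esub> = B \<inter> N" and W_mult: "x \<otimes>\<^bsub>W\<^esub> y = x <#> y"
  by (simp_all add: weyl_group_def FactGroup_def)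

lemma W_carrierE:
  assumes "x \<in> carrier W"
  obtains n where "n \<in> N" "x = (B \<inter> N) #> n"
  using assms by (auto simp: weyl_group_def FactGroup_def RCOSETS_def)

lemma W_memI:
  assumes "n \<in> N"
  obtains x where "x \<in> carrier W" "n \<in> x"
proof
  show "(B \<inter> N) #> n \<in> carrier W"
    using assms by (auto simp: weyl_group_def FactGroup_def RCOSETS_def)
  have "\<one> \<otimes> n \<in> (B \<inter> N) #> n" using B_one N_one unfolding r_coset_def by blast
  then show "n \<in> (B \<inter> N) #> n" using assms N_sub by simp
qed

lemma W_mem_N: "x \<in> carrier W \<Longrightarrow> n \<in> x \<Longrightarrow> n \<in> N"
  by (elim W_carrierE) (auto simp: r_coset_def N_mult)

lemma W_mem: "x \<in> carrier W \<Longrightarrow> n \<in> x \<Longrightarrow> n \<in> carrier G"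
  using W_mem_N N_sub by blast

lemma W_nonempty:
  assumes "x \<in> carrier W"
  obtains n where "n \<in> x"
  using assms B_one N_one by (elim W_carrierE) (auto simp: r_coset_def)

lemma W_mult_mem: "n \<in> x \<Longrightarrow> m \<in> y \<Longrightarrow> n \<otimes> m \<in> x \<otimes>\<^bsub>W\<^esub> y"
  by (auto simp: W_mult set_mult_def)

lemma W_mult_memE:
  assumes "k \<in> x \<otimes>\<^bsub>W\<^esub> y"
  obtains n m where "n \<in> x" "m \<in> y" "k = n \<otimes> m"
  using assms by (auto simp: W_mult set_mult_def)

lemma W_H_left: "x \<in> carrier W \<Longrightarrow> n \<in> x \<Longrightarrow> h \<in> B \<inter> N \<Longrightarrow> h \<otimes> n \<in> x"
  using W_mult_mem[of h "\<one>\<^bsub>W\<^esub>" n x] by (simp add: W_one[symmetric])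

lemma W_H_right: "x \<in> carrier W \<Longrightarrow> n \<in> x \<Longrightarrow> h \<in> B \<inter> N \<Longrightarrow> n \<otimes> h \<in> x"
  using W_mult_mem[of n x h "\<one>\<^bsub>W\<^esub>"] by (simp add: W_one[symmetric])

lemma W_memE:
  assumes "x \<in> carrier W" "n \<in> x" "m \<in> x"
  obtains h where "h \<in> B \<inter> N" "m = h \<otimes> n"
proof -
  obtain a where a: "a \<in> N" "x = (B \<inter> N) #> a" using assms(1) by (rule W_carrierE)
  then obtain h k where hk: "h \<in> B \<inter> N" "n = h \<otimes> a" "k \<in> B \<inter> N" "m = k \<otimes> a"
    using assms(2,3) by (auto simp: r_coset_def)
  have "m = (k \<otimes> inv h) \<otimes> n"
    using hk a(1) by (simp add: group_normalize B_sub N_sub)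
  moreover have "k \<otimes> inv h \<in> B \<inter> N" using hk by (simp add: B_mult B_inv N_mult N_inv)
  ultimately show ?thesis using that by blast
qed

lemma W_eqI:
  assumes "x \<in> carrier W" "y \<in> carrier W" "n \<in> x" "n \<in> y"
  shows "x = y"
proof -
  have "x \<subseteq> y" if "x \<in> carrier W" "y \<in> carrier W" "n \<in> x" "n \<in> y" for x y
  proof
    fix m assume "m \<in> x"
    then obtain h where "h \<in> B \<inter> N" "m = h \<otimes> n" using W_memE \<open>x \<in> carrier W\<close> \<open>n \<in> x\<close> by metis
    then show "m \<in> y" using W_H_left that by simp
  qed
  then show ?thesis using assms by blast
qed

lemma W_inv_mem:
  assumes "x \<in> carrier W" "n \<in> x"
  shows "inv n \<in> inv\<^bsub>W\<^esub> x"
proof -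
  obtain y where y: "y \<in> carrier W" "inv n \<in> y"
    using W_memI[of "inv n"] assms W_mem_N N_inv by blast
  have "\<one> \<in> y \<otimes>\<^bsub>W\<^esub> x" using W_mult_mem[OF y(2) assms(2)] assms W_mem by simp
  then have "y \<otimes>\<^bsub>W\<^esub> x = \<one>\<^bsub>W\<^esub>"
    using y(1) assms(1) B_one N_one W_one W.one_closed by (intro W_eqI[of _ _ \<one>]) auto
  then show ?thesis using y assms(1) W.inv_equality by metis
qed

lemma inv_w: "i \<in> I \<Longrightarrow> inv\<^bsub>W\<^esub> (w i) = w i"
  by (simp add: W.inv_equality w_in_W w_involution)

lemma cellI: "b \<in> B \<Longrightarrow> n \<in> x \<Longrightarrow> c \<in> B \<Longrightarrow> b \<otimes> n \<otimes> c \<in> cell x"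
  by (auto simp: cell_def set_mult_def)

lemma cellE:
  assumes "g \<in> cell x"
  obtains b n c where "b \<in> B" "n \<in> x" "c \<in> B" "g = b \<otimes> n \<otimes> c"
  using assms by (auto simp: cell_def set_mult_def)

text \<open>Two representatives of x differ by an element of H, which the left factor B absorbs; so
  one n serves for the whole cell.\<close>

lemma cell_repE:
  assumes "g \<in> cell x" "x \<in> carrier W" "n \<in> x"
  obtains b c where "b \<in> B" "c \<in> B" "g = b \<otimes> n \<otimes> c"
proof -
  obtain b m c where g: "b \<in> B" "m \<in> x" "c \<in> B" "g = b \<otimes> m \<otimes> c" using assms(1) by (rule cellE)
  obtain h where h: "h \<in> B \<inter> N" "m = h \<otimes> n" using W_memE assms(2,3) g(2) by metis
  have "g = (b \<otimes> h) \<otimes> n \<otimes> c"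
    using g h W_mem[OF assms(2,3)] by (simp add: m_assoc B_sub)
  then show ?thesis using that g h B_mult by auto
qed

lemma cell_sub: "x \<in> carrier W \<Longrightarrow> g \<in> cell x \<Longrightarrow> g \<in> carrier G"
  by (auto elim!: cellE simp: B_sub W_mem)

lemma mem_cell: "x \<in> carrier W \<Longrightarrow> n \<in> x \<Longrightarrow> n \<in> cell x"
  using cellI[of \<one> n x \<one>] by (simp add: B_one W_mem)

lemma cell_mult_B_left:
  assumes "x \<in> carrier W" "g \<in> cell x" "b \<in> B"
  shows "b \<otimes> g \<in> cell x"
proof -
  obtain c n d where g: "c \<in> B" "n \<in> x" "d \<in> B" "g = c \<otimes> n \<otimes> d" using assms(2) by (rule cellE)
  then have "b \<otimes> g = (b \<otimes> c) \<otimes> n \<otimes> d" using assms by (simp add: m_assoc B_sub W_mem)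
  then show ?thesis using g assms(3) by (simp add: cellI B_mult)
qed

lemma cell_mult_B_right:
  assumes "x \<in> carrier W" "g \<in> cell x" "b \<in> B"
  shows "g \<otimes> b \<in> cell x"
proof -
  obtain c n d where g: "c \<in> B" "n \<in> x" "d \<in> B" "g = c \<otimes> n \<otimes> d" using assms(2) by (rule cellE)
  then have "g \<otimes> b = c \<otimes> n \<otimes> (d \<otimes> b)" using assms by (simp add: m_assoc B_sub W_mem)
  then show ?thesis using g assms(3) by (simp add: cellI B_mult)
qed

lemma cell_one: "cell \<one>\<^bsub>W\<^esub> = B"
proof
  show "cell \<one>\<^bsub>W\<^esub> \<subseteq> B" by (auto elim!: cellE simp: W_one B_mult)
  show "B \<subseteq> cell \<one>\<^bsub>W\<^esub>"
    using cellI[of _ \<one> "\<one>\<^bsub>W\<^esub>" \<one>] B_one N_one by (auto simp: W_one B_sub)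
qed

lemma cell_inv:
  assumes "x \<in> carrier W" "g \<in> cell x"
  shows "inv g \<in> cell (inv\<^bsub>W\<^esub> x)"
proof -
  obtain b n c where g: "b \<in> B" "n \<in> x" "c \<in> B" "g = b \<otimes> n \<otimes> c" using assms(2) by (rule cellE)
  then have "inv g = inv c \<otimes> inv n \<otimes> inv b"
    using assms by (simp add: inv_mult_group m_assoc B_sub W_mem)
  then show ?thesis using g assms(1) by (simp add: cellI B_inv W_inv_mem)
qed

lemma BN_mult_mem:
  assumes "i \<in> I" "x \<in> carrier W" "n \<in> w i" "b \<in> B" "m \<in> x"
  shows "n \<otimes> b \<otimes> m \<in> cell x \<union> cell (w i \<otimes>\<^bsub>W\<^esub> x)"
  using BN_mult[OF assms(1,2)] assms(3-5) unfolding cell_def[symmetric]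
  by (auto simp: set_mult_def)

lemma cell_w_mult:
  assumes "i \<in> I" "x \<in> carrier W" "g \<in> cell (w i)" "h \<in> cell x"
  shows "g \<otimes> h \<in> cell x \<union> cell (w i \<otimes>\<^bsub>W\<^esub> x)"
proof -
  obtain b n c where g: "b \<in> B" "n \<in> w i" "c \<in> B" "g = b \<otimes> n \<otimes> c" using assms(3) by (rule cellE)
  obtain d m e where h: "d \<in> B" "m \<in> x" "e \<in> B" "h = d \<otimes> m \<otimes> e" using assms(4) by (rule cellE)
  have n: "n \<in> carrier G" "m \<in> carrier G"
    using g h W_mem w_in_W assms by blast+
  have "g \<otimes> h = b \<otimes> (n \<otimes> (c \<otimes> d) \<otimes> m) \<otimes> e"
    using g h n by (simp add: m_assoc B_sub)
  moreover have "n \<otimes> (c \<otimes> d) \<otimes> m \<in> cell x \<union> cell (w i \<otimes>\<^bsub>W\<^esub> x)"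
    using BN_mult_mem assms g h B_mult by blast
  ultimately show ?thesis
    using cell_mult_B_left cell_mult_B_right g h assms w_in_W W.m_closed by (metis Un_iff)
qed

text \<open>The axiom \<open>BN_mult\<close> is one-sided; inverting all factors gives the other
  side, as w_i is its own inverse.\<close>

lemma cell_mult_w:
  assumes "i \<in> I" "x \<in> carrier W" "g \<in> cell x" "h \<in> cell (w i)"
  shows "g \<otimes> h \<in> cell x \<union> cell (x \<otimes>\<^bsub>W\<^esub> w i)"
proof -
  have w: "w i \<in> carrier W" using assms(1) by (rule w_in_W)
  have gh: "g \<in> carrier G" "h \<in> carrier G" using assms cell_sub w by blast+
  have "inv h \<otimes> inv g \<in> cell (inv\<^bsub>W\<^esub> x) \<union> cell (w i \<otimes>\<^bsub>W\<^esub> inv\<^bsub>W\<^esub> x)"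
    using cell_w_mult[of i "inv\<^bsub>W\<^esub> x" "inv h" "inv g"] cell_inv[OF w assms(4)]
      cell_inv[OF assms(2,3)] assms inv_w by simp
  then have "inv (inv h \<otimes> inv g) \<in> cell x \<union> cell (inv\<^bsub>W\<^esub> (w i \<otimes>\<^bsub>W\<^esub> inv\<^bsub>W\<^esub> x))"
    using cell_inv[of "inv\<^bsub>W\<^esub> x"] cell_inv[of "w i \<otimes>\<^bsub>W\<^esub> inv\<^bsub>W\<^esub> x"] assms(2) w by auto
  then show ?thesis
    using gh w assms(1,2) by (simp add: inv_mult_group W.inv_mult_group inv_w)
qed

text \<open>Double cosets that meet coincide. This equates the sets only; that x and y agree needs
  lengths and is \<open>cell_unique\<close>.\<close>

lemma cell_eqI:
  assumes "x \<in> carrier W" "y \<in> carrier W" "g \<in> cell x" "g \<in> cell y"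
  shows "cell x = cell y"
proof -
  have "cell x \<subseteq> cell y" if *: "x \<in> carrier W" "y \<in> carrier W" "g \<in> cell x" "g \<in> cell y" for x y
  proof
    fix h assume "h \<in> cell x"
    then obtain b n c where h: "b \<in> B" "n \<in> x" "c \<in> B" "h = b \<otimes> n \<otimes> c" by (rule cellE)
    obtain d e where g: "d \<in> B" "e \<in> B" "g = d \<otimes> n \<otimes> e" using cell_repE * h(2) by metis
    have "h = (b \<otimes> inv d) \<otimes> g \<otimes> (inv e \<otimes> c)"
    proof -
      have n: "n \<in> carrier G" using W_mem * h(2) by blast
      have "inv d \<otimes> g \<otimes> inv e = n"
        using g n by (simp add: group_normalize B_sub)
      moreover have "(b \<otimes> inv d) \<otimes> g \<otimes> (inv e \<otimes> c) = b \<otimes> (inv d \<otimes> g \<otimes> inv e) \<otimes> c"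
        using g h(1,3) n by (simp add: group_normalize B_sub)
      ultimately show ?thesis using h(4) by simp
    qed
    then show "h \<in> cell y"
      using * g h by (simp add: cell_mult_B_left cell_mult_B_right B_mult B_inv)
  qed
  then show ?thesis using assms by blast
qed

text \<open>The union of the cells contains 1 and is stable under left multiplication by B and by
  each w_i, hence by N, hence by the group that B and N generate.\<close>

lemma bruhat_cover:
  assumes "g \<in> carrier G"
  obtains x where "x \<in> carrier W" "g \<in> cell x"
proof -
  define S where "S = (\<Union>x\<in>carrier W. cell x)"
  have S_sub: "S \<subseteq> carrier G" using cell_sub by (auto simp: S_def)
  have SB: "b \<otimes> s \<in> S" if "b \<in> B" "s \<in> S" for b s
    using that cell_mult_B_left by (auto simp: S_def)
  have Sw: "n \<otimes> s \<in> S" if "i \<in> I" "n \<in> w i" "s \<in> S" for i n s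
  proof -
    obtain x where x: "x \<in> carrier W" "s \<in> cell x" using \<open>s \<in> S\<close> by (auto simp: S_def)
    then have "n \<otimes> s \<in> cell x \<union> cell (w i \<otimes>\<^bsub>W\<^esub> x)"
      using that w_in_W by (intro cell_w_mult) (auto intro: mem_cell)
    then show ?thesis using x(1) that(1) w_in_W W.m_closed unfolding S_def by blast
  qed
  have SW: "n \<otimes> s \<in> S" if "x \<in> generate W (w ` I)" "n \<in> x" "s \<in> S" for x n s
    using that
  proof (induction arbitrary: n s rule: generate.induct)
    case one
    then show ?case by (simp add: W_one SB)
  next
    case (incl h)
    then show ?case using Sw by auto
  next
    case (inv h)
    then show ?case using Sw inv_w by auto
  next
    case (eng x y)
    obtain a b where ab: "a \<in> x" "b \<in> y" "n = a \<otimes> b" using eng.prems(1) by (rule W_mult_memE)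
    have "a \<in> carrier G" "b \<in> carrier G" "s \<in> carrier G"
      using ab eng w_generate S_sub W_mem by auto
    then have "n \<otimes> s = a \<otimes> (b \<otimes> s)" using ab(3) by (simp add: m_assoc)
    then show ?case using eng ab by simp
  qed
  have SN: "n \<otimes> s \<in> S" if "n \<in> N" "s \<in> S" for n s
    using W_memI[OF that(1)] SW[OF _ _ that(2)] w_generate by metis
  have "a \<otimes> s \<in> S" if "a \<in> generate G (B \<union> N)" "s \<in> S" for a s
    using that
  proof (induction arbitrary: s rule: generate.induct)
    case one
    then show ?case using S_sub by auto
  next
    case (incl h)
    then show ?case using SB SN by auto
  next
    case (inv h)
    then show ?case using SB SN B_inv N_inv by auto
  next
    case (eng a b)
    then have "a \<in> carrier G" "b \<in> carrier G" "s \<in> carrier G"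
      using BN_generate S_sub by auto
    then have "a \<otimes> b \<otimes> s = a \<otimes> (b \<otimes> s)" by (simp add: m_assoc)
    then show ?case using eng by simp
  qed
  moreover have "\<one> \<in> S"
    using cell_one B_one W.one_closed unfolding S_def by blast
  ultimately have "g \<otimes> \<one> \<in> S" using assms BN_generate by blast
  then show ?thesis using that assms by (auto simp: S_def)
qed

end

section \<open>Transversals\<close>

context group
begin

text \<open>The condition \<open>g \<otimes> inv t \<in> A\<close> says that g and t lie in the same
  right coset of A, so T represents the right cosets of A in Q.\<close>

definition transversal :: "'a set \<Rightarrow> 'a set \<Rightarrow> 'a set \<Rightarrow> bool"
  where "transversal Q A T \<longleftrightarrow> T \<subseteq> Q \<and> (\<forall>g\<in>Q. \<exists>!t. t \<in> T \<and> g \<otimes> inv t \<in> A)"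

lemma transversal_exists:
  assumes Q: "subgroup Q G" and A: "subgroup A G" and "A \<subseteq> Q" and fin: "finite Q"
  shows "\<exists>T. transversal Q A T \<and> card T * card A = card Q"
proof -
  note Q_sub = subgroup.mem_carrier[OF Q] and A_sub = subgroup.mem_carrier[OF A]
  \<comment> \<open>The choice depends on the coset only, so \<open>r\<close> is constant on cosets;
    uniqueness of representatives rests on this.\<close>
  define r where "r g = (SOME t. t \<in> A #> g)" for g
  have r: "r g \<in> A #> g" if "g \<in> Q" for g
    unfolding r_def using rcos_self[OF Q_sub[OF that] A] by (rule someI)
  have rcos: "A #> g = A #> t" if "g \<in> Q" "t \<in> A #> g" for g t
    using repr_independence[OF that(2) Q_sub[OF that(1)] A] .
  have T: "transversal Q A (r ` Q)"
    unfolding transversal_def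
  proof (intro conjI ballI)
    have "A #> g \<subseteq> Q" if "g \<in> Q" for g
      using that \<open>A \<subseteq> Q\<close> subgroup.m_closed[OF Q] by (auto simp: r_coset_def)
    then show "r ` Q \<subseteq> Q" using r by blast
    then have rQ: "r g \<in> Q" if "g \<in> Q" for g using that by blast
    fix g assume g: "g \<in> Q"
    have iff: "g \<otimes> inv t \<in> A \<longleftrightarrow> t \<in> A #> g" if "t \<in> Q" for t
    proof
      assume "g \<otimes> inv t \<in> A"
      then have "inv (g \<otimes> inv t) \<otimes> g \<in> A #> g"
        using subgroup.m_inv_closed[OF A] by (auto simp: r_coset_def)
      then show "t \<in> A #> g" using Q_sub g that by (simp add: group_normalize)
    next
      assume "t \<in> A #> g"
      then obtain a where "a \<in> A" "t = a \<otimes> g" by (auto simp: r_coset_def)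
      then show "g \<otimes> inv t \<in> A"
        using Q_sub[OF g] A_sub subgroup.m_inv_closed[OF A] by (simp add: group_normalize)
    qed
    show "\<exists>!t. t \<in> r ` Q \<and> g \<otimes> inv t \<in> A"
    proof (rule ex1I)
      show "r g \<in> r ` Q \<and> g \<otimes> inv (r g) \<in> A" using g r rQ iff by simp
      fix t assume t: "t \<in> r ` Q \<and> g \<otimes> inv t \<in> A"
      then obtain k where k: "k \<in> Q" "t = r k" by blast
      then have "A #> g = A #> k" using t iff rQ rcos r g by metis
      then show "t = r g" by (simp add: k(2) r_def)
    qed
  qed
  have "bij_betw (\<lambda>(a, t). a \<otimes> t) (A \<times> r ` Q) Q"
  proof (rule bij_betw_imageI)
    have TQ: "t \<in> Q" if "t \<in> r ` Q" for t using T that by (auto simp: transversal_def)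
    show "inj_on (\<lambda>(a, t). a \<otimes> t) (A \<times> r ` Q)"
    proof (rule inj_onI, clarify)
      fix a k a' k' assume *: "a \<in> A" "a' \<in> A" "k \<in> Q" "k' \<in> Q" "a \<otimes> r k = a' \<otimes> r k'"
      let ?g = "a \<otimes> r k"
      have c: "a \<in> carrier G" "a' \<in> carrier G" "r k \<in> carrier G" "r k' \<in> carrier G"
        using * A_sub TQ Q_sub by auto
      have "?g \<in> Q" using * TQ \<open>A \<subseteq> Q\<close> subgroup.m_closed[OF Q] by auto
      moreover have "?g \<otimes> inv (r k) \<in> A" using *(1) c by (simp add: m_assoc)
      moreover have "?g \<otimes> inv (r k') \<in> A" unfolding *(5) using *(2) c by (simp add: m_assoc)
      ultimately have "r k = r k'" using T *(3,4) unfolding transversal_def by blast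
      then show "a = a' \<and> r k = r k'" using *(5) c by simp
    qed
    show "(\<lambda>(a, t). a \<otimes> t) ` (A \<times> r ` Q) = Q"
    proof safe
      fix a k assume "a \<in> A" "k \<in> Q"
      then show "a \<otimes> r k \<in> Q" using TQ \<open>A \<subseteq> Q\<close> subgroup.m_closed[OF Q] by auto
    next
      fix g assume g: "g \<in> Q"
      then obtain t where t: "t \<in> r ` Q" "g \<otimes> inv t \<in> A"
        using T unfolding transversal_def by blast
      then have "g = (\<lambda>(a, t). a \<otimes> t) (g \<otimes> inv t, t)"
        using Q_sub g TQ by (simp add: m_assoc)
      then show "g \<in> (\<lambda>(a, t). a \<otimes> t) ` (A \<times> r ` Q)" using t by blast
    qed
  qed
  then have "card A * card (r ` Q) = card Q"
    using bij_betw_same_card by (metis card_cartesian_product)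
  then show ?thesis using T by (metis mult.commute)
qed

text \<open>Right multiplication by h permutes the cosets of A in Q, and F is constant on each of
  them. The map f sends t to the representative of the coset of t h.\<close>

lemma sum_transversal:
  fixes F :: "'a \<Rightarrow> 'c::comm_monoid_add"
  assumes Q: "subgroup Q G" and A: "subgroup A G" and T: "transversal Q A T" and fin: "finite T" and h: "h \<in> Q"
    and F: "\<And>a g. a \<in> A \<Longrightarrow> g \<in> Q \<Longrightarrow> F (a \<otimes> g) = F g"
  shows "(\<Sum>t\<in>T. F (t \<otimes> h)) = (\<Sum>t\<in>T. F t)"
proof -
  note Q_sub = subgroup.mem_carrier[OF Q]
  have TQ: "t \<in> Q" if "t \<in> T" for t using T that by (auto simp: transversal_def)
  have Q_mult: "a \<otimes> b \<in> Q" if "a \<in> Q" "b \<in> Q" for a b using that subgroup.m_closed[OF Q] by blast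
  have "\<forall>t\<in>T. \<exists>s. s \<in> T \<and> t \<otimes> h \<otimes> inv s \<in> A"
    using T TQ h Q_mult unfolding transversal_def by metis
  then obtain f where f: "\<And>t. t \<in> T \<Longrightarrow> f t \<in> T" "\<And>t. t \<in> T \<Longrightarrow> t \<otimes> h \<otimes> inv (f t) \<in> A"
    by metis
  have "inj_on f T"
  proof (rule inj_onI)
    fix s t assume st: "s \<in> T" "t \<in> T" "f s = f t"
    have c: "s \<in> carrier G" "t \<in> carrier G" "h \<in> carrier G" "f t \<in> carrier G"
      using st h f(1) TQ Q_sub by auto
    have "s \<otimes> inv t = (s \<otimes> h \<otimes> inv (f s)) \<otimes> inv (t \<otimes> h \<otimes> inv (f t))"
      using c by (simp add: st(3) group_normalize)
    then have "s \<otimes> inv t \<in> A"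
      using f(2) st A by (metis subgroup.m_closed subgroup.m_inv_closed)
    moreover have "s \<otimes> inv s \<in> A" using c A by (simp add: subgroup.one_closed)
    ultimately show "s = t" using T TQ st unfolding transversal_def by blast
  qed
  then have "bij_betw f T T"
    using f(1) fin by (simp add: bij_betw_def endo_inj_surj image_subsetI)
  then have "(\<Sum>t\<in>T. F t) = (\<Sum>t\<in>T. F (f t))" by (simp add: sum.reindex_bij_betw)
  also have "\<dots> = (\<Sum>t\<in>T. F (t \<otimes> h))"
  proof (rule sum.cong[OF refl])
    fix t assume t: "t \<in> T"
    have c: "t \<in> carrier G" "h \<in> carrier G" "f t \<in> carrier G" using t h f(1) TQ Q_sub by auto
    have "t \<otimes> h = (t \<otimes> h \<otimes> inv (f t)) \<otimes> f t" using c by (simp add: m_assoc)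
    then show "F (f t) = F (t \<otimes> h)" using F[OF f(2)[OF t] TQ[OF f(1)[OF t]]] by simp
  qed
  finally show ?thesis by simp
qed

end

section \<open>Parabolic subgroups and panels\<close>

context BN_pair
begin

lemma parabolic_iff: "g \<in> parabolic G B N w J \<longleftrightarrow> (\<exists>x\<in>generate W (w ` J). g \<in> cell x)"
  by (auto simp: parabolic_def cell_def)

lemma generate_W_sub: "J \<subseteq> I \<Longrightarrow> x \<in> generate W (w ` J) \<Longrightarrow> x \<in> carrier W"
  using W.generate_in_carrier[of "w ` J" x] w_in_W by blast

lemma parabolic_sub: "J \<subseteq> I \<Longrightarrow> parabolic G B N w J \<subseteq> carrier G"
  using generate_W_sub cell_sub by (meson parabolic_iff subsetI)

lemma B_sub_parabolic: "B \<subseteq> parabolic G B N w J"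
  using generate.one[of W "w ` J"] cell_one parabolic_iff by blast

text \<open>The set X is left open because two choices are needed: W_J, which makes the parabolic
  subset a subgroup, and W_K w_0, which gives the left invariance of
  \<open>opp_cell\<close>.\<close>

lemma parabolic_mult_cells:
  assumes J: "J \<subseteq> I" and X: "X \<subseteq> carrier W" "\<And>i x. i \<in> J \<Longrightarrow> x \<in> X \<Longrightarrow> w i \<otimes>\<^bsub>W\<^esub> x \<in> X"
    and "g \<in> parabolic G B N w J" "h \<in> (\<Union>x\<in>X. cell x)"
  shows "g \<otimes> h \<in> (\<Union>x\<in>X. cell x)"
proof -
  let ?S = "\<Union>x\<in>X. cell x"
  have S_sub: "?S \<subseteq> carrier G" using cell_sub X(1) by blast
  have step: "n \<otimes> s \<in> ?S" if "i \<in> J" "n \<in> cell (w i)" "s \<in> ?S" for i n s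
  proof -
    obtain x where x: "x \<in> X" "s \<in> cell x" using \<open>s \<in> ?S\<close> by blast
    then have "n \<otimes> s \<in> cell x \<union> cell (w i \<otimes>\<^bsub>W\<^esub> x)"
      using that J X(1) by (intro cell_w_mult) auto
    then show ?thesis using x(1) X(2) \<open>i \<in> J\<close> by blast
  qed
  have *: "n \<otimes> s \<in> ?S" if "y \<in> generate W (w ` J)" "n \<in> cell y" "s \<in> ?S" for y n s
    using that
  proof (induction arbitrary: n s rule: generate.induct)
    case one
    then obtain x where "x \<in> X" "s \<in> cell x" by blast
    then have "n \<otimes> s \<in> cell x" using one X(1) by (intro cell_mult_B_left) (auto simp: cell_one)
    then show ?case using \<open>x \<in> X\<close> by blast
  next
    case (incl v)
    then obtain i where "i \<in> J" "v = w i" by blast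
    then show ?case using step[of i n s] incl.prems by simp
  next
    case (inv v)
    then obtain i where "i \<in> J" "v = w i" by blast
    then show ?case using step[of i n s] inv_w[of i] J inv.prems by auto
  next
    case (eng x y)
    obtain b m c where n: "b \<in> B" "m \<in> x \<otimes>\<^bsub>W\<^esub> y" "c \<in> B" "n = b \<otimes> m \<otimes> c"
      using eng.prems(1) by (rule cellE)
    obtain k l where kl: "k \<in> x" "l \<in> y" "m = k \<otimes> l" using n(2) by (rule W_mult_memE)
    have xy: "x \<in> carrier W" "y \<in> carrier W" using eng.hyps generate_W_sub J by auto
    have c: "k \<in> carrier G" "l \<in> carrier G" "s \<in> carrier G" "b \<in> carrier G" "c \<in> carrier G"
      using kl xy W_mem eng.prems S_sub n B_sub by auto
    have "b \<otimes> k \<in> cell x" using cell_mult_B_left mem_cell xy kl n(1) by simp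
    moreover have "l \<otimes> c \<in> cell y" using cell_mult_B_right mem_cell xy kl n(3) by simp
    moreover have "n \<otimes> s = (b \<otimes> k) \<otimes> ((l \<otimes> c) \<otimes> s)" using c n(4) kl(3) by (simp add: m_assoc)
    ultimately show ?case using eng.IH eng.prems(2) by simp
  qed
  obtain y where "y \<in> generate W (w ` J)" "g \<in> cell y" using assms(4) parabolic_iff by blast
  then show ?thesis using *[of y g h] assms(5) by blast
qed

lemma cells_mult_parabolic:
  assumes J: "J \<subseteq> I" and X: "X \<subseteq> carrier W" "\<And>i x. i \<in> J \<Longrightarrow> x \<in> X \<Longrightarrow> x \<otimes>\<^bsub>W\<^esub> w i \<in> X"
    and g: "g \<in> parabolic G B N w J" and h: "h \<in> (\<Union>x\<in>X. cell x)"
  shows "h \<otimes> g \<in> (\<Union>x\<in>X. cell x)"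
proof -
  let ?Y = "(\<lambda>x. inv\<^bsub>W\<^esub> x) ` X"
  have w: "w i \<in> carrier W" if "i \<in> J" for i using that J w_in_W by auto
  have gh: "g \<in> carrier G" "h \<in> carrier G" using g h parabolic_sub J cell_sub X(1) by blast+
  obtain y where y: "y \<in> generate W (w ` J)" "g \<in> cell y" using g by (auto simp: parabolic_iff)
  have "w ` J \<subseteq> carrier W" using w by auto
  then have "inv\<^bsub>W\<^esub> y \<in> generate W (w ` J)" using W.generate_m_inv_closed y(1) by blast
  then have "inv g \<in> parabolic G B N w J"
    using cell_inv y generate_W_sub J unfolding parabolic_iff by blast
  moreover have "inv h \<in> (\<Union>x\<in>?Y. cell x)" using h X(1) cell_inv by blast
  moreover have "w i \<otimes>\<^bsub>W\<^esub> x \<in> ?Y" if "i \<in> J" "x \<in> ?Y" for i x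
  proof -
    obtain z where z: "z \<in> X" "x = inv\<^bsub>W\<^esub> z" using \<open>x \<in> ?Y\<close> by blast
    then have "w i \<otimes>\<^bsub>W\<^esub> x = inv\<^bsub>W\<^esub> (z \<otimes>\<^bsub>W\<^esub> w i)"
      using X(1) w[OF \<open>i \<in> J\<close>] inv_w J \<open>i \<in> J\<close> by (subst W.inv_mult_group) auto
    then show ?thesis using X(2) \<open>i \<in> J\<close> z by blast
  qed
  ultimately have "inv g \<otimes> inv h \<in> (\<Union>x\<in>?Y. cell x)"
    using X(1) by (intro parabolic_mult_cells[OF J]) auto
  then obtain z where z: "z \<in> X" "inv g \<otimes> inv h \<in> cell (inv\<^bsub>W\<^esub> z)" by blast
  then have "inv (inv g \<otimes> inv h) \<in> cell z"
    using cell_inv[of "inv\<^bsub>W\<^esub> z" "inv g \<otimes> inv h"] X(1) by auto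
  then show ?thesis using z(1) gh by (auto simp: inv_mult_group)
qed

lemma parabolic_subgroup:
  assumes J: "J \<subseteq> I"
  shows "subgroup (parabolic G B N w J) G"
proof
  show "parabolic G B N w J \<subseteq> carrier G" using J by (rule parabolic_sub)
  show "\<one> \<in> parabolic G B N w J" using B_sub_parabolic B_one by blast
  have w: "w ` J \<subseteq> carrier W" using J w_in_W by auto
  show "g \<otimes> h \<in> parabolic G B N w J" if "g \<in> parabolic G B N w J" "h \<in> parabolic G B N w J" for g h
    using parabolic_mult_cells[OF J, of "generate W (w ` J)" g h] that W.generate_incl[OF w]
    by (auto simp: parabolic_iff generate.eng generate.incl)
  show "inv g \<in> parabolic G B N w J" if "g \<in> parabolic G B N w J" for g
    using that cell_inv generate_W_sub[OF J] W.generate_m_inv_closed[OF w]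
    unfolding parabolic_iff by blast
qed

lemma mem_parabolic: "J \<subseteq> I \<Longrightarrow> i \<in> J \<Longrightarrow> n \<in> w i \<Longrightarrow> n \<in> parabolic G B N w J"
  using mem_cell[of "w i" n] w_in_W generate.incl[of "w i" "w ` J" W] by (auto simp: parabolic_iff)

text \<open>As w_i is an involution, it generates only itself and the identity.\<close>

lemma panel_cases:
  assumes "i \<in> I" "g \<in> parabolic G B N w {i}"
  shows "g \<in> B \<or> g \<in> cell (w i)"
proof -
  have "x = \<one>\<^bsub>W\<^esub> \<or> x = w i" if "x \<in> generate W (w ` {i})" for x
    using that
  proof induction
    case (eng x y)
    then show ?case using w_in_W w_involution assms(1) by auto
  qed (use inv_w assms(1) in auto)
  then show ?thesis using assms(2) cell_one parabolic_iff by metis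
qed

lemma cell_w_sub_panel: "g \<in> cell (w i) \<Longrightarrow> g \<in> parabolic G B N w {i}"
  using generate.incl[of "w i" "w ` {i}" W] by (auto simp: parabolic_iff)

end

section \<open>The number of chambers in a panel\<close>

context finite_split_BN_pair
begin

lemma U_sub_B: "U \<subseteq> B"
  using U_normal normal_imp_subgroup subgroup.subset by force

lemma U_subgroup: "subgroup U G"
  using U_normal normal_imp_subgroup B_subgroup incl_subgroup by blast

lemma U_finite: "finite U"
  using U_sub_B B_sub finite_G by (meson finite_subset subsetI)

lemma B_decomp:
  assumes "b \<in> B"
  obtains u h where "u \<in> U" "h \<in> B \<inter> N" "b = u \<otimes> h"
proof -
  have "b \<in> U <#> (B \<inter> N)" using assms B_eq by simp
  then show ?thesis using that by (auto simp: set_mult_def)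
qed

lemma B_decomp':
  assumes "b \<in> B"
  obtains u h where "u \<in> U" "h \<in> B \<inter> N" "b = h \<otimes> u"
proof -
  obtain u h where "u \<in> U" "h \<in> B \<inter> N" "inv b = u \<otimes> h" using assms B_inv B_decomp by metis
  then have "b = inv h \<otimes> inv u" "inv h \<in> B \<inter> N" "inv u \<in> U"
    using assms U_sub_B B_sub B_inv N_inv U_subgroup
    by (auto simp: subgroup.m_inv_closed subset_iff) (metis B_sub inv_inv inv_mult_group)
  then show ?thesis using that by blast
qed

lemma w_H_conj:
  assumes "x \<in> carrier W" "n \<in> x" "h \<in> B \<inter> N"
  shows "n \<otimes> h \<otimes> inv n \<in> B \<inter> N"
proof -
  have "n \<otimes> h \<otimes> inv n \<in> x \<otimes>\<^bsub>W\<^esub> inv\<^bsub>W\<^esub> x"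
    using assms by (intro W_mult_mem W_H_right W_inv_mem)
  then show ?thesis using assms(1) by (simp add: W_one)
qed

text \<open>Since n normalises H and B = UH, the assumption makes n conjugate all of B into B, and
  by finiteness onto B. Then w_i B w_i = B, against \<open>BN_nontrivial\<close>.\<close>

lemma U_conj_not_sub_B:
  assumes i: "i \<in> I" and n: "n \<in> w i" and U: "\<And>u. u \<in> U \<Longrightarrow> n \<otimes> u \<otimes> inv n \<in> B"
  shows False
proof -
  have ncar: "n \<in> carrier G" using W_mem w_in_W i n by blast
  have conj: "n \<otimes> b \<otimes> inv n \<in> B" if b: "b \<in> B" for b
  proof -
    obtain u h where uh: "u \<in> U" "h \<in> B \<inter> N" "b = u \<otimes> h" using b by (rule B_decomp)
    have "n \<otimes> b \<otimes> inv n = (n \<otimes> u \<otimes> inv n) \<otimes> (n \<otimes> h \<otimes> inv n)"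
      using uh ncar U_sub_B B_sub by (simp add: subset_iff group_normalize)
    then show ?thesis
      using U[OF uh(1)] w_H_conj[OF w_in_W[OF i] n uh(2)] by (simp add: B_mult)
  qed
  have inj: "inj_on (\<lambda>b. n \<otimes> b \<otimes> inv n) B"
    using ncar B_sub
    by (intro inj_on_inverseI[of _ "\<lambda>b. inv n \<otimes> b \<otimes> n"]) (simp add: group_normalize)
  have "finite B" using finite_G B_sub by (meson finite_subset subsetI)
  then have eq: "(\<lambda>b. n \<otimes> b \<otimes> inv n) ` B = B"
    using conj inj by (intro endo_inj_surj) auto
  have inv_n: "inv n \<in> w i" using W_inv_mem[OF w_in_W[OF i] n] inv_w[OF i] by simp
  have "w i <#> B <#> w i = B"
  proof
    show "B \<subseteq> w i <#> B <#> w i"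
      using eq n inv_n by (force simp: set_mult_def)
    show "w i <#> B <#> w i \<subseteq> B"
    proof
      fix g assume "g \<in> w i <#> B <#> w i"
      then obtain k b l where g: "k \<in> w i" "b \<in> B" "l \<in> w i" "g = k \<otimes> b \<otimes> l"
        by (auto simp: set_mult_def)
      have c: "k \<in> carrier G" "l \<in> carrier G" using g W_mem w_in_W i by blast+
      have "k \<otimes> inv n \<in> w i \<otimes>\<^bsub>W\<^esub> w i" "n \<otimes> l \<in> w i \<otimes>\<^bsub>W\<^esub> w i"
        using g n inv_n by (auto intro: W_mult_mem)
      then have "k \<otimes> inv n \<in> B" "n \<otimes> l \<in> B" using w_involution i by (auto simp: W_one)
      moreover have "g = (k \<otimes> inv n) \<otimes> (n \<otimes> b \<otimes> inv n) \<otimes> (n \<otimes> l)"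
        using g c ncar B_sub by (simp add: group_normalize)
      ultimately show "g \<in> B" using conj[OF g(2)] by (simp add: B_mult)
    qed
  qed
  then show False using BN_nontrivial[OF i] by blast
qed

text \<open>Besides B itself, the panel consists of the cosets B n u with u in U, since B n H = B n.
  They form one U-orbit, whose size divides the order of U and is not 1 by
  \<open>U_conj_not_sub_B\<close>.\<close>

lemma panel_transversal:
  assumes i: "i \<in> I"
  shows "\<exists>T. transversal (parabolic G B N w {i}) B T \<and> finite T \<and> \<one> \<in> T \<and>
    (\<forall>t\<in>T - {\<one>}. t \<in> cell (w i)) \<and> p dvd card (T - {\<one>})"
proof -
  obtain n where n: "n \<in> w i" using W_nonempty w_in_W i by blast
  have ncar: "n \<in> carrier G" using W_mem w_in_W i n by blast
  \<comment> \<open>V is the stabiliser in U of the coset B n, so a transversal T of V in U indexes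
    the orbit of that coset.\<close>
  define V where "V = {u \<in> U. n \<otimes> u \<otimes> inv n \<in> B}"
  have Ucar: "u \<in> carrier G" if "u \<in> U" for u using that U_sub_B B_sub by blast
  have conj_mult: "n \<otimes> (u \<otimes> v) \<otimes> inv n = (n \<otimes> u \<otimes> inv n) \<otimes> (n \<otimes> v \<otimes> inv n)"
    if "u \<in> carrier G" "v \<in> carrier G" for u v
    using that ncar by (simp add: group_normalize)
  have conj_inv: "n \<otimes> inv u \<otimes> inv n = inv (n \<otimes> u \<otimes> inv n)" if "u \<in> carrier G" for u
    using that ncar by (simp add: group_normalize)
  have V: "subgroup V G"
  proof
    show "V \<subseteq> carrier G" using Ucar by (auto simp: V_def)
    show "\<one> \<in> V" using U_subgroup ncar B_one by (simp add: V_def subgroup.one_closed)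
    show "u \<otimes> v \<in> V" if "u \<in> V" "v \<in> V" for u v
      using that conj_mult Ucar U_subgroup by (simp add: V_def subgroup.m_closed B_mult)
    show "inv u \<in> V" if "u \<in> V" for u
      using that conj_inv Ucar U_subgroup by (simp add: V_def subgroup.m_inv_closed B_inv)
  qed
  obtain T where T: "transversal U V T" "card T * card V = card U"
    using transversal_exists[OF U_subgroup V _ U_finite] by (auto simp: V_def)
  have TU: "T \<subseteq> U" using T(1) by (simp add: transversal_def)
  have "card T \<noteq> 1"
  proof
    assume "card T = 1"
    then have "card V = card U" using T(2) by simp
    then have "V = U" using card_subset_eq[OF U_finite, of V] by (auto simp: V_def)
    then have "n \<otimes> u \<otimes> inv n \<in> B" if "u \<in> U" for u using that unfolding V_def by blast
    then show False by (rule U_conj_not_sub_B[OF i n])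
  qed
  moreover obtain a where a: "card U = p ^ a" using U_p_group by blast
  then have "card T dvd p ^ a" using T(2) by (metis dvd_triv_left)
  then obtain m where "card T = p ^ m" using divides_primepow_nat p_prime by blast
  ultimately have pT: "p dvd card T" by (cases m) auto
  define T' where "T' = (\<lambda>t. n \<otimes> t) ` T"
  have n_notin: "n \<notin> B"
  proof
    assume "n \<in> B"
    then have "w i = \<one>\<^bsub>W\<^esub>"
      using n w_in_W[OF i] W_mem_N by (intro W_eqI[of _ _ n] W.one_closed) (auto simp: W_one)
    then show False using w_involution(1)[OF i] by simp
  qed
  have nu_notin: "g \<otimes> inv (n \<otimes> u) \<notin> B" if "g \<in> B" "u \<in> U" for g u
  proof
    assume "g \<otimes> inv (n \<otimes> u) \<in> B"
    then have "inv (g \<otimes> inv (n \<otimes> u)) \<otimes> g \<otimes> inv u \<in> B"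
      using that U_sub_B by (auto intro!: B_mult B_inv)
    then show False using n_notin ncar B_sub Ucar that by (simp add: group_normalize)
  qed
  have one_notin: "\<one> \<noteq> n \<otimes> t" if "t \<in> T" for t
  proof
    assume "\<one> = n \<otimes> t"
    then have "\<one> \<otimes> inv (n \<otimes> t) = \<one>" by (metis inv_one r_one one_closed)
    then show False using nu_notin[of \<one> t] that TU B_one by auto
  qed
  have "transversal (parabolic G B N w {i}) B (insert \<one> T')"
    unfolding transversal_def
  proof (intro conjI ballI)
    have "n \<otimes> t \<in> cell (w i)" if "t \<in> T" for t
      using cell_mult_B_right[OF w_in_W[OF i] mem_cell[OF w_in_W[OF i] n]] that TU U_sub_B by blast
    then show "insert \<one> T' \<subseteq> parabolic G B N w {i}"
      using B_sub_parabolic[of "{i}"] B_one cell_w_sub_panel by (auto simp: T'_def)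
    fix g assume g: "g \<in> parabolic G B N w {i}"
    show "\<exists>!t. t \<in> insert \<one> T' \<and> g \<otimes> inv t \<in> B"
    proof (cases "g \<in> B")
      case True
      show ?thesis
      proof (rule ex1I[of _ \<one>])
        show "\<one> \<in> insert \<one> T' \<and> g \<otimes> inv \<one> \<in> B" using True B_sub by simp
        show "t = \<one>" if "t \<in> insert \<one> T' \<and> g \<otimes> inv t \<in> B" for t
          using that nu_notin[OF True] TU by (auto simp: T'_def)
      qed
    next
      case False
      then have "g \<in> cell (w i)" using panel_cases[OF i g] by blast
      then obtain b c where bc: "b \<in> B" "c \<in> B" "g = b \<otimes> n \<otimes> c"
        using cell_repE w_in_W[OF i] n by metis
      obtain u h where uh: "u \<in> U" "h \<in> B \<inter> N" "c = h \<otimes> u" using bc(2) by (rule B_decomp')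
      \<comment> \<open>The H-part of c passes to the left of n, where B absorbs it; this leaves g =
        b' n u with u in U.\<close>
      define b' where "b' = b \<otimes> (n \<otimes> h \<otimes> inv n)"
      have b': "b' \<in> B" using bc(1) w_H_conj[OF w_in_W[OF i] n uh(2)] by (simp add: b'_def B_mult)
      have car: "b \<in> carrier G" "h \<in> carrier G" "u \<in> carrier G" "b' \<in> carrier G"
        using bc uh b' B_sub Ucar by auto
      have gt: "g \<otimes> inv (n \<otimes> t) = b' \<otimes> (n \<otimes> (u \<otimes> inv t) \<otimes> inv n)" if "t \<in> U" for t
        using car ncar Ucar[OF that] bc(3) uh(3) by (simp add: b'_def group_normalize)
      have iff: "g \<otimes> inv (n \<otimes> t) \<in> B \<longleftrightarrow> u \<otimes> inv t \<in> V" if t: "t \<in> U" for t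
      proof -
        have uU: "u \<otimes> inv t \<in> U"
          using uh(1) t U_subgroup by (simp add: subgroup.m_closed subgroup.m_inv_closed)
        let ?k = "n \<otimes> (u \<otimes> inv t) \<otimes> inv n"
        have k: "?k \<in> carrier G" using ncar Ucar[OF uU] by simp
        have "?k = inv b' \<otimes> (b' \<otimes> ?k)" using k car by (simp only: mult_inv_cancel)
        then have "b' \<otimes> ?k \<in> B \<longleftrightarrow> ?k \<in> B" using b' B_mult B_inv by metis
        then show ?thesis using uU gt[OF t] by (simp add: V_def)
      qed
      obtain t0 where t0: "t0 \<in> T" "u \<otimes> inv t0 \<in> V" "\<And>t. t \<in> T \<Longrightarrow> u \<otimes> inv t \<in> V \<Longrightarrow> t = t0"
        using T(1) uh(1) unfolding transversal_def by metis
      show ?thesis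
      proof (rule ex1I[of _ "n \<otimes> t0"])
        show "n \<otimes> t0 \<in> insert \<one> T' \<and> g \<otimes> inv (n \<otimes> t0) \<in> B"
          using t0(1,2) iff TU by (auto simp: T'_def)
        fix t assume t: "t \<in> insert \<one> T' \<and> g \<otimes> inv t \<in> B"
        have "t \<noteq> \<one>" using t False bc(3) car ncar B_sub[OF bc(2)] by auto
        then obtain t' where "t' \<in> T" "t = n \<otimes> t'" using t by (auto simp: T'_def)
        then show "t = n \<otimes> t0" using t0(3) iff TU t by auto
      qed
    qed
  qed
  moreover have "finite (insert \<one> T')" using TU U_finite finite_subset by (auto simp: T'_def)
  moreover have "\<forall>t\<in>insert \<one> T' - {\<one>}. t \<in> cell (w i)"
    using TU U_sub_B n w_in_W[OF i] cell_mult_B_right mem_cell by (auto simp: T'_def subset_iff)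
  moreover have "\<one> \<notin> T'" using one_notin unfolding T'_def by blast
  then have "insert \<one> T' - {\<one>} = T'" by simp
  moreover have "card T' = card T"
    unfolding T'_def using TU Ucar ncar
    by (intro card_image inj_on_inverseI[of _ "\<lambda>t. inv n \<otimes> t"]) (auto simp: group_normalize)
  ultimately show ?thesis using pT by (intro exI[of _ "insert \<one> T'"]) auto
qed

end

section \<open>Separation and multiplication of Bruhat cells by length\<close>

context split_BN_pair_with_roots
begin

sublocale Cox: reflection_group "weyl_group G B N" w I \<rho> R \<alpha>
  by unfold_locales
    (use w_in_W w_involution w_generate roots simple \<rho>_orthogonal \<rho>_mult \<rho>_faithful \<rho>_reflection
      in auto)

text \<open>Induction on the shorter length. Strip a left descent w_i from x: an element of w_i x
  lies in the cell of y or of w_i y. The first would give w_i x = y, impossible as w_i x is shorter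
  than x and y is not; in the second w_i cancels.\<close>

lemma cell_inj:
  assumes "x \<in> carrier W" "y \<in> carrier W" "cell x = cell y" "Cox.len x \<le> Cox.len y"
  shows "x = y"
  using assms
proof (induction "Cox.len x" arbitrary: x y rule: less_induct)
  case less
  show ?case
  proof (cases "x = \<one>\<^bsub>W\<^esub>")
    case True
    then have "cell y = B" using less.prems cell_one by simp
    moreover obtain n where "n \<in> y" using W_nonempty less.prems by blast
    ultimately have "n \<in> B \<inter> N" using mem_cell W_mem_N less.prems by blast
    then show ?thesis
      using W_eqI[of x y n] True \<open>n \<in> y\<close> less.prems by (simp add: W_one)
  next
    case False
    then obtain i where i: "i \<in> I" "Cox.pos (- \<rho> (inv\<^bsub>W\<^esub> x) (\<alpha> i))"
      using Cox.descent_exists[of "inv\<^bsub>W\<^esub> x"] less.prems by (auto simp: W.inv_eq_1_iff)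
    define x' where "x' = w i \<otimes>\<^bsub>W\<^esub> x"
    have wi: "w i \<in> carrier W" using w_in_W i by blast
    have x': "x' \<in> carrier W" using wi less.prems by (simp add: x'_def)
    have len: "Cox.len x' < Cox.len x"
      unfolding x'_def using Cox.len_left_mult_neg i less.prems by blast
    have xx': "w i \<otimes>\<^bsub>W\<^esub> x' = x" using Cox.w_cancel i less.prems by (simp add: x'_def)
    obtain n m where nm: "n \<in> w i" "m \<in> x" using W_nonempty wi less.prems by metis
    have "n \<otimes> m \<in> cell x'"
      using mem_cell[OF x'] W_mult_mem[OF nm] by (simp add: x'_def)
    moreover have "n \<otimes> m \<in> cell y \<union> cell (w i \<otimes>\<^bsub>W\<^esub> y)"
      using cell_w_mult[OF i(1), of y n m] mem_cell nm wi less.prems by auto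
    ultimately have "cell x' = cell y \<or> cell x' = cell (w i \<otimes>\<^bsub>W\<^esub> y)"
      using cell_eqI x' wi less.prems by (metis Un_iff W.m_closed)
    then show ?thesis
    proof
      assume "cell x' = cell y"
      then have "x' = y" using less.hyps[OF len x'] less.prems len by simp
      then show ?thesis using len less.prems by simp
    next
      assume *: "cell x' = cell (w i \<otimes>\<^bsub>W\<^esub> y)"
      have "Cox.len x' \<le> Cox.len (w i \<otimes>\<^bsub>W\<^esub> y)"
        using Cox.len_mult_w_ge[of y i] i less.prems len by simp
      then have "x' = w i \<otimes>\<^bsub>W\<^esub> y" using less.hyps[OF len x' _ *] wi less.prems by simp
      then show ?thesis using xx' Cox.w_cancel i less.prems by simp
    qed
  qed
qed

lemma cell_unique:
  assumes "x \<in> carrier W" "y \<in> carrier W" "g \<in> cell x" "g \<in> cell y"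
  shows "x = y"
  using cell_inj cell_eqI[OF assms] assms(1,2) by (metis nle_le)

text \<open>Write x = x' w_j with x' shorter; by induction the product with the x'-part lies in the
  cell of w_i x'. Were g h in the cell of x, undoing w_j would put that part in the cell of x or of
  x', so w_i x' would be x or x'; both contradict the lengths.\<close>

lemma cell_mult_up:
  assumes "i \<in> I" "x \<in> carrier W" "Cox.len x < Cox.len (w i \<otimes>\<^bsub>W\<^esub> x)" "g \<in> cell (w i)" "h \<in> cell x"
  shows "g \<otimes> h \<in> cell (w i \<otimes>\<^bsub>W\<^esub> x)"
  using assms
proof (induction "Cox.len x" arbitrary: x g h rule: less_induct)
  case less
  have wi: "w i \<in> carrier W" using w_in_W less.prems by blast
  show ?case
  proof (cases "x = \<one>\<^bsub>W\<^esub>")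
    case True
    then show ?thesis using less.prems cell_one cell_mult_B_right wi by simp
  next
    case False
    then obtain j where j: "j \<in> I" "Cox.pos (- \<rho> x (\<alpha> j))"
      using Cox.descent_exists[of x] less.prems by auto
    define x' where "x' = x \<otimes>\<^bsub>W\<^esub> w j"
    have wj: "w j \<in> carrier W" using w_in_W j by blast
    have x': "x' \<in> carrier W" using wj less.prems by (simp add: x'_def)
    have len: "Cox.len x' < Cox.len x"
      unfolding x'_def using Cox.len_mult_neg j less.prems by blast
    have xx': "x' \<otimes>\<^bsub>W\<^esub> w j = x" using Cox.w_cancel j less.prems by (simp add: x'_def)
    have "(w i \<otimes>\<^bsub>W\<^esub> x) \<otimes>\<^bsub>W\<^esub> w j = w i \<otimes>\<^bsub>W\<^esub> x'"
      using wi wj less.prems by (simp add: x'_def W.m_assoc)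
    then have "Cox.len (w i \<otimes>\<^bsub>W\<^esub> x) \<le> Suc (Cox.len (w i \<otimes>\<^bsub>W\<^esub> x'))"
      using Cox.len_right_mult_ge[of "w i \<otimes>\<^bsub>W\<^esub> x" j] wi j less.prems by simp
    then have len': "Cox.len x' < Cox.len (w i \<otimes>\<^bsub>W\<^esub> x')" using less.prems(3) len by simp
    obtain b n c where h: "b \<in> B" "n \<in> x" "c \<in> B" "h = b \<otimes> n \<otimes> c" using less.prems(5) by (rule cellE)
    obtain n' m where nm: "n' \<in> x'" "m \<in> w j" "n = n' \<otimes> m"
      using h(2) xx' by (metis W_mult_memE)
    have car: "n' \<in> carrier G" "m \<in> carrier G" "g \<in> carrier G" "b \<in> carrier G" "c \<in> carrier G"
      using nm W_mem x' wj less.prems cell_sub wi h B_sub by blast+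
    define k where "k = g \<otimes> (b \<otimes> n')"
    have kc: "k \<in> carrier G" using car by (simp add: k_def)
    have k: "k \<in> cell (w i \<otimes>\<^bsub>W\<^esub> x')"
      unfolding k_def using less.hyps[OF len less.prems(1) x' len' less.prems(4)]
        cell_mult_B_left mem_cell x' nm(1) h(1) by blast
    have gh: "g \<otimes> h = k \<otimes> m \<otimes> c" using h nm car by (simp add: k_def m_assoc)
    have "g \<otimes> h \<notin> cell x"
    proof
      assume "g \<otimes> h \<in> cell x"
      then have "(g \<otimes> h) \<otimes> inv c \<otimes> inv m \<in> cell x \<union> cell x'"
        unfolding x'_def
        using cell_mult_w[OF j(1) less.prems(2), of "g \<otimes> h \<otimes> inv c" "inv m"]
          cell_mult_B_right[OF less.prems(2), of "g \<otimes> h" "inv c"] h(3) B_inv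
          mem_cell[OF wj, of "inv m"] W_inv_mem[OF wj nm(2)] inv_w[OF j(1)] by simp
      then have "k \<in> cell x \<union> cell x'" using gh car kc by (simp add: group_normalize)
      then have "w i \<otimes>\<^bsub>W\<^esub> x' = x \<or> w i \<otimes>\<^bsub>W\<^esub> x' = x'"
        using cell_unique[OF _ x' k] cell_unique[OF _ less.prems(2) k] W.m_closed[OF wi x'] by blast
      then show False
      proof
        assume "w i \<otimes>\<^bsub>W\<^esub> x' = x"
        then have "w i \<otimes>\<^bsub>W\<^esub> x = x'" using Cox.w_cancel less.prems(1) x' by metis
        then show False using less.prems(3) len by simp
      next
        assume "w i \<otimes>\<^bsub>W\<^esub> x' = x'"
        then show False using len' by simp
      qed
    qed
    then show ?thesis using cell_w_mult[of i x g h] less.prems by blast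
  qed
qed

lemma cell_mult_up_right:
  assumes "i \<in> I" "x \<in> carrier W" "Cox.len x < Cox.len (x \<otimes>\<^bsub>W\<^esub> w i)" "g \<in> cell x" "h \<in> cell (w i)"
  shows "g \<otimes> h \<in> cell (x \<otimes>\<^bsub>W\<^esub> w i)"
proof -
  have wi: "w i \<in> carrier W" using w_in_W assms(1) .
  have gh: "g \<in> carrier G" "h \<in> carrier G" using assms cell_sub wi by blast+
  have inv: "inv\<^bsub>W\<^esub> (x \<otimes>\<^bsub>W\<^esub> w i) = w i \<otimes>\<^bsub>W\<^esub> inv\<^bsub>W\<^esub> x"
    using wi assms by (simp add: W.inv_mult_group inv_w)
  have "inv h \<otimes> inv g \<in> cell (w i \<otimes>\<^bsub>W\<^esub> inv\<^bsub>W\<^esub> x)"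
    using cell_inv[OF wi assms(5)] cell_inv[OF assms(2,4)] inv_w[OF assms(1)] assms(1-3) wi
      Cox.len_inv[of x] Cox.len_inv[of "x \<otimes>\<^bsub>W\<^esub> w i"]
    by (intro cell_mult_up) (auto simp: inv)
  then have "inv (inv h \<otimes> inv g) \<in> cell (inv\<^bsub>W\<^esub> (inv\<^bsub>W\<^esub> (x \<otimes>\<^bsub>W\<^esub> w i)))"
    unfolding inv[symmetric] using wi assms by (intro cell_inv) auto
  then show ?thesis using gh wi assms by (simp add: inv_mult_group)
qed

end

section \<open>Modules in characteristic p\<close>

context kG_module
begin

lemma M_zero: "0 \<in> M" and M_add: "u \<in> M \<Longrightarrow> v \<in> M \<Longrightarrow> u + v \<in> M"
  and M_scale: "v \<in> M \<Longrightarrow> smul c v \<in> M" and M_sum: "(\<And>a. a \<in> A \<Longrightarrow> f a \<in> M) \<Longrightarrow> sum f A \<in> M"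
  using M_subspace by (auto intro: subspace_0 subspace_add subspace_scale subspace_sum)

lemma act_zero: "g \<in> carrier G \<Longrightarrow> act g 0 = 0"
  using act_scale[of g 0 0] M_zero by simp

lemma act_sum:
  assumes "g \<in> carrier G" "\<And>a. a \<in> A \<Longrightarrow> f a \<in> M"
  shows "act g (\<Sum>a\<in>A. f a) = (\<Sum>a\<in>A. act g (f a))"
  using assms(2)
proof (induction A rule: infinite_finite_induct)
  case (insert a A)
  then show ?case using assms(1) by (simp add: act_add M_sum)
qed (use assms(1) in \<open>simp_all add: act_zero\<close>)

lemma act_inv: "g \<in> carrier G \<Longrightarrow> v \<in> M \<Longrightarrow> act (inv g) (act g v) = v"
  by (simp add: act_mult[symmetric] act_one)

lemma submoduleI:
  assumes "L \<subseteq> M" "0 \<in> L" "\<And>u v. u \<in> L \<Longrightarrow> v \<in> L \<Longrightarrow> u + v \<in> L"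
    "\<And>c v. v \<in> L \<Longrightarrow> smul c v \<in> L" "\<And>g v. g \<in> carrier G \<Longrightarrow> v \<in> L \<Longrightarrow> act g v \<in> L"
  shows "kG_module G smul act L"
  using assms(1) by unfold_locales
    (auto simp: subspace_def assms(2-5) act_add act_scale act_one act_mult subset_iff)

lemma restrict_group:
  assumes "subgroup Q G"
  shows "kG_module (G\<lparr>carrier := Q\<rparr>) smul act M"
proof -
  interpret Q: group "G\<lparr>carrier := Q\<rparr>" using assms by (rule G.subgroup_imp_group)
  show ?thesis
    using subgroup.subset[OF assms] M_subspace
    by unfold_locales (auto simp: act_closed act_add act_scale act_one act_mult subset_iff)
qed

end

text \<open>The range of \<open>of_nat\<close> is the prime field. It is closed under negation
  because - n equals p n - n, a natural number.\<close>

lemma range_of_nat_CHAR: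
  assumes "CHAR('k::field) = p" "p > 0"
  shows "finite (range (of_nat :: nat \<Rightarrow> 'k))" "card (range (of_nat :: nat \<Rightarrow> 'k)) = p"
    "(c :: 'k) \<in> range of_nat \<Longrightarrow> - c \<in> range of_nat"
proof -
  have mod: "(of_nat n :: 'k) = of_nat (n mod p)" for n
    by (simp add: of_nat_eq_iff_cong_CHAR assms(1) Cong.cong_def)
  have eq: "range (of_nat :: nat \<Rightarrow> 'k) = of_nat ` {..<p}"
    using mod assms(2) by (auto simp: image_iff) (metis lessThan_iff mod_less_divisor)
  then show "finite (range (of_nat :: nat \<Rightarrow> 'k))" by simp
  have "inj_on (of_nat :: nat \<Rightarrow> 'k) {..<p}"
    by (rule inj_onI) (simp add: of_nat_eq_iff_cong_CHAR assms(1) Cong.cong_def)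
  then show "card (range (of_nat :: nat \<Rightarrow> 'k)) = p" by (simp add: eq card_image)
  assume "c \<in> range of_nat"
  then obtain n where n: "c = of_nat n" by blast
  have "(of_nat (p * n) :: 'k) = 0"
    using of_nat_CHAR[where 'a='k] assms(1) by simp
  moreover have "p * n = (p * n - n) + n" using assms(2) by simp
  ultimately have "(of_nat (p * n - n) :: 'k) + of_nat n = 0" by (metis of_nat_add)
  then have "- c = of_nat (p * n - n)" unfolding n by (metis add_eq_0_iff add.commute)
  then show "- c \<in> range of_nat" by blast
qed

text \<open>Orbit sizes are powers of p. Without a fixed point none is 1, so p divides each of them
  and hence their sum.\<close>

lemma (in group_action) p_group_fixed_point:
  assumes "finite E" "prime p" "order G = p ^ a" "\<not> p dvd card E"
  shows "\<exists>x\<in>E. \<forall>g\<in>carrier G. \<phi> g x = x"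
proof (rule ccontr)
  assume contra: "\<not> ?thesis"
  interpret group_hom G "BijGroup E" \<phi> by (rule group_hom)
  have Un: "\<Union>(orbits G E \<phi>) = E" by (rule orbits_coverture)
  have "p dvd card (\<Union>(orbits G E \<phi>))"
  proof (rule dvd_partition)
    show "finite (\<Union>(orbits G E \<phi>))" using assms(1) Un by simp
    show "\<forall>c1\<in>orbits G E \<phi>. \<forall>c2\<in>orbits G E \<phi>. c1 \<noteq> c2 \<longrightarrow> c1 \<inter> c2 = {}"
      using disjoint_union by blast
    show "\<forall>c\<in>orbits G E \<phi>. p dvd card c"
    proof
      fix c assume "c \<in> orbits G E \<phi>"
      then obtain x where x: "x \<in> E" "c = orbit G \<phi> x" by (auto simp: orbits_def)
      then have "card c dvd p ^ a"
        using orbit_stabilizer_theorem assms(3) by (metis dvd_triv_left)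
      then obtain j where j: "card c = p ^ j" using divides_primepow_nat assms(2) by blast
      have "card c \<noteq> 1"
      proof
        assume "card c = 1"
        then obtain y where y: "c = {y}" using card_1_singletonE by blast
        have "\<phi> g x \<in> c" if "g \<in> carrier G" for g using x(2) that by (auto simp: orbit_def)
        moreover have "x \<in> c" using x orbit_refl by simp
        ultimately have "\<forall>g\<in>carrier G. \<phi> g x = x" using y by auto
        then show False using contra x(1) by blast
      qed
      then show "p dvd card c" using j by (cases j) auto
    qed
  qed
  then show False using Un assms(4) by simp
qed

section \<open>Fixed vectors and invariant functionals of p-groups\<close>

context kG_module
begin

text \<open>The span of an orbit over the prime field is a finite set on which \<open>G\<close> acts; counting fixed
  points modulo \<open>p\<close> gives one besides \<open>0\<close>.\<close>

lemma p_group_fixed_vector: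
  assumes p: "prime p" "CHAR('k) = p" and card: "order G = p ^ a" and "M \<noteq> {0}"
  shows "\<exists>v\<in>M. v \<noteq> 0 \<and> (\<forall>g\<in>carrier G. act g v = v)"
proof -
  obtain m where m: "m \<in> M" "m \<noteq> 0" using \<open>M \<noteq> {0}\<close> M_zero by blast
  have p0: "p > 0" using p(1) prime_gt_0_nat by blast
  have fin: "finite (carrier G)" using card p0 by (metis card.infinite order_def power_not_zero less_numeral_extra(3))
  define K where "K = (range of_nat :: 'k set)"
  note K = range_of_nat_CHAR[OF p(2) p0, folded K_def]
  have K_add: "c + d \<in> K" if "c \<in> K" "d \<in> K" for c d
    using that by (auto simp: K_def simp flip: of_nat_add)
  have K_01: "0 \<in> K" "1 \<in> K" unfolding K_def by (metis of_nat_0 rangeI) (metis of_nat_1 rangeI)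
  define S where "S c = (\<Sum>g\<in>carrier G. smul (c g) (act g m))" for c
  define X where "X = S ` {c. \<forall>g\<in>carrier G. c g \<in> K}"
  have S_M: "S c \<in> M" for c
    unfolding S_def by (intro M_sum M_scale act_closed m)
  have "X \<subseteq> S ` (carrier G \<rightarrow>\<^sub>E K)"
  proof
    fix x assume "x \<in> X"
    then obtain c where c: "x = S c" "\<forall>g\<in>carrier G. c g \<in> K" by (auto simp: X_def)
    then have "x = S (restrict c (carrier G))" by (simp add: S_def)
    moreover have "restrict c (carrier G) \<in> carrier G \<rightarrow>\<^sub>E K" using c(2) by auto
    ultimately show "x \<in> S ` (carrier G \<rightarrow>\<^sub>E K)" by blast
  qed
  then have finX: "finite X" using fin K(1) finite_PiE finite_surj by metis
  have X_M: "X \<subseteq> M" using S_M by (auto simp: X_def)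
  have X_zero: "0 \<in> X" unfolding X_def S_def
    by (rule image_eqI[of _ _ "\<lambda>_. 0"]) (use K_01 in auto)
  have X_add: "x + smul d m \<in> X" if "x \<in> X" "d \<in> K" for x d
  proof -
    obtain c where c: "x = S c" "\<forall>g\<in>carrier G. c g \<in> K" using \<open>x \<in> X\<close> by (auto simp: X_def)
    have "x + smul d m = S (c(\<one> := c \<one> + d))"
      unfolding c(1) S_def using fin m(1)
      by (simp add: sum.remove[of "carrier G" \<one>] act_one scale_left_distrib)
    moreover have "\<forall>g\<in>carrier G. (c(\<one> := c \<one> + d)) g \<in> K" using c(2) that(2) K_add by auto
    ultimately show ?thesis unfolding X_def by blast
  qed
  have X_act: "act h x \<in> X" if "h \<in> carrier G" "x \<in> X" for h x
  proof -
    obtain c where c: "x = S c" "\<forall>g\<in>carrier G. c g \<in> K" using \<open>x \<in> X\<close> by (auto simp: X_def)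
    have "act h x = (\<Sum>g\<in>carrier G. smul (c g) (act (h \<otimes> g) m))"
      unfolding c(1) S_def using that(1) m(1)
      by (simp add: act_sum M_scale act_closed act_scale act_mult)
    also have "\<dots> = S (\<lambda>g. c (inv h \<otimes> g))"
      unfolding S_def
      by (rule sum.reindex_bij_witness[of _ "\<lambda>g. inv h \<otimes> g" "\<lambda>g. h \<otimes> g"])
        (use that(1) in \<open>auto simp: G.m_assoc[symmetric]\<close>)
    finally show ?thesis unfolding X_def using c(2) that(1) by auto
  qed
  have "p dvd card X"
  proof -
    \<comment> \<open>Translation by prime-field multiples of m cuts X into classes of size p. This
      gives divisibility by p without computing the size of X.\<close>
    define C where "C x = (\<lambda>d. x + smul d m) ` K" for x
    have C_sub: "C x \<subseteq> C y" if "x + smul c m = y + smul d m" "c \<in> K" "d \<in> K" for x y c d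
    proof
      fix z assume "z \<in> C x"
      then obtain b where b: "b \<in> K" "z = x + smul b m" by (auto simp: C_def)
      have "x = y + smul d m - smul c m" using that(1) by (metis add_diff_cancel_right')
      then have "z = y + smul (d + (- c + b)) m"
        using b(2) by (simp add: scale_left_distrib scale_minus_left scale_left_diff_distrib)
      moreover have "d + (- c + b) \<in> K" using that b(1) K(3) K_add by blast
      ultimately show "z \<in> C y" by (auto simp: C_def)
    qed
    have Un: "\<Union>(C ` X) = X"
      using X_add K_01(1) unfolding C_def by force
    have "p dvd card (\<Union>(C ` X))"
    proof (rule dvd_partition)
      show "finite (\<Union>(C ` X))" using Un finX by simp
      have "inj_on (\<lambda>d. x + smul d m) K" for x
        using m(2) by (auto intro!: inj_onI)
      then show "\<forall>c\<in>C ` X. p dvd card c" using K(2) by (auto simp: C_def card_image)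
      show "\<forall>c1\<in>C ` X. \<forall>c2\<in>C ` X. c1 \<noteq> c2 \<longrightarrow> c1 \<inter> c2 = {}"
      proof (intro ballI impI, rule ccontr)
        fix c1 c2 assume *: "c1 \<in> C ` X" "c2 \<in> C ` X" "c1 \<noteq> c2" "c1 \<inter> c2 \<noteq> {}"
        then obtain x y where xy: "c1 = C x" "c2 = C y" by blast
        with *(4) obtain c d where "x + smul c m = y + smul d m" "c \<in> K" "d \<in> K"
          by (auto simp: C_def)
        then have "C x \<subseteq> C y" "C y \<subseteq> C x" using C_sub by metis+
        then show False using xy *(3) by blast
      qed
    qed
    then show ?thesis using Un by simp
  qed
  then have "\<not> p dvd card (X - {0})"
  proof -
    assume *: "p dvd card X"
    have "card X = Suc (card (X - {0}))" using finX X_zero by (metis card_Suc_Diff1)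
    then have "\<not> p dvd card (X - {0})" if "p \<noteq> 1"
      using * that by (metis dvd_add_right_iff Suc_eq_plus1 dvd_1_left nat_dvd_1_iff_1)
    then show ?thesis using p(1) not_prime_1 by blast
  qed
  moreover have "group_action G (X - {0}) (\<lambda>g. restrict (act g) (X - {0}))"
  proof -
    \<comment> \<open>Zero is removed because it is always fixed; what remains is stable, since the
      action is invertible, and its size is prime to p.\<close>
    have nz: "act g x \<in> X - {0}" if "g \<in> carrier G" "x \<in> X - {0}" for g x
      using that X_act X_M act_inv[of g x] act_zero[of "inv g"] by auto
    have "restrict (act g) (X - {0}) \<in> carrier (BijGroup (X - {0}))" if g: "g \<in> carrier G" for g
    proof -
      have "bij_betw (act g) (X - {0}) (X - {0})"
        by (rule bij_betw_byWitness[of _ "act (inv g)"])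
          (use g nz X_M act_inv[of g] act_inv[of "inv g"] in auto)
      then show ?thesis by (simp add: BijGroup_def Bij_def bij_betw_restrict_eq)
    qed
    then have "(\<lambda>g. restrict (act g) (X - {0})) \<in> hom G (BijGroup (X - {0}))"
      using nz X_M by (auto simp: hom_def BijGroup_def compose_def restrict_def fun_eq_iff act_mult)
    then show ?thesis
      by (simp add: group_action_def group_hom_def group_hom_axioms_def group_BijGroup G.is_group)
  qed
  ultimately have "\<exists>x\<in>X - {0}. \<forall>g\<in>carrier G. restrict (act g) (X - {0}) x = x"
    by (intro group_action.p_group_fixed_point[OF _ _ p(1) card] finite_Diff finX)
  then show ?thesis using X_M by auto
qed

text \<open>Functionals are set to zero outside M, so that equality of functions is equality of
  functionals on M.\<close>

definition dual :: "('m \<Rightarrow> 'k) set"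
  where "dual = {\<phi>. (\<forall>u\<in>M. \<forall>v\<in>M. \<phi> (u + v) = \<phi> u + \<phi> v) \<and>
    (\<forall>c. \<forall>v\<in>M. \<phi> (smul c v) = c * \<phi> v) \<and> (\<forall>v. v \<notin> M \<longrightarrow> \<phi> v = 0)}"

definition dual_act :: "'g \<Rightarrow> ('m \<Rightarrow> 'k) \<Rightarrow> 'm \<Rightarrow> 'k"
  where "dual_act g \<phi> = (\<lambda>v. if v \<in> M then \<phi> (act (inv g) v) else 0)"

lemma dual_module: "kG_module G fun_scale dual_act dual"
proof -
  interpret V: vector_space "fun_scale :: 'k \<Rightarrow> ('m \<Rightarrow> 'k) \<Rightarrow> _"
    by (rule vector_space_fun_scale)
  show ?thesis
    by unfold_locales
      (auto simp: V.subspace_def dual_def dual_act_def fun_scale_def fun_eq_iff algebra_simps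
        act_closed act_add act_scale act_one act_mult M_add M_scale G.inv_mult_group)
qed

text \<open>A nonzero vector is an independent set, so a linear map on the ambient space sends it to
  1; cutting this map off outside M gives the functional.\<close>

lemma dual_nonzero:
  assumes "M \<noteq> {0}"
  shows "dual \<noteq> {0}"
proof -
  obtain m where m: "m \<in> M" "m \<noteq> 0" using assms M_zero by blast
  interpret K: vector_space "(*) :: 'k \<Rightarrow> 'k \<Rightarrow> 'k" by unfold_locales (auto simp: algebra_simps)
  interpret P: vector_space_pair smul "(*) :: 'k \<Rightarrow> 'k \<Rightarrow> 'k" ..
  have "independent {m}" using m(2) by simp
  then obtain f where f: "Vector_Spaces.linear smul (*) f" "f m = 1"
    using P.linear_independent_extend[of "{m}" "\<lambda>_. 1"] by auto
  define \<phi> where "\<phi> v = (if v \<in> M then f v else 0)" for v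
  have "\<phi> \<in> dual"
    using f(1) M_add M_scale
    by (auto simp: dual_def \<phi>_def P.linear_add P.linear_scale)
  moreover have "\<phi> m \<noteq> 0" using m(1) f(2) by (simp add: \<phi>_def)
  then have "\<phi> \<noteq> 0" by (metis zero_fun_apply)
  ultimately show ?thesis by blast
qed

text \<open>An invariant functional is a fixed vector of the p-group on the dual, where
  \<open>p_group_fixed_vector\<close> applies in any dimension.\<close>

lemma invariant_functional:
  assumes p: "prime p" "CHAR('k) = p" and Q: "subgroup Q G" "card Q = p ^ a" and "M \<noteq> {0}"
  obtains \<mu> where "\<mu> \<in> dual" "\<exists>v\<in>M. \<mu> v \<noteq> 0" "\<And>u v. u \<in> Q \<Longrightarrow> v \<in> M \<Longrightarrow> \<mu> (act u v) = \<mu> v"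
proof -
  interpret D: kG_module G fun_scale dual_act dual by (rule dual_module)
  interpret DQ: kG_module "G\<lparr>carrier := Q\<rparr>" fun_scale dual_act dual by (rule D.restrict_group[OF Q(1)])
  have "order (G\<lparr>carrier := Q\<rparr>) = p ^ a" using Q(2) by (simp add: order_def)
  from DQ.p_group_fixed_vector[OF p this dual_nonzero[OF assms(5)]]
  obtain \<mu> where l: "\<mu> \<in> dual" "\<mu> \<noteq> 0" "\<And>u. u \<in> Q \<Longrightarrow> dual_act u \<mu> = \<mu>" by auto
  show ?thesis
  proof (rule that[OF l(1)])
    show "\<exists>v\<in>M. \<mu> v \<noteq> 0" using l(1,2) by (auto simp: dual_def fun_eq_iff)
    fix u v assume u: "u \<in> Q" and v: "v \<in> M"
    have uG: "u \<in> carrier G" using Q(1) u by (rule subgroup.mem_carrier)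
    have "\<mu> (act u v) = dual_act u \<mu> (act u v)" using l(3) u by simp
    also have "\<dots> = \<mu> v" using uG v by (simp add: dual_act_def act_closed act_inv)
    finally show "\<mu> (act u v) = \<mu> v" .
  qed
qed

end

lemma simple_submodule_cases:
  assumes "simple_kG_module G smul act M" "L \<subseteq> M" "0 \<in> L"
    "\<And>u v. u \<in> L \<Longrightarrow> v \<in> L \<Longrightarrow> u + v \<in> L" "\<And>c v. v \<in> L \<Longrightarrow> smul c v \<in> L"
    "\<And>g v. g \<in> carrier G \<Longrightarrow> v \<in> L \<Longrightarrow> act g v \<in> L"
  shows "L = {0} \<or> L = M"
  using assms kG_module.submoduleI[of G smul act M L] unfolding simple_kG_module_def by blast

lemma kG_hom_image_module:
  assumes "kG_module G smul act M" "kG_module G smul' act' M'" "kG_hom G smul act M smul' act' M' \<phi>"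
  shows "kG_module G smul' act' (\<phi> ` M)"
proof -
  interpret A: kG_module G smul act M by fact
  interpret A': kG_module G smul' act' M' by fact
  have sub: "\<phi> ` M \<subseteq> M'" and add: "\<And>u v. u \<in> M \<Longrightarrow> v \<in> M \<Longrightarrow> \<phi> u + \<phi> v = \<phi> (u + v)"
    and scale: "\<And>c v. v \<in> M \<Longrightarrow> smul' c (\<phi> v) = \<phi> (smul c v)"
    and act: "\<And>g v. g \<in> carrier G \<Longrightarrow> v \<in> M \<Longrightarrow> act' g (\<phi> v) = \<phi> (act g v)"
    using assms(3) unfolding kG_hom_def by simp_all
  show ?thesis
  proof (rule A'.submoduleI[OF sub])
    have "smul' 0 (\<phi> 0) = \<phi> (smul 0 0)" using scale A.M_zero by blast
    then show "0 \<in> \<phi> ` M" using A.M_zero by (metis A'.scale_zero_left imageI A.scale_zero_left)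
  qed (auto simp: add scale act A.M_add A.M_scale A.act_closed)
qed

lemma fixed_line_generator:
  assumes "kG_module G smul act M" "fixed_line_property G U P smul act M"
    "U \<subseteq> carrier G"
  obtains v where "v \<in> fixed_points act M U" "v \<noteq> 0"
    "fixed_points act M U = range (\<lambda>c. smul c v)"
proof -
  interpret kG_module G smul act M by fact
  let ?F = "fixed_points act M U"
  have "dim ?F = 1" using assms(2) by (simp add: fixed_line_property_def)
  then obtain A where A: "A \<subseteq> ?F" "independent A" "?F \<subseteq> span A" "card A = 1"
    using basis_exists by metis
  then obtain v where v: "A = {v}" using card_1_singletonE by blast
  then have "v \<noteq> 0" "v \<in> ?F" using A dependent_single by auto
  moreover have "?F = range (\<lambda>c. smul c v)"
  proof
    show "?F \<subseteq> range (\<lambda>c. smul c v)" using A(3) v span_singleton by auto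
    show "range (\<lambda>c. smul c v) \<subseteq> ?F"
      using \<open>v \<in> ?F\<close> assms(3) by (auto simp: fixed_points_def M_scale act_scale subset_iff)
  qed
  ultimately show ?thesis using that by blast
qed

section \<open>The oppositeness map\<close>

locale opposite_parabolics = split_BN_pair_with_roots +
  fixes w0 J K
  assumes w0_longest: "longest_element (weyl_group G B N) (w ` I) w0"
    and JK_opposite: "opposite_cotypes I \<alpha> (\<rho> w0) J K"
begin

sublocale Lon: reflection_group_longest "weyl_group G B N" w I \<rho> R \<alpha> w0
  by unfold_locales (rule w0_longest)

abbreviation PJ where "PJ \<equiv> parabolic G B N w J"
abbreviation PK where "PK \<equiv> parabolic G B N w K"
abbreviation WJ where "WJ \<equiv> generate W (w ` J)"
abbreviation WK where "WK \<equiv> generate W (w ` K)"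

text \<open>This is \<open>P\<^sub>K w\<^sub>0 P\<^sub>J\<close>: since w_0 W_J = W_K w_0, the Weyl
  group elements involved form the coset W_K w_0. Written by cells, membership becomes a condition
  on the Weyl group.\<close>

definition opp_cell :: "'a set"
  where "opp_cell = (\<Union>y\<in>(\<lambda>a. a \<otimes>\<^bsub>W\<^esub> w0) ` WK. cell y)"

lemma J_sub: "J \<subseteq> I" and K_sub: "K \<subseteq> I"
  using JK_opposite by (auto simp: opposite_cotypes_def)

lemmas w0_closed = Lon.w0_closed

lemma w0_mem: "n \<in> w0 \<Longrightarrow> n \<in> carrier G"
  using W_mem w0_closed by blast

lemma w0_sub: "w0 \<subseteq> carrier G"
  using w0_mem by blast

lemma PJ_subgroup: "subgroup PJ G" and PK_subgroup: "subgroup PK G"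
  using parabolic_subgroup J_sub K_sub by auto

lemmas PJ_sub = subgroup.subset[OF PJ_subgroup] and PK_sub = subgroup.subset[OF PK_subgroup]

lemma PJ_mem: "g \<in> PJ \<Longrightarrow> g \<in> carrier G" and PK_mem: "g \<in> PK \<Longrightarrow> g \<in> carrier G"
  using PJ_sub PK_sub by auto

lemma PJ_closed: "g \<in> PJ \<Longrightarrow> h \<in> PJ \<Longrightarrow> g \<otimes> h \<in> PJ" "g \<in> PJ \<Longrightarrow> inv g \<in> PJ"
  and PK_closed: "g \<in> PK \<Longrightarrow> h \<in> PK \<Longrightarrow> g \<otimes> h \<in> PK" "g \<in> PK \<Longrightarrow> inv g \<in> PK"
  using PJ_subgroup PK_subgroup by (auto intro: subgroup.m_closed subgroup.m_inv_closed)

lemma B_PJ: "b \<in> B \<Longrightarrow> b \<in> PJ" and B_PK: "b \<in> B \<Longrightarrow> b \<in> PK"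
  using B_sub_parabolic by auto

lemma WK_closed: "a \<in> WK \<Longrightarrow> a \<in> carrier W" and WJ_closed: "a \<in> WJ \<Longrightarrow> a \<in> carrier W"
  using generate_W_sub K_sub J_sub by blast+

lemma w0_right: "x \<in> carrier W \<Longrightarrow> x \<otimes>\<^bsub>W\<^esub> w0 \<otimes>\<^bsub>W\<^esub> w0 = x"
  using W.r_inv[OF w0_closed] w0_closed by (simp add: Lon.inv_w0 W.m_assoc)

lemma opp_cellE:
  assumes "g \<in> opp_cell"
  obtains y where "y \<in> carrier W" "g \<in> cell y" "y \<otimes>\<^bsub>W\<^esub> w0 \<in> WK"
proof -
  obtain a where "a \<in> WK" "g \<in> cell (a \<otimes>\<^bsub>W\<^esub> w0)" using assms by (auto simp: opp_cell_def)
  then show ?thesis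
    using that[of "a \<otimes>\<^bsub>W\<^esub> w0"] WK_closed w0_closed w0_right by simp
qed

lemma opp_cell_iff:
  assumes "y \<in> carrier W" "g \<in> cell y"
  shows "g \<in> opp_cell \<longleftrightarrow> y \<otimes>\<^bsub>W\<^esub> w0 \<in> WK"
proof
  assume "g \<in> opp_cell"
  then show "y \<otimes>\<^bsub>W\<^esub> w0 \<in> WK" using opp_cellE cell_unique assms by metis
next
  assume "y \<otimes>\<^bsub>W\<^esub> w0 \<in> WK"
  moreover have "g \<in> cell (y \<otimes>\<^bsub>W\<^esub> w0 \<otimes>\<^bsub>W\<^esub> w0)" using assms w0_right by simp
  ultimately show "g \<in> opp_cell" unfolding opp_cell_def by blast
qed

lemma opp_cell_PK:
  assumes "g \<in> PK" "h \<in> opp_cell"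
  shows "g \<otimes> h \<in> opp_cell"
  unfolding opp_cell_def
proof (rule parabolic_mult_cells[OF K_sub _ _ assms(1)])
  show "(\<lambda>a. a \<otimes>\<^bsub>W\<^esub> w0) ` WK \<subseteq> carrier W" using WK_closed w0_closed by auto
  fix i x assume i: "i \<in> K" and "x \<in> (\<lambda>a. a \<otimes>\<^bsub>W\<^esub> w0) ` WK"
  then obtain a where a: "a \<in> WK" "x = a \<otimes>\<^bsub>W\<^esub> w0" by blast
  have "w i \<otimes>\<^bsub>W\<^esub> x = (w i \<otimes>\<^bsub>W\<^esub> a) \<otimes>\<^bsub>W\<^esub> w0"
    using a w_in_W[of i] i K_sub WK_closed w0_closed by (simp add: W.m_assoc subset_iff)
  moreover have "w i \<otimes>\<^bsub>W\<^esub> a \<in> WK" using a(1) i by (simp add: generate.eng generate.incl)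
  ultimately show "w i \<otimes>\<^bsub>W\<^esub> x \<in> (\<lambda>a. a \<otimes>\<^bsub>W\<^esub> w0) ` WK" by blast
qed (use assms(2) in \<open>simp add: opp_cell_def\<close>)

text \<open>A generator w_i with i in J passes w_0 and becomes some w_j with j in K, which W_K
  absorbs. Here the opposition of J and K enters.\<close>

lemma opp_cell_PJ:
  assumes "g \<in> PJ" "h \<in> opp_cell"
  shows "h \<otimes> g \<in> opp_cell"
  unfolding opp_cell_def
proof (rule cells_mult_parabolic[OF J_sub _ _ assms(1)])
  show "(\<lambda>a. a \<otimes>\<^bsub>W\<^esub> w0) ` WK \<subseteq> carrier W" using WK_closed w0_closed by auto
  fix i x assume i: "i \<in> J" and "x \<in> (\<lambda>a. a \<otimes>\<^bsub>W\<^esub> w0) ` WK"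
  then obtain a where a: "a \<in> WK" "x = a \<otimes>\<^bsub>W\<^esub> w0" by blast
  obtain j where j: "j \<in> K" "w0 \<otimes>\<^bsub>W\<^esub> w i = w j \<otimes>\<^bsub>W\<^esub> w0"
    using Lon.opposite_generator[OF JK_opposite i] by blast
  have "i \<in> I" "j \<in> I" using i j J_sub K_sub by auto
  then have "x \<otimes>\<^bsub>W\<^esub> w i = (a \<otimes>\<^bsub>W\<^esub> w j) \<otimes>\<^bsub>W\<^esub> w0"
    using a j(2) w_in_W WK_closed w0_closed by (simp add: W.m_assoc)
  moreover have "a \<otimes>\<^bsub>W\<^esub> w j \<in> WK" using a(1) j(1) by (simp add: generate.eng generate.incl)
  ultimately show "x \<otimes>\<^bsub>W\<^esub> w i \<in> (\<lambda>a. a \<otimes>\<^bsub>W\<^esub> w0) ` WK" by blast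
qed (use assms(2) in \<open>simp add: opp_cell_def\<close>)

lemma w0_opp_cell: "n \<in> w0 \<Longrightarrow> n \<in> opp_cell"
  using opp_cell_iff[of w0 n] w0_closed mem_cell W.r_inv[OF w0_closed]
  by (simp add: Lon.inv_w0 generate.one)

lemma opp_cell_factor:
  assumes "g \<in> opp_cell" "n \<in> w0"
  obtains q b where "q \<in> PK" "b \<in> B" "g = q \<otimes> n \<otimes> b"
proof -
  obtain a where a: "a \<in> WK" "g \<in> cell (a \<otimes>\<^bsub>W\<^esub> w0)" using assms(1) by (auto simp: opp_cell_def)
  obtain m where m: "m \<in> a" using W_nonempty WK_closed[OF a(1)] by blast
  have mc: "m \<in> carrier G" using m W_mem WK_closed a(1) by blast
  obtain b c where bc: "b \<in> B" "c \<in> B" "g = b \<otimes> (m \<otimes> n) \<otimes> c"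
    using cell_repE[OF a(2) _ W_mult_mem[OF m assms(2)]] WK_closed[OF a(1)] w0_closed by auto
  have "m \<in> PK" using m a(1) mem_cell WK_closed parabolic_iff by blast
  then have "b \<otimes> m \<in> PK" using bc(1) B_PK PK_closed by blast
  moreover have "g = (b \<otimes> m) \<otimes> n \<otimes> c"
    using bc mc w0_mem[OF assms(2)] B_sub by (simp add: m_assoc)
  ultimately show ?thesis using that bc(2) by blast
qed

text \<open>The object \<open>PJ\<close> lies in \<open>P\<^sub>J w\<^sub>0 P\<^sub>K h\<close>
  exactly when 1 does, that is when h lies in \<open>P\<^sub>K w\<^sub>0 P\<^sub>J\<close>, because
  w_0 is its own inverse.\<close>

lemma opposite_iff:
  assumes h: "h \<in> carrier G"
  shows "opposite_objects G PJ w0 PJ (PK #> h) \<longleftrightarrow> h \<in> opp_cell"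
proof
  assume "opposite_objects G PJ w0 PJ (PK #> h)"
  moreover have "\<one> \<in> PJ" using B_PJ B_one by blast
  ultimately have "\<one> \<in> PJ <#> w0 <#> (PK #> h)" by (auto simp: opposite_objects_def)
  then obtain r n q where r: "r \<in> PJ" "n \<in> w0" "q \<in> PK" "\<one> = r \<otimes> n \<otimes> (q \<otimes> h)"
    by (auto simp: set_mult_def r_coset_def)
  have c: "r \<in> carrier G" "n \<in> carrier G" "q \<in> carrier G" using r PJ_mem w0_mem PK_mem by auto
  have "inv q \<otimes> (inv n \<otimes> inv r) \<otimes> \<one> = h"
    unfolding r(4) using c h by (simp add: group_normalize)
  then have "h = inv q \<otimes> (inv n \<otimes> inv r)" using c h by simp
  moreover have "inv n \<in> w0" using W_inv_mem[OF w0_closed r(2)] Lon.inv_w0 by simp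
  ultimately show "h \<in> opp_cell"
    using r PK_closed PJ_closed by (simp add: opp_cell_PK opp_cell_PJ w0_opp_cell)
next
  assume "h \<in> opp_cell"
  obtain n where n: "n \<in> w0" using W_nonempty w0_closed by blast
  obtain q b where q: "q \<in> PK" "b \<in> B" "h = q \<otimes> n \<otimes> b"
    using opp_cell_factor[OF \<open>h \<in> opp_cell\<close> n] .
  have c: "b \<in> carrier G" "n \<in> carrier G" "q \<in> carrier G" using q n B_sub w0_mem PK_mem by auto
  have inv_n: "inv n \<in> w0" using W_inv_mem[OF w0_closed n] Lon.inv_w0 by simp
  have "g \<in> PJ <#> w0 <#> (PK #> h)" if g: "g \<in> PJ" for g
  proof -
    have "g \<otimes> inv b \<in> PJ" using g q(2) B_PJ B_inv PJ_closed by blast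
    moreover have "inv q \<otimes> h \<in> PK #> h" using q(1) PK_closed by (auto simp: r_coset_def)
    moreover have "g = (g \<otimes> inv b) \<otimes> inv n \<otimes> (inv q \<otimes> h)"
      unfolding q(3) using c PJ_mem[OF g] by (simp add: group_normalize)
    ultimately show ?thesis using inv_n unfolding set_mult_def by blast
  qed
  then show "opposite_objects G PJ w0 PJ (PK #> h)" by (auto simp: opposite_objects_def)
qed

text \<open>The function e of the overview: it is the image under the oppositeness map of the
  indicator function of the coset \<open>PJ\<close>, and on G it is the indicator function of
  \<open>opp_cell\<close>.\<close>

definition opp_vec :: "'a set \<Rightarrow> 'k::field"
  where "opp_vec C = (if C \<in> rcosets PK \<and> opposite_objects G PJ w0 PJ C then 1 else 0)"

lemma opp_vec_coset: "h \<in> carrier G \<Longrightarrow> opp_vec (PK #> h) = (if h \<in> opp_cell then 1 else 0)"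
  using opposite_iff rcosetsI[OF PK_sub] by (simp add: opp_vec_def)

lemma PK_coset_mult: "q \<in> PK \<Longrightarrow> h \<in> carrier G \<Longrightarrow> PK #> (q \<otimes> h) = PK #> h"
  using coset_mult_assoc[OF PK_sub, of q h] coset_join2[OF _ PK_subgroup, of q] PK_mem by simp

lemma coset_act_coset:
  "h \<in> carrier G \<Longrightarrow> x \<in> carrier G \<Longrightarrow> coset_act G PK x f (PK #> h) = f (PK #> (h \<otimes> x))"
  using rcosetsI[OF PK_sub, of h] by (simp add: coset_act_def coset_mult_assoc PK_sub)

lemma coset_functions_eqI:
  assumes "f \<in> coset_functions G PK" "f' \<in> coset_functions G PK"
    "\<And>h. h \<in> carrier G \<Longrightarrow> f (PK #> h) = f' (PK #> h)"
  shows "f = f'"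
proof
  fix C
  show "f C = f' C"
  proof (cases "C \<in> rcosets PK")
    case True
    then show ?thesis using assms(3) by (auto simp: RCOSETS_def)
  next
    case False
    then show ?thesis using assms(1,2) by (simp add: coset_functions_def)
  qed
qed

lemma opp_vec_mem: "opp_vec \<in> coset_functions G PK"
  by (auto simp: coset_functions_def opp_vec_def)

lemma w0_opp_vec: "n \<in> w0 \<Longrightarrow> opp_vec (PK #> n) = 1"
  using w0_opp_cell w0_mem by (simp add: opp_vec_coset)

lemma opp_vec_nonzero: "(opp_vec :: 'a set \<Rightarrow> 'k::field) \<noteq> 0"
  using W_nonempty[OF w0_closed] w0_opp_vec by (metis zero_fun_apply zero_neq_one)

lemma opp_vec_PJ:
  assumes "g \<in> PJ"
  shows "coset_act G PK g opp_vec = (opp_vec :: 'a set \<Rightarrow> 'k::field)"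
proof (rule coset_functions_eqI)
  have g: "g \<in> carrier G" using assms PJ_mem by blast
  show "coset_act G PK g opp_vec \<in> coset_functions G PK"
    by (simp add: coset_act_def coset_functions_def)
  fix h assume h: "h \<in> carrier G"
  have "h \<otimes> g \<in> opp_cell \<longleftrightarrow> h \<in> opp_cell"
  proof
    assume "h \<otimes> g \<in> opp_cell"
    then have "h \<otimes> g \<otimes> inv g \<in> opp_cell" using opp_cell_PJ[OF PJ_closed(2)[OF assms]] by simp
    then show "h \<in> opp_cell" using h g by (simp add: group_normalize)
  qed (use assms opp_cell_PJ in auto)
  then show "coset_act G PK g opp_vec (PK #> h) = (opp_vec (PK #> h) :: 'k)"
    using h g by (simp add: coset_act_coset opp_vec_coset)
qed (rule opp_vec_mem)

section \<open>The image and its generator\<close>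

definition image_space :: "('a set \<Rightarrow> 'k::field) set"
  where "image_space = opposite_map G PJ PK w0 ` coset_functions G PJ"

lemma image_space_module: "kG_module G fun_scale (coset_act G PK) (image_space :: ('a set \<Rightarrow> 'k::field) set)"
  unfolding image_space_def
  by (rule kG_hom_image_module[OF kG_module_coset_functions[OF PJ_sub]
        kG_module_coset_functions[OF PK_sub] kG_hom_opposite_map[OF PJ_sub PK_sub w0_sub]])

lemma image_space_sub: "(image_space :: ('a set \<Rightarrow> 'k::field) set) \<subseteq> coset_functions G PK"
  using kG_hom_opposite_map[OF PJ_sub PK_sub w0_sub] unfolding image_space_def kG_hom_def by blast

lemma finite_rcosets_PJ: "finite (rcosets PJ)"
  using rcosets_subset_PowG[OF PJ_subgroup] finite_G by (meson finite_Pow_iff finite_subset)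

lemma opp_vec_image: "opp_vec \<in> (image_space :: ('a set \<Rightarrow> 'k::field) set)"
proof -
  have fin: "finite {D \<in> rcosets PJ. opposite_objects G PJ w0 D C}" for C
    using finite_rcosets_PJ by simp
  have PJ_rc: "PJ \<in> rcosets PJ"
    using rcosetsI[OF PJ_sub one_closed] coset_mult_one[OF PJ_sub] by simp
  define \<delta> :: "'a set \<Rightarrow> 'k" where "\<delta> D = (if D = PJ then 1 else 0)" for D
  have "\<delta> \<in> coset_functions G PJ"
    using PJ_rc by (auto simp: coset_functions_def \<delta>_def)
  moreover have "opposite_map G PJ PK w0 \<delta> = opp_vec"
    using PJ_rc fin by (auto simp: opposite_map_def opp_vec_def \<delta>_def fun_eq_iff sum.delta)
  ultimately show ?thesis unfolding image_space_def by (metis imageI)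
qed

text \<open>The image is spanned by the translates of \<open>opp_vec\<close>, the images of the indicator functions of
  the points of the domain.\<close>

lemma image_space_generated:
  fixes L :: "('a set \<Rightarrow> 'k::field) set"
  assumes "opp_vec \<in> L" "0 \<in> L" "\<And>u v. u \<in> L \<Longrightarrow> v \<in> L \<Longrightarrow> u + v \<in> L"
    "\<And>c v. v \<in> L \<Longrightarrow> fun_scale c v \<in> L"
    "\<And>g v. g \<in> carrier G \<Longrightarrow> v \<in> L \<Longrightarrow> coset_act G PK g v \<in> L"
  shows "image_space \<subseteq> L"
proof
  fix f assume "f \<in> (image_space :: ('a set \<Rightarrow> 'k) set)"
  then obtain f0 where f: "f = opposite_map G PJ PK w0 f0" by (auto simp: image_space_def)
  note fin = finite_rcosets_PJ
  have "\<forall>D\<in>rcosets PJ. \<exists>r\<in>carrier G. D = PJ #> r" by (auto simp: RCOSETS_def)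
  then obtain r where r: "\<And>D. D \<in> rcosets PJ \<Longrightarrow> r D \<in> carrier G" "\<And>D. D \<in> rcosets PJ \<Longrightarrow> D = PJ #> r D"
    by metis
  define S where "S A = (\<Sum>D\<in>A. fun_scale (f0 D) (coset_act G PK (inv (r D)) opp_vec))" for A
  have S_apply: "S A C = (\<Sum>D\<in>A. f0 D * coset_act G PK (inv (r D)) opp_vec C)" if "finite A" for A C
    unfolding S_def using that by (induction A) (auto simp: fun_scale_def)
  have S_L: "S A \<in> L" if "finite A" "A \<subseteq> rcosets PJ" for A
    unfolding S_def using that
  proof (induction A)
    case (insert D A)
    have "fun_scale (f0 D) (coset_act G PK (inv (r D)) opp_vec) \<in> L"
      using insert.prems r(1)[of D] by (intro assms(4,5,1)) auto
    then show ?case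
      unfolding sum.insert[OF insert.hyps] using insert by (intro assms(3)) auto
  qed (use assms(2) in simp)
  have "f = S (rcosets PJ)"
  proof
    fix C
    show "f C = S (rcosets PJ) C"
    proof (cases "C \<in> rcosets PK")
      case True
      then obtain h where h: "h \<in> carrier G" "C = PK #> h" by (auto simp: RCOSETS_def)
      have C_sub: "C \<subseteq> carrier G" using rcosets_subset_carrier[OF PK_sub True] .
      \<comment> \<open>This translate is the image of the indicator function of D: moving the pair
        (D, C) by the inverse of \<open>r D\<close> brings D to the base object
        \<open>PJ\<close>.\<close>
      have "coset_act G PK (inv (r D)) opp_vec C
          = (if opposite_objects G PJ w0 D C then 1 else (0::'k))" if D: "D \<in> rcosets PJ" for D
      proof -
        have rD: "r D \<in> carrier G" using r(1) D .
        have "(C #> inv (r D)) #> r D = C"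
          using C_sub rD by (simp add: coset_mult_assoc coset_mult_one)
        then have "opposite_objects G PJ w0 D C \<longleftrightarrow>
            opposite_objects G PJ w0 PJ (C #> inv (r D))"
          using opposite_objects_translate[OF PJ_sub w0_sub PJ_sub, of "C #> inv (r D)" "r D"]
            r(2)[OF D] rD r_coset_subset_G[OF C_sub] by simp
        then show ?thesis
          using True rcosets_translate[OF PK_sub True] rD by (simp add: coset_act_def opp_vec_def)
      qed
      then have "S (rcosets PJ) C = (\<Sum>D\<in>rcosets PJ. if opposite_objects G PJ w0 D C then f0 D else 0)"
        using S_apply[OF fin] by (auto intro: sum.cong)
      also have "\<dots> = f C"
        using True fin by (simp add: f opposite_map_def sum.inter_filter)
      finally show ?thesis by simp
    next
      case False
      then have "S (rcosets PJ) C = 0" using S_apply[OF fin] by (simp add: coset_act_def)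
      then show ?thesis using False by (simp add: f opposite_map_def)
    qed
  qed
  then show "f \<in> L" using S_L fin by simp
qed

end

section \<open>Simplicity of the image\<close>

context split_BN_pair_with_roots
begin

definition "panel_transv i T \<longleftrightarrow> transversal (parabolic G B N w {i}) B T \<and> finite T \<and> \<one> \<in> T \<and>
    (\<forall>t\<in>T - {\<one>}. t \<in> cell (w i)) \<and> p dvd card (T - {\<one>})"

lemma panel_transv_exists: "i \<in> I \<Longrightarrow> \<exists>T. panel_transv i T"
  using panel_transversal by (simp add: panel_transv_def)

lemma panel_transv_mem:
  assumes "panel_transv i T" "i \<in> I" "t \<in> T"
  shows "t \<in> parabolic G B N w {i}" "t \<in> carrier G"
  using assms parabolic_sub[of "{i}"] by (auto simp: panel_transv_def transversal_def)

text \<open>The sum over the chambers of a panel depends neither on the representatives nor on the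
  element of the panel from which it is written.\<close>

lemma panel_sum_shift:
  fixes F :: "'a \<Rightarrow> 'z::comm_monoid_add"
  assumes "panel_transv i T" "i \<in> I" "h \<in> parabolic G B N w {i}"
    "\<And>b g. b \<in> B \<Longrightarrow> g \<in> carrier G \<Longrightarrow> F (b \<otimes> g) = F g"
  shows "(\<Sum>t\<in>T. F (t \<otimes> h)) = (\<Sum>t\<in>T. F t)"
  using assms parabolic_subgroup[of "{i}"] parabolic_sub[of "{i}"] B_subgroup
  by (intro sum_transversal[of "parabolic G B N w {i}" B]) (auto simp: panel_transv_def)

text \<open>A panel containing elements of \<open>cell y\<close> and of \<open>cell (w i \<otimes> y)\<close> with \<open>w i \<otimes> y\<close> longer than
  \<open>y\<close> meets the former in one coset of \<open>B\<close> and the latter in a number of cosets divisible by \<open>p\<close>.\<close>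

lemma panel_sum_up:
  fixes F :: "'a \<Rightarrow> 'k::field"
  assumes "CHAR('k) = p" and T: "panel_transv i T" and i: "i \<in> I" and y: "y \<in> carrier W"
    and len: "Cox.len y < Cox.len (w i \<otimes>\<^bsub>W\<^esub> y)" and n: "n \<in> y"
    and F: "\<And>g. g \<in> cell (w i \<otimes>\<^bsub>W\<^esub> y) \<Longrightarrow> F g = c"
  shows "(\<Sum>t\<in>T. F (t \<otimes> n)) = F n"
proof -
  have T': "finite T" "\<one> \<in> T" "\<And>t. t \<in> T - {\<one>} \<Longrightarrow> t \<in> cell (w i)" "p dvd card (T - {\<one>})"
    using T by (auto simp: panel_transv_def)
  have "(\<Sum>t\<in>T. F (t \<otimes> n)) = F (\<one> \<otimes> n) + (\<Sum>t\<in>T - {\<one>}. F (t \<otimes> n))"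
    using T'(1,2) by (rule sum.remove)
  also have "(\<Sum>t\<in>T - {\<one>}. F (t \<otimes> n)) = (\<Sum>t\<in>T - {\<one>}. c)"
    using F cell_mult_up[OF i y len _ mem_cell[OF y n]] T'(3) by (intro sum.cong) auto
  also have "\<dots> = 0"
    using T'(4) assms(1) by (simp add: of_nat_eq_0_iff_char_dvd)
  finally show ?thesis using W_mem[OF y n] by simp
qed

end

context opposite_parabolics
begin

text \<open>With y = a w_0, the inverse of y is w_0 times the inverse of a. The latter lies in W_K
  and keeps \<alpha>_i positive, then w_0 makes it negative. So every i outside K is a left descent,
  and it leads out of the coset W_K w_0.\<close>

lemma opp_cell_left_descent:
  assumes y: "y \<in> carrier W" "y \<otimes>\<^bsub>W\<^esub> w0 \<in> WK" and i: "i \<in> I - K"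
  shows "w i \<otimes>\<^bsub>W\<^esub> y \<otimes>\<^bsub>W\<^esub> w0 \<notin> WK" "Cox.len (w i \<otimes>\<^bsub>W\<^esub> y) < Cox.len y"
proof -
  have wi: "w i \<in> carrier W" using w_in_W i by blast
  have wK: "w ` K \<subseteq> carrier W" using w_in_W K_sub by auto
  define a where "a = y \<otimes>\<^bsub>W\<^esub> w0"
  have a: "a \<in> WK" "a \<in> carrier W" using y WK_closed by (auto simp: a_def)
  have inv_a: "inv\<^bsub>W\<^esub> a \<in> WK" using W.generate_m_inv_closed[OF wK a(1)] .
  show "w i \<otimes>\<^bsub>W\<^esub> y \<otimes>\<^bsub>W\<^esub> w0 \<notin> WK"
  proof
    assume "w i \<otimes>\<^bsub>W\<^esub> y \<otimes>\<^bsub>W\<^esub> w0 \<in> WK"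
    then have "w i \<otimes>\<^bsub>W\<^esub> a \<in> WK" using wi y w0_closed by (simp add: a_def W.m_assoc)
    then have "w i \<otimes>\<^bsub>W\<^esub> a \<otimes>\<^bsub>W\<^esub> inv\<^bsub>W\<^esub> a \<in> WK" using inv_a by (rule generate.eng)
    then have "w i \<in> WK" using wi a(2) by (simp add: W.m_assoc)
    then show False using Cox.w_notin_generate K_sub i by blast
  qed
  have "y = a \<otimes>\<^bsub>W\<^esub> w0" using w0_right y by (simp add: a_def)
  then have inv_y: "inv\<^bsub>W\<^esub> y = w0 \<otimes>\<^bsub>W\<^esub> inv\<^bsub>W\<^esub> a"
    using a w0_closed by (simp add: W.inv_mult_group Lon.inv_w0)
  have "Cox.pos (\<rho> (inv\<^bsub>W\<^esub> a) (\<alpha> i))" using Cox.generate_pos[OF K_sub inv_a] i by blast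
  then have "Cox.pos (- \<rho> (inv\<^bsub>W\<^esub> y) (\<alpha> i))"
    using Lon.w0_neg_pos a w0_closed by (simp add: inv_y Cox.\<rho>_mult)
  then show "Cox.len (w i \<otimes>\<^bsub>W\<^esub> y) < Cox.len y"
    using Cox.len_left_mult_neg y(1) i by blast
qed

text \<open>If the panel meets \<open>opp_cell\<close>, in the cell of y say, its chamber in the
  shorter cell of w_i y contributes 0 and its q other chambers, all in the cell of y, contribute 1
  each; q is 0 in k.\<close>

lemma opp_vec_panel_sum:
  assumes char: "CHAR('k::field) = p" and T: "panel_transv i T" and i: "i \<in> I - K" and g: "g \<in> carrier G"
  shows "(\<Sum>t\<in>T. (opp_vec (PK #> (t \<otimes> g)) :: 'k)) = 0"
proof -
  have iI: "i \<in> I" using i by blast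
  have wi: "w i \<in> carrier W" using w_in_W iI by blast
  define F where "F h = (if h \<in> opp_cell then 1 else (0 :: 'k))" for h
  have F_eq: "opp_vec (PK #> h) = F h" if "h \<in> carrier G" for h
    using that by (simp add: F_def opp_vec_coset)
  have Tc: "t \<in> carrier G" if "t \<in> T" for t using panel_transv_mem T iI that by blast
  have eq: "(\<Sum>t\<in>T. opp_vec (PK #> (t \<otimes> g))) = (\<Sum>t\<in>T. F (t \<otimes> g))"
    using F_eq Tc g by simp
  have F_left: "F (b \<otimes> h) = F h" if "b \<in> B" "h \<in> carrier G" for b h
    using that F_eq[of h] F_eq[of "b \<otimes> h"] PK_coset_mult B_PK B_sub by simp
  have F_right: "F (h \<otimes> b) = F h" if "b \<in> B" "h \<in> carrier G" for b h
  proof -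
    have "h \<in> opp_cell" if "h \<otimes> b \<in> opp_cell"
      using opp_cell_PJ[OF B_PJ[OF B_inv[OF \<open>b \<in> B\<close>]] that] \<open>b \<in> B\<close> \<open>h \<in> carrier G\<close> B_sub
      by (simp add: group_normalize)
    then show ?thesis using opp_cell_PJ[OF B_PJ] that by (auto simp: F_def)
  qed
  have shift: "(\<Sum>t\<in>T. F (t \<otimes> (q \<otimes> h))) = (\<Sum>t\<in>T. F (t \<otimes> h))"
    if q: "q \<in> parabolic G B N w {i}" and h: "h \<in> carrier G" for q h
  proof -
    have qc: "q \<in> carrier G" using parabolic_sub[of "{i}"] iI q by auto
    have "(\<Sum>t\<in>T. F (t \<otimes> (q \<otimes> h))) = (\<Sum>t\<in>T. (\<lambda>x. F (x \<otimes> h)) (t \<otimes> q))"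
      using Tc qc h by (simp add: m_assoc)
    also have "\<dots> = (\<Sum>t\<in>T. F (t \<otimes> h))"
      using panel_sum_shift[OF T iI q, of "\<lambda>x. F (x \<otimes> h)"] F_left B_sub h by (simp add: m_assoc)
    finally show ?thesis .
  qed
  show ?thesis
  proof (cases "\<exists>t\<in>T. t \<otimes> g \<in> opp_cell")
    case False
    then show ?thesis unfolding eq by (simp add: F_def)
  next
    case True
    then obtain t0 where t0: "t0 \<in> T" "t0 \<otimes> g \<in> opp_cell" by blast
    obtain y where y: "y \<in> carrier W" "t0 \<otimes> g \<in> cell y" "y \<otimes>\<^bsub>W\<^esub> w0 \<in> WK"
      using t0(2) by (rule opp_cellE)
    define y' where "y' = w i \<otimes>\<^bsub>W\<^esub> y"
    have y': "y' \<in> carrier W" "w i \<otimes>\<^bsub>W\<^esub> y' = y" "y' \<otimes>\<^bsub>W\<^esub> w0 \<notin> WK" "Cox.len y' < Cox.len y"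
      using opp_cell_left_descent[OF y(1,3) i] wi y(1) Cox.w_cancel iI by (auto simp: y'_def)
    obtain b n c where n: "b \<in> B" "n \<in> y" "c \<in> B" "t0 \<otimes> g = b \<otimes> n \<otimes> c" using y(2) by (rule cellE)
    obtain m n' where m: "m \<in> w i" "n' \<in> y'" "n = m \<otimes> n'" using n(2) y'(2) W_mult_memE by metis
    have car: "b \<in> carrier G" "c \<in> carrier G" "m \<in> carrier G" "n' \<in> carrier G" "n \<in> carrier G"
      using n m B_sub W_mem wi y' y by blast+
    \<comment> \<open>The base point is moved inside the panel to a chamber in
      \<open>opp_cell\<close>, freed of its B-factors, and then moved by w_i to the chamber n' in
      the shorter cell.\<close>
    have "(\<Sum>t\<in>T. F (t \<otimes> g)) = (\<Sum>t\<in>T. F (t \<otimes> (t0 \<otimes> g)))"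
      using shift panel_transv_mem[OF T iI t0(1)] g by simp
    also have "\<dots> = (\<Sum>t\<in>T. F (t \<otimes> (b \<otimes> n)))"
    proof (rule sum.cong[OF refl])
      fix t assume "t \<in> T"
      then have "t \<otimes> (t0 \<otimes> g) = (t \<otimes> (b \<otimes> n)) \<otimes> c" using n(4) Tc car by (simp add: m_assoc)
      then show "F (t \<otimes> (t0 \<otimes> g)) = F (t \<otimes> (b \<otimes> n))" using F_right n(3) Tc[OF \<open>t \<in> T\<close>] car by simp
    qed
    also have "\<dots> = (\<Sum>t\<in>T. F (t \<otimes> (m \<otimes> n')))"
      using shift[of b n] B_sub_parabolic[of "{i}"] n(1) car m(3) by auto
    also have "\<dots> = (\<Sum>t\<in>T. F (t \<otimes> n'))"
      using shift[of m n'] mem_parabolic[of "{i}" i m] iI m(1) car by simp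
    also have "\<dots> = F n'"
    proof (rule panel_sum_up[OF char T iI y'(1) _ m(2)])
      show "Cox.len y' < Cox.len (w i \<otimes>\<^bsub>W\<^esub> y')" using y' by simp
      show "F h = 1" if "h \<in> cell (w i \<otimes>\<^bsub>W\<^esub> y')" for h
        using that y y'(2) opp_cell_iff[of y h] by (simp add: F_def)
    qed
    also have "\<dots> = 0" using opp_cell_iff[OF y'(1) mem_cell[OF y'(1) m(2)]] y'(3) by (simp add: F_def)
    finally show ?thesis using eq by simp
  qed
qed

text \<open>The relations for all g together are stable under linear combinations and translation,
  so they pass from the generator to the whole image.\<close>

lemma image_panel_sum:
  assumes char: "CHAR('k::field) = p" and T: "panel_transv i T" and i: "i \<in> I - K"
    and "g \<in> carrier G" "f \<in> (image_space :: ('a set \<Rightarrow> 'k) set)"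
  shows "(\<Sum>t\<in>T. f (PK #> (t \<otimes> g))) = 0"
proof -
  let ?L = "{f :: 'a set \<Rightarrow> 'k. \<forall>g\<in>carrier G. (\<Sum>t\<in>T. f (PK #> (t \<otimes> g))) = 0}"
  have Tc: "t \<in> carrier G" if "t \<in> T" for t using panel_transv_mem T i that by blast
  have "image_space \<subseteq> ?L"
  proof (rule image_space_generated)
    show "opp_vec \<in> ?L" using opp_vec_panel_sum[OF char T i] by simp
    fix g and v :: "'a set \<Rightarrow> 'k" assume "g \<in> carrier G" "v \<in> ?L"
    then show "coset_act G PK g v \<in> ?L" using Tc by (simp add: coset_act_coset m_assoc)
  qed (auto simp: fun_scale_def sum.distrib simp flip: sum_distrib_left)
  then show ?thesis using assms(4,5) by blast
qed

lemma image_fixed_points: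
  assumes char: "CHAR('k::field) = p" and f: "f \<in> (image_space :: ('a set \<Rightarrow> 'k) set)"
    and fix_f: "\<And>u. u \<in> U \<Longrightarrow> coset_act G PK u f = f"
  shows "\<exists>c. f = fun_scale c opp_vec"
proof -
  define F where "F g = f (PK #> g)" for g
  have F_PK: "F (q \<otimes> g) = F g" if "q \<in> PK" "g \<in> carrier G" for q g
    using PK_coset_mult that by (simp add: F_def)
  have F_U: "F (g \<otimes> u) = F g" if "u \<in> U" "g \<in> carrier G" for u g
  proof -
    have "u \<in> carrier G" using that(1) U_sub_B B_sub by blast
    then show ?thesis using coset_act_coset[OF that(2), of u f] fix_f[OF that(1)] by (simp add: F_def)
  qed
  \<comment> \<open>Left invariance under B and right invariance under U suffice for a constant on
    each cell: the H-part of the right factor is conjugated by n into B.\<close>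
  have F_cell: "F g = F n" if "x \<in> carrier W" "n \<in> x" "g \<in> cell x" for x n g
  proof -
    have nc: "n \<in> carrier G" using that W_mem by blast
    obtain b c where b: "b \<in> B" "c \<in> B" "g = b \<otimes> n \<otimes> c" using cell_repE[OF \<open>g \<in> cell x\<close> \<open>x \<in> carrier W\<close> \<open>n \<in> x\<close>] .
    obtain u h where uh: "u \<in> U" "h \<in> B \<inter> N" "c = h \<otimes> u" using b(2) by (rule B_decomp')
    have car: "b \<in> carrier G" "u \<in> carrier G" "h \<in> carrier G" using b uh B_sub U_sub_B by auto
    define d where "d = b \<otimes> (n \<otimes> h \<otimes> inv n)"
    have d: "d \<in> B" using b(1) w_H_conj[OF that(1,2) uh(2)] by (simp add: d_def B_mult)
    have "g = d \<otimes> n \<otimes> u" using b(3) uh(3) car nc by (simp add: d_def group_normalize)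
    then show ?thesis using F_U F_PK uh(1) d B_PK B_sub nc by simp
  qed
  have F_zero: "F g = 0" if "x \<in> carrier W" "x \<otimes>\<^bsub>W\<^esub> w0 \<notin> WK" "g \<in> cell x" for x g
    using that
  proof (induction "Cox.len w0 - Cox.len x" arbitrary: x g rule: less_induct)
    case less
    have x: "x \<in> carrier W" using less.prems by blast
    obtain n where n: "n \<in> x" using W_nonempty x by blast
    have nc: "n \<in> carrier G" using W_mem x n by blast
    have "inv\<^bsub>W\<^esub> x \<noteq> w0"
    proof
      assume "inv\<^bsub>W\<^esub> x = w0"
      then have "x = w0" using Lon.inv_w0 x by (metis W.inv_inv)
      then show False using less.prems(2) w0_right[of "\<one>\<^bsub>W\<^esub>"] w0_closed by (simp add: generate.one)
    qed
    then obtain i where i: "i \<in> I" "Cox.pos (\<rho> (inv\<^bsub>W\<^esub> x) (\<alpha> i))"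
      using Lon.ascent_exists[of "inv\<^bsub>W\<^esub> x"] x by auto
    have wi: "w i \<in> carrier W" using w_in_W i by blast
    have len: "Cox.len x < Cox.len (w i \<otimes>\<^bsub>W\<^esub> x)" using Cox.len_left_mult_pos x i by blast
    have wx: "w i \<otimes>\<^bsub>W\<^esub> x \<in> carrier W" using wi x by simp
    obtain m where m: "m \<in> w i" using W_nonempty wi by blast
    have mn: "m \<otimes> n \<in> w i \<otimes>\<^bsub>W\<^esub> x" using W_mult_mem m n by blast
    have "F n = 0"
    \<comment> \<open>For i in K, n and m n lie in the same coset of \<open>PK\<close>, and m n lies
      in a longer cell outside \<open>opp_cell\<close>. For i outside K the longer cell may lie in
      \<open>opp_cell\<close>, where F need not vanish; there its constant value enters q
      times.\<close>
    proof (cases "i \<in> K")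
      case True
      have "w i \<otimes>\<^bsub>W\<^esub> x \<otimes>\<^bsub>W\<^esub> w0 \<notin> WK"
      proof
        assume "w i \<otimes>\<^bsub>W\<^esub> x \<otimes>\<^bsub>W\<^esub> w0 \<in> WK"
        then have "w i \<otimes>\<^bsub>W\<^esub> (w i \<otimes>\<^bsub>W\<^esub> x \<otimes>\<^bsub>W\<^esub> w0) \<in> WK"
          using True by (simp add: generate.eng generate.incl)
        then have "x \<otimes>\<^bsub>W\<^esub> w0 \<in> WK" using Cox.w_cancel i x w0_closed wi by (simp add: W.m_assoc)
        then show False using less.prems(2) by blast
      qed
      then have "F (m \<otimes> n) = 0"
        using less.hyps[OF _ wx _ mem_cell[OF wx mn]] len Lon.len_le_w0[OF wx] by simp
      then show ?thesis using F_PK[of m n] mem_parabolic[OF K_sub True m] nc by simp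
    next
      case False
      obtain T where T: "panel_transv i T" using panel_transv_exists i by blast
      have "(\<Sum>t\<in>T. F (t \<otimes> n)) = F n"
        using panel_sum_up[OF char T i(1) x len n, of F] F_cell[OF wx mn] by blast
      moreover have "(\<Sum>t\<in>T. F (t \<otimes> n)) = 0"
        using image_panel_sum[OF char T _ nc f] i False by (simp add: F_def)
      ultimately show ?thesis by simp
    qed
    then show ?case using F_cell x n less.prems(3) by metis
  qed
  obtain n0 where n0: "n0 \<in> w0" using W_nonempty w0_closed by blast
  have f_mem: "f \<in> coset_functions G PK" using f image_space_sub by blast
  have "f = fun_scale (F n0) opp_vec"
  proof (rule coset_functions_eqI[OF f_mem])
    show "fun_scale (F n0) opp_vec \<in> coset_functions G PK"
      using opp_vec_mem by (auto simp: coset_functions_def fun_scale_def)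
    fix h assume h: "h \<in> carrier G"
    obtain y where y: "y \<in> carrier W" "h \<in> cell y" using h by (rule bruhat_cover)
    show "f (PK #> h) = fun_scale (F n0) opp_vec (PK #> h)"
    proof (cases "h \<in> opp_cell")
      case True
      obtain a where a: "a \<in> WK" "h \<in> cell (a \<otimes>\<^bsub>W\<^esub> w0)" using True by (auto simp: opp_cell_def)
      obtain m where m: "m \<in> a" using W_nonempty WK_closed[OF a(1)] by blast
      have "F h = F (m \<otimes> n0)"
        using F_cell[OF _ W_mult_mem[OF m n0] a(2)] WK_closed[OF a(1)] w0_closed by simp
      also have "\<dots> = F n0"
        using F_PK m a(1) mem_cell WK_closed parabolic_iff w0_mem n0 by blast
      finally show ?thesis using True h by (simp add: F_def fun_scale_def opp_vec_coset)
    next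
      case False
      then have "F h = 0" using F_zero[OF y(1) _ y(2)] opp_cell_iff[OF y] by blast
      then show ?thesis using False h by (simp add: F_def fun_scale_def opp_vec_coset)
    qed
  qed
  then show ?thesis by blast
qed

lemma opp_vec_fixed: "u \<in> U \<Longrightarrow> coset_act G PK u opp_vec = opp_vec"
  using opp_vec_PJ B_PJ U_sub_B by blast

lemma image_space_U_fixed:
  assumes "CHAR('k::field) = p"
  shows "fixed_points (coset_act G PK) (image_space :: ('a set \<Rightarrow> 'k) set) U
    = range (\<lambda>c. fun_scale c opp_vec)"
proof -
  interpret M: kG_module G fun_scale "coset_act G PK" "image_space :: ('a set \<Rightarrow> 'k) set"
    by (rule image_space_module)
  have "coset_act G PK u (fun_scale c opp_vec) = fun_scale c opp_vec"
    if "u \<in> U" for u and c :: 'k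
  proof -
    have "u \<in> carrier G" using that U_sub_B B_sub by blast
    then show ?thesis by (simp add: M.act_scale[OF _ opp_vec_image] opp_vec_fixed[OF that])
  qed
  then show ?thesis
    using image_fixed_points[OF assms] M.M_scale[OF opp_vec_image]
    by (auto simp: fixed_points_def image_iff)
qed

lemma image_space_simple:
  assumes char: "CHAR('k::field) = p"
  shows "simple_kG_module G fun_scale (coset_act G PK) (image_space :: ('a set \<Rightarrow> 'k) set)"
  unfolding simple_kG_module_def
proof (intro conjI allI impI)
  show "kG_module G fun_scale (coset_act G PK) (image_space :: ('a set \<Rightarrow> 'k) set)"
    by (rule image_space_module)
  show "image_space \<noteq> {0 :: 'a set \<Rightarrow> 'k}"
    using opp_vec_image opp_vec_nonzero by blast
  fix L :: "('a set \<Rightarrow> 'k) set"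
  assume L: "L \<subseteq> image_space \<and> kG_module G fun_scale (coset_act G PK) L"
  interpret L: kG_module G fun_scale "coset_act G PK" L using L by blast
  show "L = {0} \<or> L = image_space"
  proof (cases "L = {0}")
    case nz: False
    interpret LU: kG_module "G\<lparr>carrier := U\<rparr>" fun_scale "coset_act G PK" L
      by (rule L.restrict_group[OF U_subgroup])
    obtain a where "order (G\<lparr>carrier := U\<rparr>) = p ^ a" using U_p_group by (auto simp: order_def)
    from LU.p_group_fixed_vector[OF p_prime char this nz]
    obtain f where f: "f \<in> L" "f \<noteq> 0" "\<And>u. u \<in> U \<Longrightarrow> coset_act G PK u f = f" by auto
    then obtain c where c: "f = fun_scale c opp_vec" using image_fixed_points[OF char] L by blast
    have "c \<noteq> 0" using c f(2) by (auto simp: fun_scale_def fun_eq_iff)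
    then have "opp_vec = fun_scale (inverse c) f" by (simp add: c fun_scale_def fun_eq_iff)
    then have "opp_vec \<in> L" using L.M_scale f(1) by metis
    then have "image_space \<subseteq> L"
      by (rule image_space_generated) (auto intro: L.M_zero L.M_add L.M_scale L.act_closed)
    then show ?thesis using L by blast
  qed simp
qed

text \<open>Such a g preserves \<open>opp_cell\<close> from the right. Testing this near w_0, with g
  in the cell of x, gives w_0 x w_0 in W_K, and conjugation by w_0 brings x into W_J.\<close>

lemma opp_vec_stabilizer:
  assumes g: "g \<in> carrier G" and eq: "coset_act G PK g opp_vec = (opp_vec :: 'a set \<Rightarrow> 'k::field)"
  shows "g \<in> PJ"
proof -
  have iff: "h \<otimes> g \<in> opp_cell \<longleftrightarrow> h \<in> opp_cell" if h: "h \<in> carrier G" for h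
  proof -
    have "opp_vec (PK #> (h \<otimes> g)) = (opp_vec (PK #> h) :: 'k)"
      using coset_act_coset[OF h g, of "opp_vec :: 'a set \<Rightarrow> 'k"] eq by simp
    then show ?thesis using h g by (simp add: opp_vec_coset split: if_splits)
  qed
  obtain x where x: "x \<in> carrier W" "g \<in> cell x" using g by (rule bruhat_cover)
  obtain b n c where n: "b \<in> B" "n \<in> x" "c \<in> B" "g = b \<otimes> n \<otimes> c" using x(2) by (rule cellE)
  obtain n0 where n0: "n0 \<in> w0" using W_nonempty w0_closed by blast
  have car: "n0 \<in> carrier G" "b \<in> carrier G" "c \<in> carrier G" "n \<in> carrier G"
    using n0 w0_mem n B_sub W_mem x by blast+
  have "n0 \<otimes> inv b \<in> opp_cell" using opp_cell_PJ w0_opp_cell n0 B_PJ B_inv n(1) by blast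
  then have "n0 \<otimes> inv b \<otimes> g \<in> opp_cell" using iff car by simp
  then have "n0 \<otimes> inv b \<otimes> g \<otimes> inv c \<in> opp_cell" using opp_cell_PJ B_PJ B_inv n(3) by blast
  then have "n0 \<otimes> n \<in> opp_cell" using n(4) car by (simp add: group_normalize)
  then have "w0 \<otimes>\<^bsub>W\<^esub> x \<otimes>\<^bsub>W\<^esub> w0 \<in> WK"
    using opp_cell_iff[OF _ mem_cell[OF _ W_mult_mem[OF n0 n(2)]]] w0_closed x(1) by simp
  then have "w0 \<otimes>\<^bsub>W\<^esub> (w0 \<otimes>\<^bsub>W\<^esub> x \<otimes>\<^bsub>W\<^esub> w0) \<otimes>\<^bsub>W\<^esub> w0 \<in> WJ"
    using Lon.generate_opposite[OF Lon.opposite_cotypes_sym[OF JK_opposite]] by blast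
  moreover have "w0 \<otimes>\<^bsub>W\<^esub> (w0 \<otimes>\<^bsub>W\<^esub> x \<otimes>\<^bsub>W\<^esub> w0) \<otimes>\<^bsub>W\<^esub> w0 = x"
    using Lon.w0_w0[of "x \<otimes>\<^bsub>W\<^esub> w0"] w0_right[OF x(1)] x(1) w0_closed by (simp add: W.m_assoc)
  ultimately show ?thesis using x(2) parabolic_iff by metis
qed

lemma image_space_fixed_line:
  assumes char: "CHAR('k::field) = p"
  shows "fixed_line_property G U PJ fun_scale (coset_act G PK) (image_space :: ('a set \<Rightarrow> 'k) set)"
proof -
  interpret M: kG_module G fun_scale "coset_act G PK" "image_space :: ('a set \<Rightarrow> 'k) set"
    by (rule image_space_module)
  let ?v = "opp_vec :: 'a set \<Rightarrow> 'k"
  have fp: "fixed_points (coset_act G PK) (image_space :: ('a set \<Rightarrow> 'k) set) U = range (\<lambda>c. fun_scale c ?v)"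
    by (rule image_space_U_fixed[OF char])
  have nz: "?v \<noteq> 0" by (rule opp_vec_nonzero)
  have fixed: "coset_act G PK g (fun_scale c ?v) = fun_scale c ?v" if "g \<in> PJ" for g c
    by (simp add: M.act_scale[OF PJ_mem[OF that] opp_vec_image] opp_vec_PJ[OF that])
  have "M.dim (range (\<lambda>c. fun_scale c ?v)) = 1"
  proof -
    have "M.independent {?v}" using nz by simp
    then have "M.dim (M.span {?v}) = card {?v}"
      by (metis M.dim_span M.dim_eq_card_independent)
    then show ?thesis by (simp add: M.span_singleton)
  qed
  moreover have "subset_stabilizer G (coset_act G PK) (range (\<lambda>c. fun_scale c ?v)) = PJ"
  proof
    show "PJ \<subseteq> subset_stabilizer G (coset_act G PK) (range (\<lambda>c. fun_scale c ?v))"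
    proof
      fix g assume g: "g \<in> PJ"
      have "coset_act G PK g ` range (\<lambda>c. fun_scale c ?v) = range (\<lambda>c. fun_scale c ?v)"
        using fixed[OF g] by (simp add: image_image)
      then show "g \<in> subset_stabilizer G (coset_act G PK) (range (\<lambda>c. fun_scale c ?v))"
        using PJ_mem[OF g] by (simp add: subset_stabilizer_def)
    qed
    show "subset_stabilizer G (coset_act G PK) (range (\<lambda>c. fun_scale c ?v)) \<subseteq> PJ"
    proof
      fix g assume "g \<in> subset_stabilizer G (coset_act G PK) (range (\<lambda>c. fun_scale c ?v))"
      then have g: "g \<in> carrier G"
        and st: "coset_act G PK g ` range (\<lambda>c. fun_scale c ?v) = range (\<lambda>c. fun_scale c ?v)"
        by (auto simp: subset_stabilizer_def)
      have "?v = fun_scale 1 ?v" by (simp add: fun_scale_def)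
      then have "coset_act G PK g ?v \<in> range (\<lambda>c. fun_scale c ?v)"
        using st by (metis imageI rangeI)
      then obtain c where c: "coset_act G PK g ?v = fun_scale c ?v" by blast
      have "coset_act G PK g ?v \<noteq> 0"
      proof
        assume "coset_act G PK g ?v = 0"
        then have "?v = coset_act G PK (inv g) 0" using M.act_inv[OF g opp_vec_image] by simp
        then show False using nz M.act_zero[of "inv g"] g by simp
      qed
      then have "c \<noteq> 0" using c by (auto simp: fun_scale_def fun_eq_iff)
      \<comment> \<open>Stability of the line gives a scalar c only. Since \<open>opp_vec\<close>
        takes only the values 0 and 1, a nonzero c must be 1.\<close>
      obtain n0 where n0: "n0 \<in> w0" using W_nonempty w0_closed by blast
      have "?v (PK #> n0) = 1" using n0 by (rule w0_opp_vec)
      then have "?v (PK #> (n0 \<otimes> g)) = c"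
        using coset_act_coset[OF w0_mem[OF n0] g, of ?v] c by (simp add: fun_scale_def)
      then have "c = 1" using \<open>c \<noteq> 0\<close> w0_mem[OF n0] g by (simp add: opp_vec_coset split: if_splits)
      then have "coset_act G PK g ?v = ?v" using c by (simp add: fun_scale_def)
      then show "g \<in> PJ" using opp_vec_stabilizer g by blast
    qed
  qed
  ultimately show ?thesis
    using fixed fp by (auto simp: fixed_line_property_def)
qed

end

section \<open>Uniqueness\<close>

context opposite_parabolics
begin

text \<open>The sum over a panel of type \<open>i\<close> is a \<open>U\<close>-fixed vector stabilised by the parabolic subgroup of
  type \<open>{i}\<close>, so it can only be nonzero for \<open>i \<in> J\<close>.\<close>

lemma fixed_line_panel_sum:
  assumes M: "kG_module G smul act M" and fl: "fixed_line_property G U PJ smul act M"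
    and v: "v \<in> fixed_points act M U" and i: "i \<in> I - J" and T: "panel_transv i T"
  shows "(\<Sum>t\<in>T. act (inv t) v) = 0"
proof (rule ccontr)
  interpret kG_module G smul act M by fact
  define z where "z = (\<Sum>t\<in>T. act (inv t) v)"
  assume "(\<Sum>t\<in>T. act (inv t) v) \<noteq> 0"
  then have z0: "z \<noteq> 0" by (simp add: z_def)
  have iI: "i \<in> I" using i by blast
  let ?P = "parabolic G B N w {i}"
  have U_sub: "U \<subseteq> carrier G" using U_sub_B B_sub by blast
  have P_sub: "?P \<subseteq> carrier G" using parabolic_sub[of "{i}"] iI by blast
  have vM: "v \<in> M" using v by (simp add: fixed_points_def)
  have vPJ: "act g v = v" if "g \<in> PJ" for g
    using fl v that by (simp add: fixed_line_property_def)
  have Tc: "t \<in> carrier G" if "t \<in> T" for t using panel_transv_mem T iI that by blast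
  have zM: "z \<in> M" unfolding z_def using Tc vM by (intro M_sum act_closed) auto
  \<comment> \<open>Acting by g amounts to right multiplication of the representatives by the
    inverse of g, which permutes the cosets of the panel; v is fixed by B.\<close>
  have z_P: "act g z = z" if g: "g \<in> ?P" for g
  proof -
    have gi: "inv g \<in> ?P" using parabolic_subgroup[of "{i}"] iI g by (simp add: subgroup.m_inv_closed)
    have gc: "g \<in> carrier G" using g P_sub by blast
    have "act g z = (\<Sum>t\<in>T. act g (act (inv t) v))"
      unfolding z_def using gc Tc vM by (intro act_sum act_closed) auto
    also have "\<dots> = (\<Sum>t\<in>T. act (inv (t \<otimes> inv g)) v)"
      using gc Tc vM by (intro sum.cong) (auto simp: inv_mult_group act_mult)
    also have "\<dots> = z"
      unfolding z_def
    proof (rule panel_sum_shift[OF T iI gi])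
      fix b h assume "b \<in> B" "h \<in> carrier G"
      then show "act (inv (b \<otimes> h)) v = act (inv h) v"
        using vPJ[of "inv b"] B_PJ B_inv B_sub vM by (simp add: inv_mult_group act_mult)
    qed
    finally show ?thesis .
  qed
  have z_fix: "z \<in> fixed_points act M U"
    using zM z_P U_sub_B B_sub_parabolic by (auto simp: fixed_points_def)
  obtain v0 where v0: "fixed_points act M U = range (\<lambda>c. smul c v0)"
    using fixed_line_generator[OF M fl U_sub] by metis
  obtain c where c: "z = smul c v0" using z_fix v0 by auto
  \<comment> \<open>As z is nonzero it spans the fixed line, so the panel subgroup lies in the
    stabiliser \<open>PJ\<close>. That would put w_i in W_J although i is not in J.\<close>
  have "c \<noteq> 0" using c z0 by auto
  then have v0z: "v0 = smul (inverse c) z" by (simp add: c)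
  have "act g x = x" if g: "g \<in> ?P" and x_fix: "x \<in> fixed_points act M U" for g x
  proof -
    obtain d where "x = smul d v0" using v0 x_fix by auto
    then have x: "x = smul (d * inverse c) z" by (simp add: v0z)
    have "g \<in> carrier G" using g P_sub by blast
    then show ?thesis unfolding x using zM z_P[OF g] by (simp add: act_scale)
  qed
  then have "act g ` fixed_points act M U = fixed_points act M U" if "g \<in> ?P" for g
    using that by (simp cong: image_cong)
  then have "?P \<subseteq> subset_stabilizer G act (fixed_points act M U)"
    using P_sub by (auto simp: subset_stabilizer_def)
  then have "?P \<subseteq> PJ" using fl by (simp add: fixed_line_property_def)
  moreover obtain n where n: "n \<in> w i" using W_nonempty w_in_W iI by blast
  ultimately have "n \<in> PJ" using mem_parabolic[of "{i}" i n] iI by blast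
  then obtain x where x: "x \<in> WJ" "n \<in> cell x" by (auto simp: parabolic_iff)
  have "w i = x" using cell_unique[OF w_in_W[OF iI] WJ_closed[OF x(1)] mem_cell x(2)] w_in_W iI n by blast
  then show False using Cox.w_notin_generate[OF J_sub i] x(1) by blast
qed

text \<open>A solution of the panel relations is determined by its value at one element of w_0: on
  the cell of w_0 by the two invariances, below by right ascents. For i in J an ascent stays in a
  coset of \<open>PJ\<close>; otherwise all terms of the panel sum but the one at 1 lie in the
  longer cell and vanish.\<close>

lemma function_determined:
  fixes F :: "'a \<Rightarrow> 'k::ab_group_add"
  assumes F_U: "\<And>u g. u \<in> U \<Longrightarrow> g \<in> carrier G \<Longrightarrow> F (u \<otimes> g) = F g"
    and F_PJ: "\<And>q g. q \<in> PJ \<Longrightarrow> g \<in> carrier G \<Longrightarrow> F (g \<otimes> q) = F g"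
    and F_panel: "\<And>i T g. i \<in> I - J \<Longrightarrow> panel_transv i T \<Longrightarrow> g \<in> carrier G \<Longrightarrow> (\<Sum>t\<in>T. F (g \<otimes> inv t)) = 0"
    and n0: "n0 \<in> w0" "F n0 = 0" and g: "g \<in> carrier G"
  shows "F g = 0"
proof -
  have "F g = 0" if "x \<in> carrier W" "g \<in> cell x" for x g
    using that
  proof (induction "Cox.len w0 - Cox.len x" arbitrary: x g rule: less_induct)
    case less
    have x: "x \<in> carrier W" using less.prems by blast
    show ?case
    proof (cases "x = w0")
      case True
      then obtain b c where b: "b \<in> B" "c \<in> B" "g = b \<otimes> n0 \<otimes> c"
        using cell_repE[OF less.prems(2) x] n0(1) by blast
      obtain u h where uh: "u \<in> U" "h \<in> B \<inter> N" "b = u \<otimes> h" using b(1) by (rule B_decomp)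
      have inv_n0: "inv n0 \<in> w0" using W_inv_mem[OF w0_closed n0(1)] Lon.inv_w0 by simp
      have car: "u \<in> carrier G" "h \<in> carrier G" "c \<in> carrier G" "n0 \<in> carrier G"
        using uh b U_sub_B B_sub w0_mem n0(1) by auto
      \<comment> \<open>The H-part of b is carried across n0 into B, which leaves a factor from U on
        the left and one from B, hence from \<open>PJ\<close>, on the right.\<close>
      define d where "d = inv n0 \<otimes> h \<otimes> n0 \<otimes> c"
      have "inv n0 \<otimes> h \<otimes> inv (inv n0) \<in> B" using w_H_conj[OF w0_closed inv_n0 uh(2)] by simp
      then have d: "d \<in> B" using b(2) car by (simp add: d_def B_mult)
      have "g = u \<otimes> (n0 \<otimes> d)" using b(3) uh(3) car by (simp add: d_def group_normalize)
      then show ?thesis using F_U[OF uh(1)] F_PJ[OF B_PJ[OF d]] n0 car d B_sub by simp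
    next
      case False
      then obtain i where i: "i \<in> I" "Cox.pos (\<rho> x (\<alpha> i))" using Lon.ascent_exists x by blast
      have wi: "w i \<in> carrier W" using w_in_W i by blast
      have len: "Cox.len x < Cox.len (x \<otimes>\<^bsub>W\<^esub> w i)" using Cox.len_mult_pos x i by blast
      have xw: "x \<otimes>\<^bsub>W\<^esub> w i \<in> carrier W" using wi x by simp
      have IH: "F h = 0" if "h \<in> cell (x \<otimes>\<^bsub>W\<^esub> w i)" for h
        using less.hyps[OF _ xw that] len Lon.len_le_w0[OF xw] by simp
      have gc: "g \<in> carrier G" using cell_sub less.prems by blast
      show ?thesis
      proof (cases "i \<in> J")
        case True
        obtain n where n: "n \<in> w i" using W_nonempty wi by blast
        have "F (g \<otimes> n) = 0"
          using IH cell_mult_up_right[OF i(1) x len less.prems(2) mem_cell[OF wi n]] by blast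
        then show ?thesis using F_PJ[OF mem_parabolic[OF J_sub True n] gc] by simp
      next
        case False
        obtain T where T: "panel_transv i T" using panel_transv_exists i by blast
        have T': "finite T" "\<one> \<in> T" "\<And>t. t \<in> T - {\<one>} \<Longrightarrow> t \<in> cell (w i)"
          using T by (auto simp: panel_transv_def)
        have "F (g \<otimes> inv t) = 0" if "t \<in> T - {\<one>}" for t
          using IH cell_mult_up_right[OF i(1) x len less.prems(2)] cell_inv[OF wi T'(3)[OF that]] inv_w i(1)
          by simp
        then have "(\<Sum>t\<in>T. F (g \<otimes> inv t)) = F (g \<otimes> inv \<one>)"
          using T'(1,2) by (simp add: sum.remove)
        then show ?thesis using F_panel[OF _ T gc] i(1) False gc by simp
      qed
    qed
  qed
  then show ?thesis using bruhat_cover g by metis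
qed

text \<open>An invariant functional \<open>\<mu>\<close> embeds \<open>M\<close> into the functions on \<open>G\<close> by matrix coefficients; by
  \<open>function_determined\<close> the coefficient of the generator \<open>v\<close> is a multiple of \<open>opp_vec\<close>.\<close>

lemma simple_module_isomorphic:
  fixes smul :: "'k::field \<Rightarrow> 'm::ab_group_add \<Rightarrow> 'm"
  assumes char: "CHAR('k) = p" and simple: "simple_kG_module G smul act M"
    and fl: "fixed_line_property G U PJ smul act M"
  shows "kG_isomorphic G smul act M fun_scale (coset_act G PK) (image_space :: ('a set \<Rightarrow> 'k) set)"
proof -
  have M: "kG_module G smul act M" using simple by (simp add: simple_kG_module_def)
  interpret kG_module G smul act M by fact
  interpret A: kG_module G fun_scale "coset_act G PK" "image_space :: ('a set \<Rightarrow> 'k) set"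
    by (rule image_space_module)
  have M0: "M \<noteq> {0}" using simple by (simp add: simple_kG_module_def)
  have U_sub: "U \<subseteq> carrier G" using U_sub_B B_sub by blast
  obtain v where v: "v \<in> fixed_points act M U" "v \<noteq> 0" using fixed_line_generator[OF M fl U_sub] by metis
  have vM: "v \<in> M" using v(1) by (simp add: fixed_points_def)
  have vPJ: "act g v = v" if "g \<in> PJ" for g
    using fl v(1) that by (simp add: fixed_line_property_def)
  \<comment> \<open>An induction principle: by simplicity, a property stable under the module
    operations holds on M as soon as it holds for v.\<close>
  have generated: "M \<subseteq> {m \<in> M. Q m}" if "Q v" "Q 0"
    "\<And>x y. x \<in> M \<Longrightarrow> y \<in> M \<Longrightarrow> Q x \<Longrightarrow> Q y \<Longrightarrow> Q (x + y)"
    "\<And>c x. x \<in> M \<Longrightarrow> Q x \<Longrightarrow> Q (smul c x)"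
    "\<And>g x. g \<in> carrier G \<Longrightarrow> x \<in> M \<Longrightarrow> Q x \<Longrightarrow> Q (act g x)" for Q
  proof -
    have "{m \<in> M. Q m} = {0} \<or> {m \<in> M. Q m} = M"
      by (rule simple_submodule_cases[OF simple])
        (use that M_zero M_add M_scale act_closed in auto)
    then show ?thesis using that(1) vM v(2) by blast
  qed
  obtain a where a: "card U = p ^ a" using U_p_group by blast
  obtain \<mu> where mu: "\<mu> \<in> dual" "\<exists>x\<in>M. \<mu> x \<noteq> 0" "\<And>u x. u \<in> U \<Longrightarrow> x \<in> M \<Longrightarrow> \<mu> (act u x) = \<mu> x"
    using invariant_functional[OF p_prime char U_subgroup a M0] by metis
  have mu_add: "\<mu> (x + y) = \<mu> x + \<mu> y" if "x \<in> M" "y \<in> M" for x y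
    using mu(1) that by (simp add: dual_def)
  have mu_scale: "\<mu> (smul c x) = c * \<mu> x" if "x \<in> M" for c x
    using mu(1) that by (simp add: dual_def)
  have mu_zero: "\<mu> 0 = 0" using mu_scale[OF M_zero, of 0] by simp
  have mu_sum: "\<mu> (\<Sum>t\<in>T. f t) = (\<Sum>t\<in>T. \<mu> (f t))" if "\<And>t. t \<in> T \<Longrightarrow> f t \<in> M" for f and T :: "'a set"
    using that by (induction T rule: infinite_finite_induct) (auto simp: mu_zero mu_add M_sum)
  obtain n0 where n0: "n0 \<in> w0" using W_nonempty w0_closed by blast
  define s where "s = \<mu> (act n0 v)"
  let ?e = "opp_vec :: 'a set \<Rightarrow> 'k"
  have coeff: "\<mu> (act g v) = s * ?e (PK #> g)" if g: "g \<in> carrier G" for g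
  proof -
    define F where "F g = \<mu> (act g v) - s * ?e (PK #> g)" for g
    have "F g = 0"
    proof (rule function_determined[OF _ _ _ n0 _ g])
      show "F n0 = 0" by (simp add: F_def s_def w0_opp_vec[OF n0])
      show "F (u \<otimes> h) = F h" if "u \<in> U" "h \<in> carrier G" for u h
        using that U_sub mu(3) act_mult vM act_closed PK_coset_mult B_PK U_sub_B
        by (simp add: F_def subset_iff)
      show "F (h \<otimes> q) = F h" if "q \<in> PJ" "h \<in> carrier G" for q h
      proof -
        have "?e (PK #> (h \<otimes> q)) = ?e (PK #> h)"
          using coset_act_coset[OF that(2) PJ_mem[OF that(1)], of ?e] opp_vec_PJ[OF that(1)] by metis
        then show ?thesis using that PJ_mem vPJ vM by (simp add: F_def act_mult)
      qed
      fix i T h assume i: "i \<in> I - J" and T: "panel_transv i T" and h: "h \<in> carrier G"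
      have Tc: "t \<in> carrier G" if "t \<in> T" for t using panel_transv_mem T i that by blast
      have "(\<Sum>t\<in>T. \<mu> (act (h \<otimes> inv t) v)) = \<mu> (\<Sum>t\<in>T. act h (act (inv t) v))"
        using Tc h vM by (subst mu_sum) (auto simp: act_closed act_mult)
      also have "(\<Sum>t\<in>T. act h (act (inv t) v)) = act h (\<Sum>t\<in>T. act (inv t) v)"
        using Tc h vM by (subst act_sum) (auto simp: act_closed)
      also have "\<mu> \<dots> = 0"
        using fixed_line_panel_sum[OF M fl v(1) i T] h by (simp add: act_zero mu_zero)
      finally have 1: "(\<Sum>t\<in>T. \<mu> (act (h \<otimes> inv t) v)) = 0" .
      \<comment> \<open>The image is itself a module with the fixed line property, so
        \<open>opp_vec\<close> satisfies the panel relations that v satisfies.\<close>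
      have "?e \<in> fixed_points (coset_act G PK) image_space U"
        using opp_vec_image opp_vec_fixed by (auto simp: fixed_points_def)
      from fixed_line_panel_sum[OF image_space_module image_space_fixed_line[OF char] this i T]
      have "0 = (\<Sum>t\<in>T. coset_act G PK (inv t) ?e) (PK #> h)" by simp
      also have "\<dots> = (\<Sum>t\<in>T. coset_act G PK (inv t) ?e (PK #> h))"
        by (induction T rule: infinite_finite_induct) auto
      also have "\<dots> = (\<Sum>t\<in>T. ?e (PK #> (h \<otimes> inv t)))"
        using Tc h by (intro sum.cong) (auto simp: coset_act_coset)
      finally have 2: "(\<Sum>t\<in>T. ?e (PK #> (h \<otimes> inv t))) = 0" by simp
      show "(\<Sum>t\<in>T. F (h \<otimes> inv t)) = 0"
        by (simp add: F_def sum_subtractf 1 2 flip: sum_distrib_left)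
    qed
    then show ?thesis by (simp add: F_def)
  qed
  \<comment> \<open>If s were 0, the functional would vanish on all translates of v, hence on
    M.\<close>
  have s0: "s \<noteq> 0"
  proof
    assume "s = 0"
    then have "M \<subseteq> {m \<in> M. \<forall>g\<in>carrier G. \<mu> (act g m) = 0}"
      using coeff
      by (intro generated)
        (auto simp: act_zero mu_zero act_add mu_add act_scale mu_scale act_closed act_mult[symmetric])
    then have "\<mu> x = 0" if "x \<in> M" for x using that act_one[OF that] by (metis (mono_tags, lifting) CollectD one_closed subsetD)
    then show False using mu(2) by blast
  qed
  \<comment> \<open>For v this is visible from \<open>coeff\<close>. The quantification over all h
    makes the property stable under the action, so it spreads to M.\<close>
  have PK_inv: "\<mu> (act (q \<otimes> h) m) = \<mu> (act h m)" if "q \<in> PK" "h \<in> carrier G" "m \<in> M" for q h m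
  proof -
    have "M \<subseteq> {m \<in> M. \<forall>h\<in>carrier G. \<forall>q\<in>PK. \<mu> (act (q \<otimes> h) m) = \<mu> (act h m)}"
    proof (rule generated)
      show "\<forall>h\<in>carrier G. \<forall>q\<in>PK. \<mu> (act (q \<otimes> h) v) = \<mu> (act h v)"
        using coeff PK_coset_mult PK_mem by simp
    next
      fix g x assume g: "g \<in> carrier G" and x: "x \<in> M"
        and *: "\<forall>h\<in>carrier G. \<forall>q\<in>PK. \<mu> (act (q \<otimes> h) x) = \<mu> (act h x)"
      show "\<forall>h\<in>carrier G. \<forall>q\<in>PK. \<mu> (act (q \<otimes> h) (act g x)) = \<mu> (act h (act g x))"
      proof (intro ballI)
        fix h q assume hq: "h \<in> carrier G" "q \<in> PK"
        have "\<mu> (act (q \<otimes> (h \<otimes> g)) x) = \<mu> (act (h \<otimes> g) x)" using * hq g by simp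
        then show "\<mu> (act (q \<otimes> h) (act g x)) = \<mu> (act h (act g x))"
          using hq g x PK_mem by (simp add: act_mult[symmetric] m_assoc)
      qed
    qed (auto simp: act_zero mu_zero act_add mu_add act_scale mu_scale act_closed PK_mem)
    then show ?thesis using that by blast
  qed
  \<comment> \<open>A coset representative, needed to regard the coefficient g \<mapsto> \<mu> (g m)
    as a function on cosets; by \<open>PK_inv\<close> its choice does not affect the value on
    M.\<close>
  define r where "r C = (SOME g. g \<in> carrier G \<and> C = PK #> g)" for C
  define \<psi> where "\<psi> m C = (if C \<in> rcosets PK then \<mu> (act (r C) m) else 0)" for m C
  have psi: "\<psi> m (PK #> h) = \<mu> (act h m)" if h: "h \<in> carrier G" and m: "m \<in> M" for m h
  proof -
    have r: "r (PK #> h) \<in> carrier G" "PK #> h = PK #> r (PK #> h)"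
      using someI[of "\<lambda>g. g \<in> carrier G \<and> PK #> h = PK #> g" h] h unfolding r_def by blast+
    have "r (PK #> h) \<in> PK #> h" using rcos_self[OF r(1) PK_subgroup] r(2) by simp
    then obtain q where "q \<in> PK" "r (PK #> h) = q \<otimes> h" by (auto simp: r_coset_def)
    then show ?thesis using PK_inv h m rcosetsI[OF PK_sub h] by (simp add: \<psi>_def)
  qed
  have psi_mem: "\<psi> m \<in> coset_functions G PK" for m by (simp add: coset_functions_def \<psi>_def)
  have F_mod: "kG_module G fun_scale (coset_act G PK) (coset_functions G PK :: ('a set \<Rightarrow> 'k) set)"
    by (rule kG_module_coset_functions[OF PK_sub])
  interpret F: kG_module G fun_scale "coset_act G PK" "coset_functions G PK :: ('a set \<Rightarrow> 'k) set"
    by (rule F_mod)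
  have psi_add: "\<psi> (x + y) = \<psi> x + \<psi> y" if "x \<in> M" "y \<in> M" for x y
    using that by (intro coset_functions_eqI psi_mem F.M_add) (simp add: psi M_add act_add mu_add act_closed)
  have psi_scale: "\<psi> (smul c x) = fun_scale c (\<psi> x)" if "x \<in> M" for c x
    using that by (intro coset_functions_eqI psi_mem F.M_scale)
      (simp add: psi M_scale act_scale mu_scale act_closed fun_scale_def)
  have psi_act: "\<psi> (act g x) = coset_act G PK g (\<psi> x)" if "g \<in> carrier G" "x \<in> M" for g x
    using that by (intro coset_functions_eqI psi_mem F.act_closed)
      (simp_all add: psi act_closed coset_act_coset act_mult)
  have psi_v: "\<psi> v = fun_scale s ?e"
    using vM by (intro coset_functions_eqI psi_mem F.M_scale opp_vec_mem)
      (simp add: psi coeff fun_scale_def)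
  have psi_zero: "\<psi> 0 = 0" using psi_scale[OF M_zero, of 0] by (simp add: fun_scale_def fun_eq_iff)
  have psi_image: "\<psi> ` M \<subseteq> image_space"
  proof -
    have "M \<subseteq> {m \<in> M. \<psi> m \<in> image_space}"
      by (rule generated)
        (auto simp: psi_v psi_zero psi_add psi_scale psi_act A.M_zero
          intro: A.M_scale opp_vec_image A.M_add A.act_closed)
    then show ?thesis by blast
  qed
  have hom: "kG_hom G smul act M fun_scale (coset_act G PK) image_space \<psi>"
    using psi_image psi_add psi_scale psi_act by (auto simp: kG_hom_def)
  have psi_v0: "\<psi> v \<noteq> 0"
  proof
    assume "\<psi> v = 0"
    then have "fun_scale s ?e (PK #> n0) = 0" by (metis psi_v zero_fun_apply)
    then show False using s0 by (simp add: fun_scale_def w0_opp_vec[OF n0])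
  qed
  have "kG_module G fun_scale (coset_act G PK) (\<psi> ` M)"
    by (rule kG_hom_image_module[OF M image_space_module hom])
  then have "\<psi> ` M = image_space"
    using image_space_simple[OF char] psi_image psi_v0 vM unfolding simple_kG_module_def by blast
  moreover have "inj_on \<psi> M"
  proof -
    have ker: "{m \<in> M. \<psi> m = 0} = {0}"
    proof -
      have "{m \<in> M. \<psi> m = 0} = {0} \<or> {m \<in> M. \<psi> m = 0} = M"
        by (rule simple_submodule_cases[OF simple])
          (auto simp: psi_zero psi_add psi_scale psi_act M_zero M_add M_scale act_closed F.act_zero A.scale_zero_right)
      then show ?thesis using psi_v0 vM by blast
    qed
    show ?thesis
    proof (rule inj_onI)
      fix x y assume xy: "x \<in> M" "y \<in> M" "\<psi> x = \<psi> y"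
      have neg: "smul (- 1) y \<in> M" using xy M_scale by blast
      have "\<psi> (x + smul (- 1) y) = \<psi> y + fun_scale (- 1) (\<psi> y)"
        using xy neg by (simp only: psi_add psi_scale)
      also have "\<dots> = 0" by (simp add: fun_scale_def fun_eq_iff)
      finally have "x + smul (- 1) y = 0" using ker M_add[OF xy(1) neg] by blast
      then show "x = y" by simp
    qed
  qed
  ultimately show ?thesis
    using hom unfolding kG_isomorphic_def bij_betw_def by blast
qed

end

theorem theorem4p1:
  fixes G :: "('g, 'x) monoid_scheme"
    and B N U :: "'g set"
    and p l :: nat
    and w :: "nat \<Rightarrow> 'g set"
    and \<rho> :: "'g set \<Rightarrow> 'v::euclidean_space \<Rightarrow> 'v"
    and R :: "'v set"
    and \<alpha> :: "nat \<Rightarrow> 'v"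
    and w0 :: "'g set"
    and J K :: "nat set"
    and P\<^sub>J P\<^sub>K :: "'g set"
    and F\<^sub>J :: "('g set \<Rightarrow> 'k::alg_closed_field) set"
    and \<eta> :: "('g set \<Rightarrow> 'k) \<Rightarrow> 'g set \<Rightarrow> 'k"
  assumes "split_BN_pair_with_roots G B N {1..l} w U p \<rho> R \<alpha>"
    and "longest_element (weyl_group G B N) (w ` {1..l}) w0"
    and "opposite_cotypes {1..l} \<alpha> (\<rho> w0) J K"
    and "CHAR('k) = p"
    and "P\<^sub>J = parabolic G B N w J"
    and "P\<^sub>K = parabolic G B N w K"
    and "F\<^sub>J = coset_functions G P\<^sub>J"
    and "\<eta> = opposite_map G P\<^sub>J P\<^sub>K w0"
  shows "simple_kG_module G fun_scale (coset_act G P\<^sub>K) (\<eta> ` F\<^sub>J) \<and>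
    fixed_line_property G U P\<^sub>J fun_scale (coset_act G P\<^sub>K) (\<eta> ` F\<^sub>J) \<and>
    (\<forall>(smul :: 'k \<Rightarrow> 'm::ab_group_add \<Rightarrow> 'm) act M.
      simple_kG_module G smul act M \<and> fixed_line_property G U P\<^sub>J smul act M \<longrightarrow>
      kG_isomorphic G smul act M fun_scale (coset_act G P\<^sub>K) (\<eta> ` F\<^sub>J))"
proof -
  interpret opposite_parabolics G B N "{1..l}" w U p \<rho> R \<alpha> w0 J K
    using assms(1-3) by (simp add: opposite_parabolics_def opposite_parabolics_axioms_def)
  have "\<eta> ` F\<^sub>J = image_space"
    by (simp add: image_space_def assms(5-8))
  then show ?thesis
    unfolding assms(5,6)
    by (auto intro: image_space_simple image_space_fixed_line simple_module_isomorphic assms(4))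
qed

end
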